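(* Prop-CFD (given an instance of the connected fair division problem, does it admit a proportional valid allocation?) is solvable in polynomial time on instances whose graph $G$ is a star.
   Context: An instance of the connected fair division problem (CFD) is a triple $I=(G,N,\mathcal U)$ where $G=(V,E)$ is a finite undirected graph whose vertices are called items, $N=\{1,\dots,n\}$ is a set of players, and $\mathcal U=(u_1,\dots,u_n)$ with $u_i:V\to\mathbb Q_{\ge 0}$ and $\sum_{v\in V}u_i(v)=1$ for every $i$. Utilities are additive: $u_i(X)=\sum_{v\in X}u_i(v)$. An allocation $\pi:N\to 2^V$ is valid if each $\pi(i)$ induces a connected subgraph of $G$ and $\pi(i)\cap\pi(j)=\emptyset$ for $i\neq j$. A valid allocation is proportional if $u_i(\pi(i))\ge 1/n$ for all $i\in N$. *)

theory Defs
  imports Complex_Main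
begin

section \<open>Connected fair division (CFD)\<close>

text \<open>A graph is given by a finite vertex set V and a set E of undirected edges,
  each edge being a two-element set of vertices.\<close>

definition edges_ok :: "'v set \<Rightarrow> 'v set set \<Rightarrow> bool" where
  "edges_ok V E \<longleftrightarrow> (\<forall>e\<in>E. \<exists>a b. e = {a, b} \<and> a \<noteq> b \<and> a \<in> V \<and> b \<in> V)"

text \<open>X induces a connected subgraph: any two vertices of X are joined by a path
  all of whose vertices lie in X (the empty set counts as connected).\<close>
definition induces_connected :: "'v set set \<Rightarrow> 'v set \<Rightarrow> bool" where
  "induces_connected E X \<longleftrightarrow>
     (\<forall>x\<in>X. \<forall>y\<in>X. (x, y) \<in> {(a, b). a \<in> X \<and> b \<in> X \<and> {a, b} \<in> E}\<^sup>*)"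

text \<open>An instance (G, N, U) with G = (V,E), N = {1..n}, utilities u i :: V \<Rightarrow> Q>=0
  summing to 1 for each player.\<close>
definition cfd_instance :: "'v set \<Rightarrow> 'v set set \<Rightarrow> nat \<Rightarrow> (nat \<Rightarrow> 'v \<Rightarrow> rat) \<Rightarrow> bool" where
  "cfd_instance V E n u \<longleftrightarrow> finite V \<and> edges_ok V E \<and>
     (\<forall>i\<in>{1..n}. (\<forall>v\<in>V. 0 \<le> u i v) \<and> sum (u i) V = 1)"

definition valid_allocation :: "'v set \<Rightarrow> 'v set set \<Rightarrow> nat \<Rightarrow> (nat \<Rightarrow> 'v set) \<Rightarrow> bool" where
  "valid_allocation V E n \<pi> \<longleftrightarrow>
     (\<forall>i\<in>{1..n}. \<pi> i \<subseteq> V \<and> induces_connected E (\<pi> i)) \<and>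
     (\<forall>i\<in>{1..n}. \<forall>j\<in>{1..n}. i \<noteq> j \<longrightarrow> \<pi> i \<inter> \<pi> j = {})"

definition proportional :: "nat \<Rightarrow> (nat \<Rightarrow> 'v \<Rightarrow> rat) \<Rightarrow> (nat \<Rightarrow> 'v set) \<Rightarrow> bool" where
  "proportional n u \<pi> \<longleftrightarrow> (\<forall>i\<in>{1..n}. sum (u i) (\<pi> i) \<ge> 1 / of_nat n)"

definition has_proportional_allocation ::
  "'v set \<Rightarrow> 'v set set \<Rightarrow> nat \<Rightarrow> (nat \<Rightarrow> 'v \<Rightarrow> rat) \<Rightarrow> bool" where
  "has_proportional_allocation V E n u \<longleftrightarrow>
     (\<exists>\<pi>. valid_allocation V E n \<pi> \<and> proportional n u \<pi>)"

text \<open>G is a star: some centre c is adjacent to every other vertex and these are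
  all the edges (K_{1,t}, t >= 0).\<close>
definition is_star :: "'v set \<Rightarrow> 'v set set \<Rightarrow> bool" where
  "is_star V E \<longleftrightarrow> (\<exists>c\<in>V. E = {{c, v} | v. v \<in> V \<and> v \<noteq> c})"

section \<open>Machine model: deterministic single-tape Turing machines\<close>

datatype sym = Blank | Zero | One | Sep
datatype dir = MoveL | MoveR | Stay

text \<open>A TM is (K, delta): states 0..<K, start state 0, accept state 1, reject state 2
  (both halting).\<close>
type_synonym tm = "nat \<times> (nat \<Rightarrow> sym \<Rightarrow> nat \<times> sym \<times> dir)"
type_synonym config = "nat \<times> (int \<Rightarrow> sym) \<times> int"

definition wf_tm :: "tm \<Rightarrow> bool" where
  "wf_tm M \<longleftrightarrow> 3 \<le> fst M \<and> (\<forall>q < fst M. \<forall>s. fst (snd M q s) < fst M)"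

definition move :: "dir \<Rightarrow> int" where
  "move d = (case d of MoveL \<Rightarrow> -1 | MoveR \<Rightarrow> 1 | Stay \<Rightarrow> 0)"

definition tm_step :: "tm \<Rightarrow> config \<Rightarrow> config" where
  "tm_step M c = (case c of (q, t, p) \<Rightarrow>
     if q = 1 \<or> q = 2 then c
     else (case snd M q (t p) of (q', s, d) \<Rightarrow> (q', t(p := s), p + move d)))"

definition tm_init :: "sym list \<Rightarrow> config" where
  "tm_init w = (0, \<lambda>i. if 0 \<le> i \<and> nat i < length w then w ! nat i else Blank, 0)"

text \<open>M, started on w, has halted after k steps and its verdict equals b.\<close>
definition decides_in :: "tm \<Rightarrow> sym list \<Rightarrow> nat \<Rightarrow> bool \<Rightarrow> bool" where
  "decides_in M w k b \<longleftrightarrow>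
     (let q = fst ((tm_step M ^^ k) (tm_init w)) in (q = 1 \<or> q = 2) \<and> (q = 1 \<longleftrightarrow> b))"

section \<open>Standard binary encoding of CFD instances\<close>

fun bits :: "nat \<Rightarrow> sym list" where
  "bits n = (if n = 0 then [] else (if n mod 2 = 0 then Zero else One) # bits (n div 2))"

definition enc_nats :: "nat list \<Rightarrow> sym list" where
  "enc_nats xs = concat (map (\<lambda>x. bits x @ [Sep]) xs)"

definition enc_rat :: "rat \<Rightarrow> nat list" where
  "enc_rat r = [nat (fst (quotient_of r)), nat (snd (quotient_of r))]"

text \<open>An instance with vertex set {0..<m}, edge list es, players 1..n and
  utility table u is encoded as the list of numbers
  m, |es|, the endpoints of the edges, n, and numerator/denominator of every u i v.\<close>
definition enc_instance :: "nat \<Rightarrow> (nat \<times> nat) list \<Rightarrow> nat \<Rightarrow> (nat \<Rightarrow> nat \<Rightarrow> rat) \<Rightarrow> sym list" where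
  "enc_instance m es n u = enc_nats
     ([m, length es] @ concat (map (\<lambda>(a, b). [a, b]) es) @ [n] @
      concat [enc_rat (u i v). i \<leftarrow> [1..<n+1], v \<leftarrow> [0..<m]])"

definition edge_set :: "(nat \<times> nat) list \<Rightarrow> nat set set" where
  "edge_set es = {{a, b} | a b. (a, b) \<in> set es}"

end

theory Submission
  imports Defs "HOL-Library.Stream"
begin

text \<open>In a proportional allocation on a star every player except one, say j, receives a single leaf
  worth at least 1/n to them, and j may be given the centre and all remaining leaves. For fixed j,
  one therefore needs a matching of the other players into acceptable leaves that minimises the
  total value, for j, of the leaves used. The matchable sets of leaves form a matroid, so the greedy
  choice is optimal: a leaf is used iff it increases the maximum size of a matching, when the
  leaves are considered in the order of their value for j. Maximum matchings are found by an auction.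

  To obtain a Turing machine, programs on finitely many stacks are simulated on one tape, and the
  functions computed by them in polynomial time, on binary trees coded by words, are shown to be
  closed under composition, pairing and iteration with polynomially bounded intermediate
  results. The algorithm is then an ordinary function built from these operations.\<close>

section \<open>Structured programs for Turing machines\<close>

text \<open>The greedy choice suits a machine because it can be expressed through ranks alone:
  whether a leaf is used depends on two maximum matching sizes, so no partial choice has to be
  stored. Leaves are therefore the left vertices (bidders) and players the right ones (objects). The
  auction is convenient because a round is one local update, without a search for augmenting paths,
  and because its final prices exhibit a vertex cover of the size of the matching. This yields
  Koenig's theorem, from which in turn the exchange property of matchable sets is derived. The
  obstacle on the machine side is size: a polynomial-time map iterated polynomially often may
  produce exponentially long results, hence every iteration rule carries a bound on intermediate
  values. On the level of functions, loops are counted by the symbols of a word, so termination is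
  built in. Numbers have to be binary because the common denominator of a player's utilities is a
  product of all denominators, which has polynomially many bits but possibly exponential
  value.\<close>

type_synonym zipper = "sym stream \<times> sym stream"

datatype tprog =
    TAct "sym \<Rightarrow> sym" dir
  | TSeq tprog tprog
  | TIf "sym \<Rightarrow> bool" tprog tprog
  | TWhile "sym \<Rightarrow> bool" tprog

text \<open>The head stands on the first symbol of the right stream, and the left stream is read
  outwards from the head. Tape contents thus need no absolute positions.\<close>

definition act :: "(sym \<Rightarrow> sym) \<Rightarrow> dir \<Rightarrow> zipper \<Rightarrow> zipper" where
  "act f d z = (case z of (l, r) \<Rightarrow>
     (case d of Stay \<Rightarrow> (l, f (shd r) ## stl r)
      | MoveR \<Rightarrow> (f (shd r) ## l, stl r)
      | MoveL \<Rightarrow> (stl l, shd l ## f (shd r) ## stl r)))"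

text \<open>The number is only an upper bound, owing to \<open>texec_relax\<close>. The surcharge 2
  for a conditional or an iteration pays for the test and for the jump behind the other branch or
  back to the test; the else branch has no second jump but is charged alike.\<close>

inductive texec :: "tprog \<Rightarrow> zipper \<Rightarrow> nat \<Rightarrow> zipper \<Rightarrow> bool" where
  texec_Act: "texec (TAct f d) z 1 (act f d z)"
| texec_Seq: "texec p z n z' \<Longrightarrow> texec q z' n' z'' \<Longrightarrow> texec (TSeq p q) z (n + n') z''"
| texec_IfT: "b (shd (snd z)) \<Longrightarrow> texec p z n z' \<Longrightarrow> texec (TIf b p q) z (n + 2) z'"
| texec_IfF: "\<not> b (shd (snd z)) \<Longrightarrow> texec q z n z' \<Longrightarrow> texec (TIf b p q) z (n + 2) z'"
| texec_WhileF: "\<not> b (shd (snd z)) \<Longrightarrow> texec (TWhile b p) z 1 z"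
| texec_WhileT: "b (shd (snd z)) \<Longrightarrow> texec p z n z' \<Longrightarrow> texec (TWhile b p) z' n' z'' \<Longrightarrow>
    texec (TWhile b p) z (n + n' + 2) z''"
| texec_relax: "texec p z n z' \<Longrightarrow> n \<le> m \<Longrightarrow> texec p z m z'"

primrec tlen :: "tprog \<Rightarrow> nat" where
  "tlen (TAct f d) = 1"
| "tlen (TSeq p q) = tlen p + tlen q"
| "tlen (TIf b p q) = tlen p + tlen q + 2"
| "tlen (TWhile b p) = tlen p + 2"

text \<open>The code of \<open>p\<close> occupies \<open>tlen p\<close> states from \<open>a\<close>
  on and exits through state \<open>a + tlen p\<close>, which makes sequencing a juxtaposition. The
  additional states are the tests and the jumps that end a then branch or a loop body.\<close>

primrec tdelta :: "tprog \<Rightarrow> nat \<Rightarrow> nat \<Rightarrow> sym \<Rightarrow> nat \<times> sym \<times> dir" where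
  "tdelta (TAct f d) a q s = (a + 1, f s, d)"
| "tdelta (TSeq p1 p2) a q s =
     (if q < a + tlen p1 then tdelta p1 a q s else tdelta p2 (a + tlen p1) q s)"
| "tdelta (TIf b p1 p2) a q s =
     (if q = a then (if b s then a + 1 else a + 2 + tlen p1, s, Stay)
      else if q < a + 1 + tlen p1 then tdelta p1 (a + 1) q s
      else if q = a + 1 + tlen p1 then (a + 2 + tlen p1 + tlen p2, s, Stay)
      else tdelta p2 (a + 2 + tlen p1) q s)"
| "tdelta (TWhile b p) a q s =
     (if q = a then (if b s then a + 1 else a + 2 + tlen p, s, Stay)
      else if q < a + 1 + tlen p then tdelta p (a + 1) q s
      else (a, s, Stay))"

lemma tdelta_bound:
  "a \<le> q \<Longrightarrow> q < a + tlen p \<Longrightarrow> fst (tdelta p a q s) \<le> a + tlen p"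
proof (induction p arbitrary: a q)
  case (TSeq p1 p2)
  show ?case using TSeq.IH(1)[of a q] TSeq.IH(2)[of "a + tlen p1" q] TSeq.prems by force
next
  case (TIf b p1 p2)
  show ?case using TIf.IH(1)[of "a+1" q] TIf.IH(2)[of "a + 2 + tlen p1" q] TIf.prems by force
next
  case (TWhile b p)
  show ?case using TWhile.IH(1)[of "a+1" q] TWhile.prems by force
qed auto

definition zip_rel :: "zipper \<Rightarrow> (int \<Rightarrow> sym) \<Rightarrow> int \<Rightarrow> bool" where
  "zip_rel z t p \<longleftrightarrow>
     (\<forall>k. t (p + int k) = snd z !! k) \<and> (\<forall>k. t (p - 1 - int k) = fst z !! k)"

lemma zip_rel_head: "zip_rel z t p \<Longrightarrow> t p = shd (snd z)"
  unfolding zip_rel_def by (metis add_0_right int_ops(1) snth.simps(1))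

lemma zip_rel_act:
  assumes "zip_rel z t p"
  shows "zip_rel (act f d z) (t(p := f (t p))) (p + move d)"
proof -
  obtain l r where z: "z = (l, r)" by (cases z)
  have r: "t (p + int k) = r !! k" for k using assms by (auto simp: zip_rel_def z)
  have l: "t (p - 1 - int k) = l !! k" for k using assms by (auto simp: zip_rel_def z)
  have h: "t p = shd r" using r[of 0] by simp
  show ?thesis
  proof (cases d)
    case MoveL
    have "(t(p := f (t p))) (p - 1 + int k) = (shd l ## f (shd r) ## stl r) !! k" for k
    proof -
      consider "k = 0" | "k = 1" | k' where "k = Suc (Suc k')"
        by (metis One_nat_def not0_implies_Suc)
      then show ?thesis
      proof cases
        case 1 then show ?thesis using l[of 0] by simp
      next
        case 2 then show ?thesis using h by simp
      next
        case 3
        have k: "p - 1 + int k = p + int (Suc k')" using 3 by simp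
        show ?thesis unfolding k using r[of "Suc k'"] 3 by simp
      qed
    qed
    moreover have "(t(p := f (t p))) (p - 1 - 1 - int k) = stl l !! k" for k
      using l[of "Suc k"] by (simp add: algebra_simps)
    ultimately show ?thesis
      by (simp add: act_def z MoveL zip_rel_def move_def h)
  next
    case MoveR
    have "(t(p := f (t p))) (p + 1 + int k) = stl r !! k" for k
      using r[of "Suc k"] by (simp add: algebra_simps)
    moreover have "(t(p := f (t p))) (p - int k) = (f (shd r) ## l) !! k" for k
    proof (cases k)
      case 0 then show ?thesis using h by simp
    next
      case (Suc k')
      then show ?thesis using l[of k'] by (simp add: algebra_simps)
    qed
    ultimately show ?thesis
      by (simp add: act_def z MoveR zip_rel_def move_def h)
  next
    case Stay
    have "(t(p := f (t p))) (p + int k) = (f (shd r) ## stl r) !! k" for k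
      using r[of k] h by (cases k) auto
    moreover have "(t(p := f (t p))) (p - 1 - int k) = l !! k" for k
      using l[of k] by simp
    ultimately show ?thesis
      by (simp add: act_def z Stay zip_rel_def move_def)
  qed
qed

definition reaches :: "tm \<Rightarrow> config \<Rightarrow> nat \<Rightarrow> config \<Rightarrow> bool" where
  "reaches M c n c' \<longleftrightarrow> (\<exists>k\<le>n. (tm_step M ^^ k) c = c')"

lemma reaches_trans:
  assumes "reaches M c n c'" "reaches M c' m c''" shows "reaches M c (n + m) c''"
proof -
  obtain k k' where "k \<le> n" "(tm_step M ^^ k) c = c'" "k' \<le> m" "(tm_step M ^^ k') c' = c''"
    using assms by (auto simp: reaches_def)
  then have "k' + k \<le> n + m" "(tm_step M ^^ (k' + k)) c = c''" by (auto simp: funpow_add)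
  then show ?thesis unfolding reaches_def by blast
qed

lemma reaches_mono: "reaches M c n c' \<Longrightarrow> n \<le> m \<Longrightarrow> reaches M c m c'"
  unfolding reaches_def using order.trans by blast

lemma reaches_step: "tm_step M c = c' \<Longrightarrow> reaches M c 1 c'"
  unfolding reaches_def by (intro exI[of _ 1]) simp

lemma reaches_stay:
  assumes "snd M q (t p) = (q', t p, Stay)" "3 \<le> q"
  shows "reaches M (q, t, p) 1 (q', t, p)"
  by (rule reaches_step) (use assms in \<open>auto simp: tm_step_def move_def\<close>)

text \<open>\<open>M\<close> is constrained on the states of the block only, so the induction
  hypotheses apply to subprograms embedded in the same machine. With \<open>3 \<le> a\<close> the
  block stays clear of the halting states 1 and 2.\<close>

lemma texec_reaches:
  assumes "texec p z n z'" "3 \<le> a"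
    and "\<forall>q s. a \<le> q \<and> q < a + tlen p \<longrightarrow> snd M q s = tdelta p a q s"
    and "zip_rel z t pos"
  shows "\<exists>t' pos'. reaches M (a, t, pos) n (a + tlen p, t', pos') \<and> zip_rel z' t' pos'"
  using assms
proof (induction arbitrary: a t pos rule: texec.induct)
  case (texec_Act f d z)
  have "reaches M (a, t, pos) 1 (a + 1, t(pos := f (t pos)), pos + move d)"
    by (rule reaches_step) (use texec_Act in \<open>auto simp: tm_step_def\<close>)
  then show ?case using zip_rel_act[OF texec_Act(3)] by auto
next
  case (texec_Seq p z n z' q n' z'')
  obtain t1 p1 where 1: "reaches M (a, t, pos) n (a + tlen p, t1, p1)" "zip_rel z' t1 p1"
    using texec_Seq.IH(1)[of a t pos] texec_Seq.prems by auto
  obtain t2 p2 where 2: "reaches M (a + tlen p, t1, p1) n' (a + tlen p + tlen q, t2, p2)"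
    "zip_rel z'' t2 p2"
    using texec_Seq.IH(2)[of "a + tlen p" t1 p1] texec_Seq.prems 1 by auto
  show ?case using reaches_trans[OF 1(1) 2(1)] 2(2) by (auto simp: add.assoc)
next
  case (texec_IfT b z p n z' q)
  have b: "b (t pos)" using texec_IfT zip_rel_head by metis
  have 0: "reaches M (a, t, pos) 1 (a + 1, t, pos)"
    by (rule reaches_stay) (use texec_IfT b in auto)
  obtain t1 p1 where 1: "reaches M (a + 1, t, pos) n (a + 1 + tlen p, t1, p1)" "zip_rel z' t1 p1"
    using texec_IfT.IH[of "a + 1" t pos] texec_IfT.prems by auto
  have 2: "reaches M (a + 1 + tlen p, t1, p1) 1 (a + 2 + tlen p + tlen q, t1, p1)"
    by (rule reaches_stay) (use texec_IfT in auto)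
  have "reaches M (a, t, pos) (n + 2) (a + tlen (TIf b p q), t1, p1)"
    using reaches_trans[OF reaches_trans[OF 0 1(1)] 2]
    by (simp add: add.assoc add.commute add.left_commute)
  then show ?case using 1(2) by blast
next
  case (texec_IfF b z q n z' p)
  have b: "\<not> b (t pos)" using texec_IfF zip_rel_head by metis
  have 0: "reaches M (a, t, pos) 1 (a + 2 + tlen p, t, pos)"
    by (rule reaches_stay) (use texec_IfF b in auto)
  obtain t1 p1 where 1: "reaches M (a + 2 + tlen p, t, pos) n (a + 2 + tlen p + tlen q, t1, p1)"
    "zip_rel z' t1 p1"
    using texec_IfF.IH[of "a + 2 + tlen p" t pos] texec_IfF.prems by auto
  have "reaches M (a, t, pos) (1 + n) (a + tlen (TIf b p q), t1, p1)"
    using reaches_trans[OF 0 1(1)] by (simp add: add.assoc add.commute add.left_commute)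
  then show ?case using 1(2) reaches_mono[of M _ "1 + n" _ "n + 2"] by fastforce
next
  case (texec_WhileF b z p)
  have b: "\<not> b (t pos)" using texec_WhileF zip_rel_head by metis
  have "reaches M (a, t, pos) 1 (a + tlen (TWhile b p), t, pos)"
    by (rule reaches_stay) (use texec_WhileF b in auto)
  then show ?case using texec_WhileF by blast
next
  case (texec_WhileT b z p n z' n' z'')
  have b: "b (t pos)" using texec_WhileT zip_rel_head by metis
  have 0: "reaches M (a, t, pos) 1 (a + 1, t, pos)"
    by (rule reaches_stay) (use texec_WhileT b in auto)
  obtain t1 p1 where 1: "reaches M (a + 1, t, pos) n (a + 1 + tlen p, t1, p1)" "zip_rel z' t1 p1"
    using texec_WhileT.IH(1)[of "a + 1" t pos] texec_WhileT.prems by auto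
  have 2: "reaches M (a + 1 + tlen p, t1, p1) 1 (a, t1, p1)"
    by (rule reaches_stay) (use texec_WhileT in auto)
  obtain t2 p2 where 3: "reaches M (a, t1, p1) n' (a + tlen (TWhile b p), t2, p2)" "zip_rel z'' t2 p2"
    using texec_WhileT.IH(2)[of "a" t1 p1] texec_WhileT.prems 1 by auto
  have "reaches M (a, t, pos) (1 + n + 1 + n') (a + tlen (TWhile b p), t2, p2)"
    using reaches_trans[OF reaches_trans[OF reaches_trans[OF 0 1(1)] 2] 3(1)] .
  then show ?case using 3(2) reaches_mono[of M _ "1 + n + 1 + n'" _ "n + n' + 2"] by fastforce
next
  case (texec_relax p z n z' m)
  then show ?case using reaches_mono by meson
qed

text \<open>The start state merely jumps over the halting states to the code; the exit state of the
  code turns the scanned symbol into the verdict.\<close>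

definition tm_of :: "tprog \<Rightarrow> tm" where
  "tm_of p = (4 + tlen p, \<lambda>q s.
     if q = 0 then (3, s, Stay)
     else if 3 \<le> q \<and> q < 3 + tlen p then tdelta p 3 q s
     else if q = 3 + tlen p then (if s = One then 1 else 2, s, Stay)
     else (0, s, Stay))"

lemma wf_tm_of: "wf_tm (tm_of p)"
proof -
  have "fst (tdelta p 3 q s) < 4 + tlen p" if "3 \<le> q" "q < 3 + tlen p" for q s
    using tdelta_bound[OF that, of s] by simp
  then show ?thesis by (auto simp: wf_tm_def tm_of_def)
qed

lemma tm_of_decides:
  assumes "texec p (sconst Blank, w @- sconst Blank) n z'"
  shows "\<exists>k\<le>n + 2. decides_in (tm_of p) w k (shd (snd z') = One)"
proof -
  let ?M = "tm_of p"
  obtain t where t: "tm_init w = (0, t, 0)" by (simp add: tm_init_def)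
  have td: "t = (\<lambda>i. if 0 \<le> i \<and> nat i < length w then w ! nat i else Blank)"
    using t by (simp add: tm_init_def)
  have zr: "zip_rel (sconst Blank, w @- sconst Blank) t 0"
    by (auto simp: zip_rel_def td shift_snth)
  have 0: "reaches ?M (0, t, 0) 1 (3, t, 0)"
    by (rule reaches_step) (simp add: tm_step_def tm_of_def move_def)
  obtain t1 p1 where 1: "reaches ?M (3, t, 0) n (3 + tlen p, t1, p1)" "zip_rel z' t1 p1"
    using texec_reaches[OF assms, of 3 ?M t 0] zr by (auto simp: tm_of_def)
  let ?q = "if shd (snd z') = One then 1 else 2 :: nat"
  have 2: "reaches ?M (3 + tlen p, t1, p1) 1 (?q, t1, p1)"
    by (rule reaches_stay) (use zip_rel_head[OF 1(2)] in \<open>auto simp: tm_of_def\<close>)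
  have "reaches ?M (0, t, 0) (n + 2) (?q, t1, p1)"
    using reaches_trans[OF reaches_trans[OF 0 1(1)] 2] by (simp add: add.commute)
  then obtain k where k: "k \<le> n + 2" "(tm_step ?M ^^ k) (0, t, 0) = (?q, t1, p1)"
    unfolding reaches_def by blast
  then have "decides_in ?M w k (shd (snd z') = One)"
    by (simp add: decides_in_def t)
  then show ?thesis using k(1) by blast
qed

section \<open>Blocks of symbols on the tape\<close>

definition keep :: "sym \<Rightarrow> sym" where
  "keep s = s"

abbreviation "goR \<equiv> TAct keep MoveR"
abbreviation "goL \<equiv> TAct keep MoveL"
abbreviation "put s \<equiv> TAct (\<lambda>_. s)"
abbreviation "nonblank \<equiv> (\<lambda>s. s \<noteq> Blank)"

lemma texec_ActI: "act f d z = z' \<Longrightarrow> 1 \<le> m \<Longrightarrow> texec (TAct f d) z m z'"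
  using texec_Act texec_relax by metis

lemma texec_SeqI:
  "texec p z n z' \<Longrightarrow> texec q z' n' z'' \<Longrightarrow> n + n' \<le> m \<Longrightarrow> texec (TSeq p q) z m z''"
  using texec_Seq texec_relax by metis

lemma texec_WhileI:
  "b (shd (snd z)) \<Longrightarrow> texec p z n z' \<Longrightarrow> texec (TWhile b p) z' n' z'' \<Longrightarrow> n + n' + 2 \<le> m \<Longrightarrow>
    texec (TWhile b p) z m z''"
  using texec_WhileT texec_relax by metis

lemma texec_WhileFI:
  "\<not> b (shd (snd z)) \<Longrightarrow> z = z' \<Longrightarrow> 1 \<le> m \<Longrightarrow> texec (TWhile b p) z m z'"
  using texec_WhileF texec_relax by metis

lemma act_keep [simp]:
  "act keep MoveR (l, x ## r) = (x ## l, r)"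
  "act keep MoveL (y ## l, x ## r) = (l, y ## x ## r)"
  by (auto simp: act_def keep_def)

lemma act_const [simp]:
  "act (\<lambda>_. s) MoveR (l, x ## r) = (s ## l, r)"
  "act (\<lambda>_. s) MoveL (y ## l, x ## r) = (l, y ## s ## r)"
  "act (\<lambda>_. s) Stay (l, x ## r) = (l, s ## r)"
  by (auto simp: act_def)


lemma act_keep_MoveL: "act keep MoveL (l, r) = (stl l, shd l ## r)"
  by (simp add: act_def keep_def)

lemma sconst_Blank: "Blank ## sconst Blank = sconst Blank"
  by (rule sym, subst siterate.code, subst id_apply, rule refl)

primrec trep :: "nat \<Rightarrow> tprog \<Rightarrow> tprog" where
  "trep 0 p = TAct keep Stay"
| "trep (Suc n) p = TSeq p (trep n p)"

lemma act_keep_Stay: "act keep Stay z = z"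
  by (cases z) (simp add: act_def keep_def)

text \<open>The work tape holds finitely many blocks over the non-blank symbols, each terminated by a
  blank; in particular the initial tape is a block layout whose first block is the input.\<close>

definition blocks :: "sym list list \<Rightarrow> sym list" where
  "blocks bs = concat (map (\<lambda>b. b @ [Blank]) bs)"

definition lft :: "sym list list \<Rightarrow> sym stream" where
  "lft bs = rev (blocks bs) @- sconst Blank"

lemma blocks_simps [simp]:
  "blocks [] = []" "blocks (b # bs) = b @ Blank # blocks bs" "blocks (as @ bs) = blocks as @ blocks bs"
  by (auto simp: blocks_def)

lemma lft_Nil: "lft [] = sconst Blank"
  by (simp add: lft_def)

lemma lft_snoc: "lft (bs @ [b]) = Blank ## rev b @- lft bs"
  by (simp add: lft_def)

text \<open>This blank is the terminator of the preceding block or belongs to the empty tape. It is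
  where leftward sweeps stop, also in front of the first block.\<close>

lemma lft_Blank: "\<exists>l. lft bs = Blank ## l"
proof (cases bs rule: rev_cases)
  case Nil
  then have "lft bs = Blank ## sconst Blank" by (simp only: lft_Nil sconst_Blank)
  then show ?thesis ..
next
  case (snoc cs c)
  then have "lft bs = Blank ## rev c @- lft cs" by (simp only: lft_snoc)
  then show ?thesis ..
qed

lemma sweep_right:
  "Blank \<notin> set b \<Longrightarrow>
    texec (TWhile nonblank goR) (l, b @- Blank ## r) (3 * length b + 1) (rev b @- l, Blank ## r)"
proof (induction b arbitrary: l)
  case Nil
  then show ?case by (auto intro: texec_WhileFI)
next
  case (Cons x b)
  have nb: "Blank \<notin> set b" and x: "nonblank x" using Cons.prems by auto
  have 1: "texec goR (l, (x # b) @- Blank ## r) 1 (x ## l, b @- Blank ## r)"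
    by (rule texec_ActI) auto
  show ?case
    using texec_WhileI[OF _ 1 Cons.IH[OF nb], where m = "3 * length (x # b) + 1"] x by simp
qed

text \<open>Writing the start as a left move treats an empty and a non-empty \<open>c\<close>
  uniformly: in both cases the head is on the first symbol of
  \<open>c @- Blank ## l\<close>.\<close>

lemma sweep_left:
  "Blank \<notin> set c \<Longrightarrow>
    texec (TWhile nonblank goL) (act keep MoveL (c @- Blank ## l, r)) (3 * length c + 1)
      (l, Blank ## rev c @- r)"
proof (induction c arbitrary: r)
  case Nil
  then show ?case by (auto intro: texec_WhileFI simp: act_keep_MoveL)
next
  case (Cons x c)
  have nb: "Blank \<notin> set c" and x: "nonblank x" using Cons.prems by auto
  have 1: "texec goL (act keep MoveL ((x # c) @- Blank ## l, r)) 1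
      (act keep MoveL (c @- Blank ## l, x ## r))"
    by (rule texec_ActI) (auto simp: act_keep_MoveL)
  show ?case
    using texec_WhileI[where m = "3 * length (x # c) + 1", OF _ 1 Cons.IH[OF nb]] x
    by (simp add: act_keep_MoveL)
qed

definition fwd :: tprog where
  "fwd = TSeq (TWhile nonblank goR) goR"

text \<open>The first move reaches the terminator of the block to the left, the second the last
  symbol of that block; the sweep ends on the blank in front of it.\<close>

definition bwd :: tprog where
  "bwd = TSeq goL (TSeq goL (TSeq (TWhile nonblank goL) goR))"

lemma fwd:
  assumes "Blank \<notin> set b"
  shows "texec fwd (lft bs, b @- Blank ## r) (3 * length b + 2) (lft (bs @ [b]), r)"
  unfolding fwd_def
  by (rule texec_SeqI[OF sweep_right[OF assms]])
     (auto intro: texec_ActI simp: lft_snoc)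

lemma bwd:
  assumes "Blank \<notin> set b"
  shows "texec bwd (lft (bs @ [b]), r) (3 * length b + 4) (lft bs, b @- Blank ## r)"
proof -
  obtain l where l: "lft bs = Blank ## l" using lft_Blank by blast
  have nb: "Blank \<notin> set (rev b)" using assms by simp
  note s = sweep_left[OF nb, of l "Blank ## r"]
  have 1: "texec goL (lft (bs @ [b]), r) 1 (rev b @- lft bs, Blank ## r)"
    by (rule texec_ActI) (auto simp: lft_snoc act_keep_MoveL)
  have 2: "texec goL (rev b @- lft bs, Blank ## r) 1 (act keep MoveL (rev b @- Blank ## l, Blank ## r))"
    by (rule texec_ActI) (auto simp: l)
  have 3: "texec goR (l, Blank ## b @- Blank ## r) 1 (lft bs, b @- Blank ## r)"
    by (rule texec_ActI) (auto simp: l)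
  show ?thesis unfolding bwd_def
    by (rule texec_SeqI[OF 1 texec_SeqI[OF 2 texec_SeqI[OF s]], where m = "3 * length b + 4"])
       (use 3 in auto)
qed

lemma fwds:
  assumes "\<forall>c\<in>set cs. Blank \<notin> set c"
  shows "texec (trep (length cs) fwd) (lft bs, blocks cs @- r) (3 * length (blocks cs) + 1)
           (lft (bs @ cs), r)"
  using assms
proof (induction cs arbitrary: bs)
  case Nil
  then show ?case by (auto intro: texec_ActI simp: act_keep_Stay)
next
  case (Cons c cs)
  have "texec fwd (lft bs, c @- Blank ## blocks cs @- r) (3 * length c + 2)
     (lft (bs @ [c]), blocks cs @- r)"
    using Cons.prems by (intro fwd) auto
  from texec_SeqI[OF this Cons.IH, where m = "3 * length (blocks (c # cs)) + 1"]
  show ?case using Cons.prems by simp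
qed

lemma bwds:
  assumes "\<forall>c\<in>set cs. Blank \<notin> set c"
  shows "texec (trep (length cs) bwd) (lft (bs @ cs), r) (4 * length (blocks cs) + 1)
           (lft bs, blocks cs @- r)"
  using assms
proof (induction cs arbitrary: r rule: rev_induct)
  case Nil
  then show ?case by (auto intro: texec_ActI simp: act_keep_Stay)
next
  case (snoc c cs)
  have "texec bwd (lft (bs @ cs @ [c]), r) (3 * length c + 4) (lft (bs @ cs), c @- Blank ## r)"
    using bwd[of c "bs @ cs" r] snoc.prems by simp
  from texec_SeqI[OF this snoc.IH, where m = "4 * length (blocks (cs @ [c])) + 1"]
  show ?case using snoc.prems by simp
qed

text \<open>An action writes a symbol determined by the cell it overwrites. Carrying a symbol to a
  neighbouring cell therefore takes one branch per symbol, so that the control state remembers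
  it.\<close>

definition copy_right :: tprog where
  "copy_right = TIf (\<lambda>s. s = Zero) (TSeq goR (put Zero MoveL))
     (TIf (\<lambda>s. s = One) (TSeq goR (put One MoveL)) (TSeq goR (put Sep MoveL)))"

definition copy_left :: tprog where
  "copy_left = TIf (\<lambda>s. s = Zero) (TSeq goL (put Zero MoveR))
     (TIf (\<lambda>s. s = One) (TSeq goL (put One MoveR)) (TSeq goL (put Sep MoveR)))"

lemma texec_IfI:
  "texec (if b (shd (snd z)) then p else q) z n z' \<Longrightarrow> n + 2 \<le> m \<Longrightarrow> texec (TIf b p q) z m z'"
  using texec_IfT[of b z p n z' q] texec_IfF[of b z q n z' p] texec_relax
  by (metis (full_types))

lemma move_put:
  "texec (TSeq goR (put s MoveL)) (l, x ## y ## r) 2 (l, x ## s ## r)"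
  "texec (TSeq goL (put s MoveR)) (y ## l, x ## r) 2 (s ## l, x ## r)"
proof -
  have "texec (TSeq goR (put s MoveL)) (l, x ## y ## r) 2 (l, x ## s ## r)"
    by (rule texec_SeqI[where z' = "(x ## l, y ## r)" and n = 1 and n' = 1])
       (auto intro: texec_ActI)
  then show "texec (TSeq goR (put s MoveL)) (l, x ## y ## r) 2 (l, x ## s ## r)" .
  have "texec (TSeq goL (put s MoveR)) (y ## l, x ## r) 2 (s ## l, x ## r)"
    by (rule texec_SeqI[where z' = "(l, y ## x ## r)" and n = 1 and n' = 1])
       (auto intro: texec_ActI)
  then show "texec (TSeq goL (put s MoveR)) (y ## l, x ## r) 2 (s ## l, x ## r)" .
qed

lemma copy_right:
  assumes "x \<noteq> Blank"
  shows "texec copy_right (l, x ## y ## r) 6 (l, x ## x ## r)"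
  using assms unfolding copy_right_def
  by (intro texec_IfI[where n = 4 and m = 6])
     (use move_put(1) in \<open>cases x; auto intro: texec_IfI[where n = 2 and m = 4] texec_relax[where n = 2]\<close>)+

lemma copy_left:
  assumes "x \<noteq> Blank"
  shows "texec copy_left (y ## l, x ## r) 6 (x ## l, x ## r)"
  using assms unfolding copy_left_def
  by (intro texec_IfI[where n = 4 and m = 6])
     (use move_put(2) in \<open>cases x; auto intro: texec_IfI[where n = 2 and m = 4] texec_relax[where n = 2]\<close>)+

text \<open>The start is a free cell behind the block. It becomes the new terminator, and the
  symbols are copied one cell to the right from the last to the first. The cell freed in front of
  the block keeps a stale symbol, which the lemmas quantify existentially.\<close>

definition shift_right :: tprog where
  "shift_right = TSeq (put Blank MoveL)
     (TSeq goL (TSeq (TWhile nonblank (TSeq copy_right goL)) goR))"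

definition shift_left :: tprog where
  "shift_left = TSeq goR (TSeq (TWhile nonblank (TSeq copy_left goR)) (TSeq goL (put Blank MoveR)))"

lemma shift_right_loop:
  "Blank \<notin> set c \<Longrightarrow>
    \<exists>y'. texec (TWhile nonblank (TSeq copy_right goL)) (act keep MoveL (c @- Blank ## l, y ## r))
      (9 * length c + 1) (l, Blank ## y' ## rev c @- r)"
proof (induction c arbitrary: y r)
  case Nil
  then show ?case by (auto intro!: exI[of _ y] texec_WhileFI simp: act_keep_MoveL)
next
  case (Cons x c)
  obtain y' where y': "texec (TWhile nonblank (TSeq copy_right goL))
      (act keep MoveL (c @- Blank ## l, x ## x ## r)) (9 * length c + 1)
      (l, Blank ## y' ## rev c @- x ## r)"
    using Cons by (metis list.set_intros(2))
  have b: "texec (TSeq copy_right goL) (act keep MoveL ((x # c) @- Blank ## l, y ## r)) 7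
      (act keep MoveL (c @- Blank ## l, x ## x ## r))"
    unfolding act_keep_MoveL
    by (rule texec_SeqI[where n = 6 and n' = 1 and z' = "(c @- Blank ## l, x ## x ## r)"])
       (use Cons.prems copy_right[of x] in \<open>auto intro: texec_ActI simp: act_keep_MoveL\<close>)
  have "texec (TWhile nonblank (TSeq copy_right goL)) (act keep MoveL ((x # c) @- Blank ## l, y ## r))
      (9 * length (x # c) + 1) (l, Blank ## y' ## rev c @- x ## r)"
    by (rule texec_WhileI[OF _ b y']) (use Cons.prems in \<open>auto simp: act_keep_MoveL\<close>)
  then show ?case by auto
qed

lemma shift_left_loop:
  "Blank \<notin> set b \<Longrightarrow>
    \<exists>y'. texec (TWhile nonblank (TSeq copy_left goR)) (y ## l, b @- Blank ## r)
      (9 * length b + 1) (y' ## rev b @- l, Blank ## r)"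
proof (induction b arbitrary: y l)
  case Nil
  then show ?case by (auto intro!: exI[of _ y] texec_WhileFI)
next
  case (Cons x b)
  obtain y' where y': "texec (TWhile nonblank (TSeq copy_left goR))
      (x ## x ## l, b @- Blank ## r) (9 * length b + 1) (y' ## rev b @- x ## l, Blank ## r)"
    using Cons by (metis list.set_intros(2))
  have b: "texec (TSeq copy_left goR) (y ## l, (x # b) @- Blank ## r) 7
      (x ## x ## l, b @- Blank ## r)"
    by (rule texec_SeqI[where n = 6 and n' = 1 and z' = "(x ## l, x ## b @- Blank ## r)"])
       (use Cons.prems copy_left[of x] in \<open>auto intro: texec_ActI\<close>)
  have "texec (TWhile nonblank (TSeq copy_left goR)) (y ## l, (x # b) @- Blank ## r)
      (9 * length (x # b) + 1) (y' ## rev b @- x ## l, Blank ## r)"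
    by (rule texec_WhileI[OF _ b y']) (use Cons.prems in auto)
  then show ?case by auto
qed

lemma shift_right:
  assumes "Blank \<notin> set b"
  shows "\<exists>y. texec shift_right (lft (bs @ [b]), x ## r) (9 * length b + 9)
    (lft bs, y ## b @- Blank ## r)"
proof -
  obtain l where l: "lft bs = Blank ## l" using lft_Blank by blast
  have nb: "Blank \<notin> set (rev b)" using assms by simp
  obtain y where s: "texec (TWhile nonblank (TSeq copy_right goL))
      (act keep MoveL (rev b @- Blank ## l, Blank ## Blank ## r))
      (9 * length b + 1) (l, Blank ## y ## b @- Blank ## r)"
    using shift_right_loop[OF nb, of l Blank "Blank ## r"] by auto
  have 1: "texec (put Blank MoveL) (lft (bs @ [b]), x ## r) 1 (rev b @- lft bs, Blank ## Blank ## r)"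
    by (rule texec_ActI) (auto simp: lft_snoc)
  have 2: "texec goL (rev b @- lft bs, Blank ## Blank ## r) 1
      (act keep MoveL (rev b @- Blank ## l, Blank ## Blank ## r))"
    by (rule texec_ActI) (auto simp: l)
  have 3: "texec goR (l, Blank ## y ## b @- Blank ## r) 1 (lft bs, y ## b @- Blank ## r)"
    by (rule texec_ActI) (auto simp: l)
  have "texec shift_right (lft (bs @ [b]), x ## r) (9 * length b + 9) (lft bs, y ## b @- Blank ## r)"
    unfolding shift_right_def
    by (rule texec_SeqI[OF 1 texec_SeqI[OF 2 texec_SeqI[OF s 3 le_refl] le_refl]]) simp
  then show ?thesis by blast
qed

lemma shift_left:
  assumes "Blank \<notin> set b"
  shows "texec shift_left (lft bs, y ## b @- Blank ## r) (9 * length b + 9)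
    (lft (bs @ [b]), Blank ## r)"
proof -
  obtain y' where s: "texec (TWhile nonblank (TSeq copy_left goR))
      (y ## lft bs, b @- Blank ## r) (9 * length b + 1) (y' ## rev b @- lft bs, Blank ## r)"
    using shift_left_loop[OF assms] by blast
  have 1: "texec goR (lft bs, y ## b @- Blank ## r) 1 (y ## lft bs, b @- Blank ## r)"
    by (rule texec_ActI) auto
  have 2: "texec goL (y' ## rev b @- lft bs, Blank ## r) 1 (rev b @- lft bs, y' ## Blank ## r)"
    by (rule texec_ActI) auto
  have 3: "texec (put Blank MoveR) (rev b @- lft bs, y' ## Blank ## r) 1 (lft (bs @ [b]), Blank ## r)"
    by (rule texec_ActI) (auto simp: lft_snoc)
  show ?thesis
    unfolding shift_left_def
    by (rule texec_SeqI[OF 1 texec_SeqI[OF s texec_SeqI[OF 2 3 le_refl] le_refl]]) simp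
qed

lemma shifts_right:
  assumes "\<forall>c\<in>set cs. Blank \<notin> set c"
  shows "\<exists>y. texec (trep (length cs) shift_right) (lft (bs @ cs), x ## r) (9 * length (blocks cs) + 1)
           (lft bs, y ## blocks cs @- r)"
  using assms
proof (induction cs arbitrary: x r rule: rev_induct)
  case Nil
  then show ?case by (auto intro!: exI[of _ x] texec_ActI simp: act_keep_Stay)
next
  case (snoc c cs)
  obtain z where 1: "texec shift_right (lft (bs @ cs @ [c]), x ## r) (9 * length c + 9)
      (lft (bs @ cs), z ## c @- Blank ## r)"
    using shift_right[of c "bs @ cs" x r] snoc.prems by auto
  obtain y where 2: "texec (trep (length cs) shift_right) (lft (bs @ cs), z ## c @- Blank ## r)
      (9 * length (blocks cs) + 1) (lft bs, y ## blocks cs @- c @- Blank ## r)"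
    using snoc by fastforce
  show ?case
    using texec_SeqI[OF 1 2, where m = "9 * length (blocks (cs @ [c])) + 1"] by auto
qed

text \<open>The free cell travels from the front of the blocks to their end. It comes out blank as
  soon as one block has passed it, so the tape behind the last register is clean after a
  pop.\<close>

lemma shifts_left:
  assumes "\<forall>c\<in>set cs. Blank \<notin> set c"
  shows "texec (trep (length cs) shift_left) (lft bs, y ## blocks cs @- r) (9 * length (blocks cs) + 1)
           (lft (bs @ cs), (if cs = [] then y else Blank) ## r)"
  using assms
proof (induction cs arbitrary: y bs)
  case Nil
  then show ?case by (auto intro: texec_ActI simp: act_keep_Stay)
next
  case (Cons c cs)
  have 1: "texec shift_left (lft bs, y ## c @- Blank ## blocks cs @- r) (9 * length c + 9)
      (lft (bs @ [c]), Blank ## blocks cs @- r)"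
    using shift_left[of c bs y] Cons.prems by auto
  have 2: "texec (trep (length cs) shift_left) (lft (bs @ [c]), Blank ## blocks cs @- r)
      (9 * length (blocks cs) + 1) (lft ((bs @ [c]) @ cs), (if cs = [] then Blank else Blank) ## r)"
    using Cons.IH[of "bs @ [c]" Blank] Cons.prems by auto
  show ?case
    using texec_SeqI[OF 1 2, where m = "9 * length (blocks (c # cs)) + 1"] by auto
qed

section \<open>Programs on finitely many stacks\<close>

datatype cmd =
    Push nat sym
  | Pop nat
  | CSeq cmd cmd
  | CIf nat "sym \<Rightarrow> bool" cmd cmd
  | CWhile nat "sym \<Rightarrow> bool" cmd

type_synonym regs = "nat \<Rightarrow> sym list"

text \<open>An empty stack shows \<open>Blank\<close> because on the tape the head then sees the
  terminator of an empty block.\<close>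

definition top_sym :: "sym list \<Rightarrow> sym" where
  "top_sym xs = (case xs of [] \<Rightarrow> Blank | x # _ \<Rightarrow> x)"

lemma top_sym_simps [simp]: "top_sym [] = Blank" "top_sym (x # xs) = x"
  by (auto simp: top_sym_def)

inductive exec :: "cmd \<Rightarrow> regs \<Rightarrow> nat \<Rightarrow> regs \<Rightarrow> bool" where
  exec_Push: "s \<noteq> Blank \<Longrightarrow> exec (Push i s) R 1 (R(i := s # R i))"
| exec_Pop: "exec (Pop i) R 1 (R(i := tl (R i)))"
| exec_Seq: "exec p R n R' \<Longrightarrow> exec q R' n' R'' \<Longrightarrow> exec (CSeq p q) R (n + n') R''"
| exec_If: "exec (if b (top_sym (R i)) then p else q) R n R' \<Longrightarrow> exec (CIf i b p q) R (n + 1) R'"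
| exec_WhileF: "\<not> b (top_sym (R i)) \<Longrightarrow> exec (CWhile i b p) R 1 R"
| exec_WhileT: "b (top_sym (R i)) \<Longrightarrow> exec p R n R' \<Longrightarrow> exec (CWhile i b p) R' n' R'' \<Longrightarrow>
    exec (CWhile i b p) R (n + n' + 1) R''"
| exec_relax: "exec p R n R' \<Longrightarrow> n \<le> m \<Longrightarrow> exec p R m R'"

lemma exec_IfT: "b (top_sym (R i)) \<Longrightarrow> exec p R n R' \<Longrightarrow> exec (CIf i b p q) R (n + 1) R'"
  and exec_IfF: "\<not> b (top_sym (R i)) \<Longrightarrow> exec q R n R' \<Longrightarrow> exec (CIf i b p q) R (n + 1) R'"
  using exec_If[of b R i p q n R'] by simp_all

primrec regs_below :: "nat \<Rightarrow> cmd \<Rightarrow> bool" where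
  "regs_below K (Push i s) \<longleftrightarrow> i < K"
| "regs_below K (Pop i) \<longleftrightarrow> i < K"
| "regs_below K (CSeq p q) \<longleftrightarrow> regs_below K p \<and> regs_below K q"
| "regs_below K (CIf i b p q) \<longleftrightarrow> i < K \<and> regs_below K p \<and> regs_below K q"
| "regs_below K (CWhile i b p) \<longleftrightarrow> i < K \<and> regs_below K p"

lemma regs_below_mono: "regs_below K c \<Longrightarrow> K \<le> K' \<Longrightarrow> regs_below K' c"
  by (induction c) auto

lemma regs_below_exists: "\<exists>K>0. regs_below K c"
proof (induction c)
  case (Push i s)
  show ?case by (auto intro: exI[of _ "Suc i"])
next
  case (Pop i)
  show ?case by (auto intro: exI[of _ "Suc i"])
next
  case (CSeq p q)
  then obtain K K' where "K > 0" "regs_below K p" "regs_below K' q" by blast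
  then show ?case
    by (auto intro!: exI[of _ "K + K'"] elim: regs_below_mono)
next
  case (CIf i b p q)
  then obtain K K' where "regs_below K p" "regs_below K' q" by blast
  then show ?case
    by (auto intro!: exI[of _ "K + K' + Suc i"] elim: regs_below_mono)
next
  case (CWhile i b p)
  then obtain K where "regs_below K p" by blast
  then show ?case
    by (auto intro!: exI[of _ "K + Suc i"] elim: regs_below_mono)
qed

text \<open>Between commands the head rests at the start of register 0. A push opens a hole in front
  of block \<open>i\<close> by shifting the blocks from \<open>i\<close> on, last one first; a pop
  regards the top symbol as a hole and closes it by the opposite shift.\<close>

primrec compile :: "nat \<Rightarrow> cmd \<Rightarrow> tprog" where
  "compile K (Push i s) =
     TSeq (trep K fwd) (TSeq (trep (K - i) shift_right) (TSeq (put s Stay) (trep i bwd)))"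
| "compile K (Pop i) =
     TSeq (trep i fwd) (TIf nonblank (TSeq (trep (K - i) shift_left) (trep K bwd)) (trep i bwd))"
| "compile K (CSeq p q) = TSeq (compile K p) (compile K q)"
| "compile K (CIf i b p q) =
     TSeq (trep i fwd) (TIf b (TSeq (trep i bwd) (compile K p)) (TSeq (trep i bwd) (compile K q)))"
| "compile K (CWhile i b p) =
     TSeq (trep i fwd)
       (TSeq (TWhile b (TSeq (trep i bwd) (TSeq (compile K p) (trep i fwd)))) (trep i bwd))"

section \<open>Correctness and running time of the compiled stack programs\<close>

definition at_reg :: "nat \<Rightarrow> nat \<Rightarrow> regs \<Rightarrow> zipper" where
  "at_reg K i R = (lft (map R [0..<i]), blocks (map R [i..<K]) @- sconst Blank)"

definition reg_total :: "nat \<Rightarrow> regs \<Rightarrow> nat" where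
  "reg_total K R = length (blocks (map R [0..<K]))"

definition no_blank :: "nat \<Rightarrow> regs \<Rightarrow> bool" where
  "no_blank K R \<longleftrightarrow> (\<forall>i<K. Blank \<notin> set (R i))"

lemma blocks_split:
  assumes "i \<le> K"
  shows "blocks (map R [0..<K]) = blocks (map R [0..<i]) @ blocks (map R [i..<K])"
proof -
  have "[0..<K] = [0..<i] @ [i..<K]" using assms upt_add_eq_append[of 0 i "K - i"] by simp
  then show ?thesis by simp
qed

lemma reg_total_split:
  assumes "i \<le> K"
  shows "length (blocks (map R [0..<i])) + length (blocks (map R [i..<K])) = reg_total K R"
  using blocks_split[OF assms, of R] by (simp add: reg_total_def)

lemma fwd_reg:
  assumes "no_blank K R" "i \<le> K"
  shows "texec (trep i fwd) (at_reg K 0 R) (3 * reg_total K R + 1) (at_reg K i R)"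
proof -
  have "\<forall>c\<in>set (map R [0..<i]). Blank \<notin> set c" using assms by (auto simp: no_blank_def)
  from fwds[OF this, of "[]" "blocks (map R [i..<K]) @- sconst Blank"]
  have "texec (trep i fwd) (at_reg K 0 R) (3 * length (blocks (map R [0..<i])) + 1) (at_reg K i R)"
    by (simp add: at_reg_def blocks_split[OF assms(2)])
  then show ?thesis by (rule texec_relax) (use reg_total_split[OF assms(2), of R] in simp)
qed

lemma bwd_reg:
  assumes "no_blank K R" "i \<le> K"
  shows "texec (trep i bwd) (at_reg K i R) (4 * reg_total K R + 1) (at_reg K 0 R)"
proof -
  have "\<forall>c\<in>set (map R [0..<i]). Blank \<notin> set c" using assms by (auto simp: no_blank_def)
  from bwds[OF this, of "[]" "blocks (map R [i..<K]) @- sconst Blank"]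
  have "texec (trep i bwd) (at_reg K i R) (4 * length (blocks (map R [0..<i])) + 1) (at_reg K 0 R)"
    by (simp add: at_reg_def blocks_split[OF assms(2)])
  then show ?thesis by (rule texec_relax) (use reg_total_split[OF assms(2), of R] in simp)
qed

lemma upt_conv: "i < K \<Longrightarrow> map R [i..<K] = R i # map R [Suc i..<K]"
  by (simp add: upt_conv_Cons)

lemma at_reg_head: "i < K \<Longrightarrow> shd (snd (at_reg K i R)) = top_sym (R i)"
  by (cases "R i") (auto simp: at_reg_def upt_conv)

lemma map_upd_lt: "map (R(i := x)) [0..<i] = map R [0..<i]"
  by auto

lemma map_upd_ge: "map (R(i := x)) [Suc i..<K] = map R [Suc i..<K]"
  by auto

lemma reg_total_upd:
  assumes "i < K"
  shows "reg_total K (R(i := x)) + length (R i) = reg_total K R + length x"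
  using reg_total_split[of i K R] reg_total_split[of i K "R(i := x)"] assms
  by (auto simp: upt_conv map_upd_lt map_upd_ge)

lemma compile_Push:
  assumes nb: "no_blank K R" and i: "i < K" and s: "s \<noteq> Blank"
  shows "texec (compile K (Push i s)) (at_reg K 0 R) (20 * (reg_total K R + 1))
    (at_reg K 0 (R(i := s # R i)))"
proof -
  let ?T = "reg_total K R"
  let ?as = "map R [0..<i]" and ?cs = "map R [i..<K]"
  have 1: "texec (trep K fwd) (at_reg K 0 R) (3 * ?T + 1) (at_reg K K R)"
    by (rule fwd_reg[OF nb]) simp
  have KK: "at_reg K K R = (lft (?as @ ?cs), Blank ## sconst Blank)"
  proof -
    have "[0..<K] = [0..<i] @ [i..<K]" using i upt_add_eq_append[of 0 i "K - i"] by simp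
    then show ?thesis by (simp only: at_reg_def sconst_Blank) simp
  qed
  have cs: "\<forall>c\<in>set ?cs. Blank \<notin> set c" using nb by (auto simp: no_blank_def)
  obtain y where y: "texec (trep (K - i) shift_right) (at_reg K K R)
      (9 * length (blocks ?cs) + 1) (lft ?as, y ## blocks ?cs @- sconst Blank)"
    using shifts_right[OF cs, of ?as Blank "sconst Blank"] KK by auto
  have at: "at_reg K i (R(i := s # R i)) = (lft ?as, s ## blocks ?cs @- sconst Blank)"
    using i by (simp add: at_reg_def upt_conv map_upd_lt map_upd_ge)
  have 3: "texec (put s Stay) (lft ?as, y ## blocks ?cs @- sconst Blank) 1
      (at_reg K i (R(i := s # R i)))"
    by (rule texec_ActI) (auto simp: at)
  have nb': "no_blank K (R(i := s # R i))" using nb s i by (auto simp: no_blank_def)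
  have 4: "texec (trep i bwd) (at_reg K i (R(i := s # R i))) (4 * reg_total K (R(i := s # R i)) + 1)
      (at_reg K 0 (R(i := s # R i)))"
    by (rule bwd_reg[OF nb']) (use i in simp)
  show ?thesis
    unfolding compile.simps
    by (rule texec_SeqI[OF 1 texec_SeqI[OF y texec_SeqI[OF 3 4 le_refl] le_refl]])
       (use reg_total_split[of i K R] reg_total_upd[OF i, of R "s # R i"] i in simp)
qed

lemma compile_Pop:
  assumes nb: "no_blank K R" and i: "i < K"
  shows "texec (compile K (Pop i)) (at_reg K 0 R) (20 * (reg_total K R + 1))
    (at_reg K 0 (R(i := tl (R i))))"
proof (cases "R i")
  case Nil
  have 1: "texec (trep i fwd) (at_reg K 0 R) (3 * reg_total K R + 1) (at_reg K i R)"
    by (rule fwd_reg[OF nb]) (use i in simp)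
  have 2: "texec (trep i bwd) (at_reg K i R) (4 * reg_total K R + 1) (at_reg K 0 R)"
    by (rule bwd_reg[OF nb]) (use i in simp)
  have 3: "\<not> nonblank (shd (snd (at_reg K i R)))" using at_reg_head[OF i] Nil by simp
  have "R(i := tl (R i)) = R" using Nil by (metis fun_upd_triv list.sel(2))
  then show ?thesis
    unfolding compile.simps using texec_SeqI[OF 1 texec_IfF[of nonblank, OF 3 2]] by simp
next
  case (Cons x xs)
  let ?T = "reg_total K R" and ?R = "R(i := tl (R i))"
  let ?as = "map ?R [0..<i]" and ?cs = "map ?R [i..<K]"
  have 1: "texec (trep i fwd) (at_reg K 0 R) (3 * ?T + 1) (at_reg K i R)"
    by (rule fwd_reg[OF nb]) (use i in simp)
  have at: "at_reg K i R = (lft ?as, x ## blocks ?cs @- sconst Blank)"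
    using i Cons by (simp add: at_reg_def upt_conv map_upd_lt map_upd_ge)
  have nb': "no_blank K ?R"
    using nb i by (auto simp: no_blank_def) (metis list.sel(2) list.set_sel(2))
  have cs: "\<forall>c\<in>set ?cs. Blank \<notin> set c" using nb' by (auto simp: no_blank_def)
  have ne: "?cs \<noteq> []" using i by simp
  have KK: "at_reg K K ?R = (lft (?as @ ?cs), Blank ## sconst Blank)"
  proof -
    have "[0..<K] = [0..<i] @ [i..<K]" using i upt_add_eq_append[of 0 i "K - i"] by simp
    then show ?thesis by (simp only: at_reg_def sconst_Blank) simp
  qed
  have 2: "texec (trep (K - i) shift_left) (at_reg K i R) (9 * length (blocks ?cs) + 1) (at_reg K K ?R)"
    using shifts_left[OF cs, of ?as x "sconst Blank"] ne unfolding KK at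
    by (simp only: length_map length_upt if_False)
  have 3: "texec (trep K bwd) (at_reg K K ?R) (4 * reg_total K ?R + 1) (at_reg K 0 ?R)"
    by (rule bwd_reg[OF nb']) simp
  have 4: "nonblank (shd (snd (at_reg K i R)))"
    using at_reg_head[OF i, of R] Cons nb i by (auto simp: no_blank_def)
  show ?thesis
    unfolding compile.simps
    by (rule texec_SeqI[OF 1 texec_IfT[of nonblank, OF 4 texec_SeqI[OF 2 3 le_refl]]])
       (use reg_total_split[of i K ?R] reg_total_upd[OF i, of R xs] Cons i in simp)
qed

lemma while_body_time:
  fixes a :: nat
  assumes "a \<le> a'" "b \<le> b'" "T' \<le> T + n"
  shows "4 * T + 1 + (a + (3 * T' + 1)) + b + 2 \<le> a' + b' + 7 * (T + (n + n' + 1) + 1)"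
  using assms by (simp add: algebra_simps)

lemma while_total_time:
  fixes a :: nat
  assumes "T' \<le> T + n" "T'' \<le> T' + n'" "z = a + b + 20 * (T + (n + n' + 1) + 1)"
  shows "3 * T + 1 + (a + b + 7 * (T + (n + n' + 1) + 1) + (4 * T'' + 1)) \<le> z"
  using assms by (simp add: algebra_simps)

text \<open>One unit of stack time pays for boundedly many passes over the used tape, which grows by
  at most one cell per unit; the factor 20 covers a push and a pop. The last conjunct speaks of the
  bare loop started at register \<open>i\<close>, since \<open>exec_WhileT\<close> recurses into the
  loop without the walks that surround it in the compiled code.\<close>

lemma compile_correct:
  assumes "exec c R t R'" "regs_below K c" "no_blank K R"
  shows "no_blank K R' \<and> reg_total K R' \<le> reg_total K R + t \<and>
    texec (compile K c) (at_reg K 0 R) (t * (20 * (reg_total K R + t + 1))) (at_reg K 0 R') \<and>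
    (\<forall>i b p. c = CWhile i b p \<longrightarrow>
       texec (TWhile b (TSeq (trep i bwd) (TSeq (compile K p) (trep i fwd))))
         (at_reg K i R) (t * (20 * (reg_total K R + t + 1))) (at_reg K i R'))"
  using assms
proof (induction rule: exec.induct)
  case (exec_Push s i R)
  have "texec (compile K (Push i s)) (at_reg K 0 R) (1 * (20 * (reg_total K R + 1 + 1)))
    (at_reg K 0 (R(i := s # R i)))"
    by (rule texec_relax[OF compile_Push]) (use exec_Push in auto)
  moreover have "no_blank K (R(i := s # R i))" using exec_Push by (auto simp: no_blank_def)
  ultimately show ?case using reg_total_upd[of i K R "s # R i"] exec_Push
    by (simp del: fun_upd_apply compile.simps)
next
  case (exec_Pop i R)
  have "texec (compile K (Pop i)) (at_reg K 0 R) (1 * (20 * (reg_total K R + 1 + 1)))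
    (at_reg K 0 (R(i := tl (R i))))"
    by (rule texec_relax[OF compile_Pop]) (use exec_Pop in auto)
  moreover have "no_blank K (R(i := tl (R i)))"
    using exec_Pop by (auto simp: no_blank_def) (metis list.sel(2) list.set_sel(2))
  ultimately show ?case using reg_total_upd[of i K R "tl (R i)"] exec_Pop
    by (simp del: fun_upd_apply compile.simps)
next
  case (exec_Seq p R n R' q n' R'')
  let ?X = "reg_total K R + (n + n') + 1"
  have 1: "texec (compile K p) (at_reg K 0 R) (n * (20 * (reg_total K R + n + 1))) (at_reg K 0 R')"
    "no_blank K R'" "reg_total K R' \<le> reg_total K R + n"
    using exec_Seq by auto
  then have 2: "texec (compile K q) (at_reg K 0 R') (n' * (20 * (reg_total K R' + n' + 1))) (at_reg K 0 R'')"
    "no_blank K R''" "reg_total K R'' \<le> reg_total K R' + n'"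
    using exec_Seq by auto
  have a: "n * (20 * (reg_total K R + n + 1)) \<le> n * (20 * ?X)" by (rule mult_le_mono2) simp
  have b: "n' * (20 * (reg_total K R' + n' + 1)) \<le> n' * (20 * ?X)"
    by (rule mult_le_mono2) (use 1 in simp)
  have "texec (compile K (CSeq p q)) (at_reg K 0 R) ((n + n') * (20 * ?X)) (at_reg K 0 R'')"
    unfolding compile.simps
    by (rule texec_SeqI[OF 1(1) 2(1)]) (use a b in \<open>simp only: add_mult_distrib add_le_mono\<close>)
  then show ?case using 1 2 by auto
next
  case (exec_If b R i p q n R')
  let ?T = "reg_total K R" and ?c = "if b (top_sym (R i)) then p else q"
  have i: "i < K" and c: "regs_below K ?c" using exec_If.prems by auto
  note 0 = fwd_reg[OF exec_If.prems(2) less_imp_le[OF i]] bwd_reg[OF exec_If.prems(2) less_imp_le[OF i]]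
  have 1: "texec (compile K ?c) (at_reg K 0 R) (n * (20 * (?T + n + 1))) (at_reg K 0 R')"
    "no_blank K R'" "reg_total K R' \<le> ?T + n"
    using exec_If.IH[OF c exec_If.prems(2)] by auto
  have "texec (TIf b (TSeq (trep i bwd) (compile K p)) (TSeq (trep i bwd) (compile K q)))
      (at_reg K i R) (4 * ?T + 1 + n * (20 * (?T + n + 1)) + 2) (at_reg K 0 R')"
    by (rule texec_IfI[OF _ le_refl])
       (use texec_Seq[OF 0(2) 1(1)] at_reg_head[OF i, of R] in \<open>simp split: if_splits\<close>)
  then have "texec (compile K (CIf i b p q)) (at_reg K 0 R) ((n + 1) * (20 * (?T + (n + 1) + 1)))
      (at_reg K 0 R')"
    unfolding compile.simps by (rule texec_SeqI[OF 0(1)]) (simp add: algebra_simps)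
  then show ?case using 1 by auto
next
  case (exec_WhileF b R i p)
  let ?T = "reg_total K R"
  have i: "i < K" using exec_WhileF by auto
  note 0 = fwd_reg[OF exec_WhileF.prems(2) less_imp_le[OF i]] bwd_reg[OF exec_WhileF.prems(2) less_imp_le[OF i]]
  have b: "\<not> b (shd (snd (at_reg K i R)))" using at_reg_head[OF i] exec_WhileF by simp
  let ?W = "TWhile b (TSeq (trep i bwd) (TSeq (compile K p) (trep i fwd)))"
  have 2: "texec ?W (at_reg K i R) 1 (at_reg K i R)"
    by (rule texec_WhileF[of b]) (rule b)
  have "texec (compile K (CWhile i b p)) (at_reg K 0 R) (1 * (20 * (?T + 1 + 1))) (at_reg K 0 R)"
    unfolding compile.simps
    by (rule texec_SeqI[OF 0(1) texec_SeqI[OF 2 0(2) le_refl]]) simp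
  moreover have "texec ?W (at_reg K i R) (1 * (20 * (?T + 1 + 1))) (at_reg K i R)"
    by (rule texec_relax[OF 2]) simp
  ultimately show ?case using exec_WhileF by auto
next
  case (exec_WhileT b R i p n R' n' R'')
  let ?X = "reg_total K R + (n + n' + 1) + 1"
  have i: "i < K" using exec_WhileT by auto
  let ?W = "TWhile b (TSeq (trep i bwd) (TSeq (compile K p) (trep i fwd)))"
  have 1: "texec (compile K p) (at_reg K 0 R) (n * (20 * (reg_total K R + n + 1))) (at_reg K 0 R')"
    "no_blank K R'" "reg_total K R' \<le> reg_total K R + n"
    using exec_WhileT by auto
  have 2: "texec ?W (at_reg K i R') (n' * (20 * (reg_total K R' + n' + 1))) (at_reg K i R'')"
    "no_blank K R''" "reg_total K R'' \<le> reg_total K R' + n'"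
    using exec_WhileT.IH(2) exec_WhileT.prems 1 by auto
  have i': "i \<le> K" using i by simp
  note 0 = fwd_reg[OF exec_WhileT.prems(2) i'] bwd_reg[OF exec_WhileT.prems(2) i']
    fwd_reg[OF 1(2) i'] bwd_reg[OF 2(2) i']
  have b: "b (shd (snd (at_reg K i R)))" using at_reg_head[OF i] exec_WhileT by simp
  have A: "n * (20 * (reg_total K R + n + 1)) \<le> n * (20 * ?X)" by (rule mult_le_mono2) simp
  have B: "n' * (20 * (reg_total K R' + n' + 1)) \<le> n' * (20 * ?X)"
    by (rule mult_le_mono2) (use 1 in simp)
  have D: "(n + n' + 1) * (20 * ?X) = n * (20 * ?X) + n' * (20 * ?X) + 20 * ?X"
    by (simp only: add_mult_distrib mult_1)
  \<comment> \<open>Of the share \<open>20 * ?X\<close> of this iteration, \<open>7 * ?X\<close>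
    pays for the test and the walks to register 0 and back to register \<open>i\<close>; the rest
    covers the walks before and after the whole loop.\<close>
  let ?I = "n * (20 * ?X) + n' * (20 * ?X) + 7 * ?X"
  have W: "texec ?W (at_reg K i R) ?I (at_reg K i R'')"
    by (rule texec_WhileI[of b, OF b texec_SeqI[OF 0(2) texec_SeqI[OF 1(1) 0(3) le_refl] le_refl] 2(1)])
       (rule while_body_time[OF A B 1(3)])
  have "texec (compile K (CWhile i b p)) (at_reg K 0 R) ((n + n' + 1) * (20 * ?X)) (at_reg K 0 R'')"
    unfolding compile.simps
    by (rule texec_SeqI[OF 0(1) texec_SeqI[OF W 0(4) le_refl]])
       (rule while_total_time[OF 1(3) 2(3) D])
  moreover have "texec ?W (at_reg K i R) ((n + n' + 1) * (20 * ?X)) (at_reg K i R'')"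
    by (rule texec_relax[OF W]) (simp only: D add_le_mono le_refl mult_le_mono)
  ultimately show ?case using 1 2 by auto
next
  case (exec_relax p R n R' m)
  have le: "n * (20 * (reg_total K R + n + 1)) \<le> m * (20 * (reg_total K R + m + 1))"
    using exec_relax by (intro mult_le_mono) auto
  show ?case using exec_relax le by (auto elim!: texec_relax)
qed

theorem cmd_to_tm:
  assumes "regs_below K c" "K > 0"
    and "exec c ((\<lambda>_. [])(0 := w)) t R'" "Blank \<notin> set w"
  shows "\<exists>k \<le> t * (20 * (length w + K + t + 1)) + 2.
    decides_in (tm_of (compile K c)) w k (top_sym (R' 0) = One)"
proof -
  let ?R = "(\<lambda>_. [])(0 := w)"
  have nb: "no_blank K ?R" using assms by (auto simp: no_blank_def)
  have tot: "reg_total K ?R = length w + K"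
  proof -
    have "reg_total K (\<lambda>_. []) = K"
      by (simp add: reg_total_def blocks_def length_concat o_def sum_list_triv)
    then show ?thesis using reg_total_upd[of 0 K "\<lambda>_. []" w] assms by simp
  qed
  have blanks: "xs @- sconst Blank = sconst Blank" if "set xs \<subseteq> {Blank}" for xs
    using that by (induction xs) (auto simp: sconst_Blank)
  \<comment> \<open>An empty register is a single blank cell, so the registers above 0 cannot be
    told from empty tape.\<close>
  have z: "at_reg K 0 ?R = (sconst Blank, w @- sconst Blank)"
  proof -
    have "map ?R [0..<K] = w # map (\<lambda>_. []) [Suc 0..<K]"
      using assms by (simp add: upt_conv)
    then have "blocks (map ?R [0..<K]) @- sconst Blank =
        w @- (Blank # blocks (map (\<lambda>_. []) [Suc 0..<K])) @- sconst Blank"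
      by simp
    also have "\<dots> = w @- sconst Blank"
      by (subst blanks) (auto simp: blocks_def)
    finally show ?thesis by (simp add: at_reg_def lft_Nil)
  qed
  have "texec (compile K c) (sconst Blank, w @- sconst Blank) (t * (20 * (length w + K + t + 1)))
      (at_reg K 0 R')"
    using compile_correct[OF assms(3,1) nb] tot z by simp
  from tm_of_decides[OF this] show ?thesis using at_reg_head[OF assms(2), of R'] by simp
qed

section \<open>Basic stack programs and codes of trees\<close>

lemma exec_eq: "exec c R n R1 \<Longrightarrow> R1 = R2 \<Longrightarrow> n \<le> m \<Longrightarrow> exec c R m R2"
  using exec_relax by blast

lemma exec_length: "exec c R n R' \<Longrightarrow> length (R' i) \<le> length (R i) + n"
  by (induction rule: exec.induct) auto

text \<open>A command cannot refer to the symbol that was just read; a family of commands is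
  dispatched on it instead.\<close>

definition on_top :: "nat \<Rightarrow> (sym \<Rightarrow> cmd) \<Rightarrow> cmd" where
  "on_top i f = CIf i (\<lambda>s. s = Zero) (f Zero) (CIf i (\<lambda>s. s = One) (f One) (f Sep))"

lemma on_top:
  assumes "R i = s # xs" "s \<noteq> Blank" "exec (f s) R n R'"
  shows "exec (on_top i f) R (n + 2) R'"
  unfolding on_top_def
proof (cases s)
  case Zero
  then show "exec (CIf i (\<lambda>s. s = Zero) (f Zero) (CIf i (\<lambda>s. s = One) (f One) (f Sep))) R (n + 2) R'"
    by (intro exec_eq[OF exec_IfT]) (use assms in auto)
next
  case One
  then show "exec (CIf i (\<lambda>s. s = Zero) (f Zero) (CIf i (\<lambda>s. s = One) (f One) (f Sep))) R (n + 2) R'"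
    by (intro exec_eq[OF exec_IfF[OF _ exec_IfT]]) (use assms in auto)
next
  case Sep
  then show "exec (CIf i (\<lambda>s. s = Zero) (f Zero) (CIf i (\<lambda>s. s = One) (f One) (f Sep))) R (n + 2) R'"
    by (intro exec_eq[OF exec_IfF[OF _ exec_IfF]]) (use assms in auto)
qed (use assms in simp)

definition xfer :: "nat \<Rightarrow> nat \<Rightarrow> cmd" where
  "xfer i j = on_top i (\<lambda>s. CSeq (Pop i) (Push j s))"

lemma xfer:
  assumes "R i = s # xs" "s \<noteq> Blank" "i \<noteq> j"
  shows "exec (xfer i j) R 4 (R(i := xs, j := s # R j))"
  unfolding xfer_def
  by (rule exec_eq[OF on_top[where s = s and xs = xs, OF _ _ exec_Seq[OF exec_Pop exec_Push]]])
     (use assms in auto)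

definition mv :: "nat \<Rightarrow> nat \<Rightarrow> cmd" where
  "mv i j = CWhile i nonblank (xfer i j)"

definition clr :: "nat \<Rightarrow> cmd" where
  "clr i = CWhile i nonblank (Pop i)"

lemma mv:
  assumes "Blank \<notin> set (R i)" "i \<noteq> j"
  shows "exec (mv i j) R (5 * length (R i) + 1) (R(i := [], j := rev (R i) @ R j))"
proof -
  have "exec (mv i j) R (5 * length xs + 1) (R(i := [], j := rev xs @ R j))"
    if "R i = xs" "Blank \<notin> set xs" for xs
    using that
  proof (induction xs arbitrary: R)
    case Nil
    have "exec (mv i j) R 1 R" unfolding mv_def by (rule exec_WhileF) (use Nil in simp)
    then show ?case by (rule exec_eq) (use Nil assms in \<open>auto simp: fun_eq_iff\<close>)
  next
    case (Cons s xs)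
    let ?R = "R(i := xs, j := s # R j)"
    have 1: "exec (xfer i j) R 4 ?R" by (rule xfer) (use Cons assms in auto)
    have 2: "exec (mv i j) ?R (5 * length xs + 1) (?R(i := [], j := rev xs @ ?R j))"
      by (rule Cons.IH) (use Cons.prems assms in auto)
    have "exec (mv i j) R (4 + (5 * length xs + 1) + 1) (?R(i := [], j := rev xs @ ?R j))"
      unfolding mv_def
      by (rule exec_WhileT[OF _ 1 2[unfolded mv_def]]) (use Cons.prems in auto)
    then show ?case by (rule exec_eq) (use assms in \<open>auto simp: fun_eq_iff\<close>)
  qed
  then show ?thesis using assms by blast
qed

lemma clr:
  assumes "Blank \<notin> set (R i)"
  shows "exec (clr i) R (2 * length (R i) + 1) (R(i := []))"
proof -
  have "exec (clr i) R (2 * length xs + 1) (R(i := []))"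
    if "R i = xs" "Blank \<notin> set xs" for xs
    using that
  proof (induction xs arbitrary: R)
    case Nil
    have "exec (clr i) R 1 R" unfolding clr_def by (rule exec_WhileF) (use Nil in simp)
    then show ?case by (rule exec_eq) (use Nil in \<open>auto simp: fun_eq_iff\<close>)
  next
    case (Cons s xs)
    let ?R = "R(i := tl (R i))"
    have 2: "exec (clr i) ?R (2 * length xs + 1) (?R(i := []))"
      by (rule Cons.IH) (use Cons.prems in auto)
    have "exec (clr i) R (1 + (2 * length xs + 1) + 1) (?R(i := []))"
      unfolding clr_def
      by (rule exec_WhileT[OF _ exec_Pop 2[unfolded clr_def]]) (use Cons.prems in auto)
    then show ?case by (rule exec_eq) (auto simp: fun_eq_iff)
  qed
  then show ?thesis using assms by blast
qed

definition xfer2 :: "nat \<Rightarrow> nat \<Rightarrow> nat \<Rightarrow> cmd" where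
  "xfer2 i j k = on_top i (\<lambda>s. CSeq (Push j s) (xfer i k))"

lemma xfer2:
  assumes "R i = s # xs" "s \<noteq> Blank" "i \<noteq> j" "i \<noteq> k" "j \<noteq> k"
  shows "exec (xfer2 i j k) R 7 (R(i := xs, j := s # R j, k := s # R k))"
  unfolding xfer2_def
  by (rule exec_eq[OF on_top[where s = s and xs = xs,
        OF _ _ exec_Seq[OF exec_Push xfer[where s = s and xs = xs]]]])
     (use assms in \<open>auto simp: fun_eq_iff\<close>)

definition mv2 :: "nat \<Rightarrow> nat \<Rightarrow> nat \<Rightarrow> cmd" where
  "mv2 i j k = CWhile i nonblank (xfer2 i j k)"

lemma mv2:
  assumes "Blank \<notin> set (R i)" "i \<noteq> j" "i \<noteq> k" "j \<noteq> k"
  shows "exec (mv2 i j k) R (8 * length (R i) + 1)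
    (R(i := [], j := rev (R i) @ R j, k := rev (R i) @ R k))"
proof -
  have "exec (mv2 i j k) R (8 * length xs + 1) (R(i := [], j := rev xs @ R j, k := rev xs @ R k))"
    if "R i = xs" "Blank \<notin> set xs" for xs
    using that
  proof (induction xs arbitrary: R)
    case Nil
    have "exec (mv2 i j k) R 1 R" unfolding mv2_def by (rule exec_WhileF) (use Nil in simp)
    then show ?case by (rule exec_eq) (use Nil assms in \<open>auto simp: fun_eq_iff\<close>)
  next
    case (Cons s xs)
    let ?R = "R(i := xs, j := s # R j, k := s # R k)"
    have 1: "exec (xfer2 i j k) R 7 ?R" by (rule xfer2) (use Cons assms in auto)
    have 2: "exec (mv2 i j k) ?R (8 * length xs + 1)
        (?R(i := [], j := rev xs @ ?R j, k := rev xs @ ?R k))"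
      by (rule Cons.IH) (use Cons.prems assms in auto)
    have "exec (mv2 i j k) R (7 + (8 * length xs + 1) + 1)
        (?R(i := [], j := rev xs @ ?R j, k := rev xs @ ?R k))"
      unfolding mv2_def
      by (rule exec_WhileT[OF _ 1 2[unfolded mv2_def]]) (use Cons.prems in auto)
    then show ?case by (rule exec_eq) (use assms in \<open>auto simp: fun_eq_iff\<close>)
  qed
  then show ?thesis using assms by blast
qed

text \<open>Pouring one stack onto another reverses it; the detour through \<open>k\<close> restores
  the order.\<close>

definition relocate :: "nat \<Rightarrow> nat \<Rightarrow> nat \<Rightarrow> cmd" where
  "relocate i j k = CSeq (mv i k) (mv k j)"

lemma relocate:
  assumes "Blank \<notin> set (R i)" "R k = []" "i \<noteq> k" "j \<noteq> k"
  shows "exec (relocate i j k) R (10 * length (R i) + 2)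
    (R(i := [], j := R i @ (if i = j then [] else R j)))"
  unfolding relocate_def
  by (rule exec_eq[OF exec_Seq[OF mv mv]]) (use assms in \<open>auto simp: fun_eq_iff\<close>)

definition dup :: "nat \<Rightarrow> nat \<Rightarrow> nat \<Rightarrow> cmd" where
  "dup i j k = CSeq (mv i k) (mv2 k i j)"

lemma dup:
  assumes "Blank \<notin> set (R i)" "R k = []" "i \<noteq> k" "j \<noteq> k" "i \<noteq> j"
  shows "exec (dup i j k) R (13 * length (R i) + 2) (R(j := R i @ R j))"
  unfolding dup_def
  by (rule exec_eq[OF exec_Seq[OF mv mv2]]) (use assms in \<open>auto simp: fun_eq_iff\<close>)

definition swap :: "nat \<Rightarrow> cmd" where
  "swap b = CSeq (mv b (b+2)) (CSeq (mv (b+1) (b+3)) (CSeq (mv (b+2) (b+1)) (mv (b+3) b)))"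

lemma swap:
  assumes "Blank \<notin> set (R b)" "Blank \<notin> set (R (b+1))" "R (b+2) = []" "R (b+3) = []"
  shows "exec (swap b) R (10 * length (R b) + 10 * length (R (b+1)) + 4)
    (R(b := R (b+1), b+1 := R b))"
  unfolding swap_def
  by (rule exec_eq[OF exec_Seq[OF mv exec_Seq[OF mv exec_Seq[OF mv mv]]]])
    (use assms in \<open>auto simp: fun_eq_iff\<close>)

text \<open>The language has no empty command. Clearing register \<open>b + 1\<close>, which is
  assumed empty in the lemma, takes its place.\<close>

primrec pushes :: "nat \<Rightarrow> sym list \<Rightarrow> cmd" where
  "pushes b [] = clr (b + 1)"
| "pushes b (s # xs) = CSeq (pushes b xs) (Push b s)"

lemma pushes:
  assumes "Blank \<notin> set xs" "R (b + 1) = []"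
  shows "exec (pushes b xs) R (length xs + 1) (R(b := xs @ R b))"
  using assms(1)
proof (induction xs)
  case Nil
  show ?case unfolding pushes.simps
    by (rule exec_eq[OF clr]) (use assms(2) in \<open>auto simp: fun_eq_iff\<close>)
next
  case (Cons s xs)
  then show ?case unfolding pushes.simps
    by (intro exec_eq[OF exec_Seq[OF Cons.IH exec_Push]]) auto
qed

datatype tree = Lf | Nd tree tree

text \<open>Preorder is self-delimiting, so codes are concatenated without separators, and the first
  symbol tells a leaf from a node.\<close>

primrec code :: "tree \<Rightarrow> sym list" where
  "code Lf = [Zero]"
| "code (Nd s t) = One # code s @ code t"

lemma code_no_blank [simp]: "Blank \<notin> set (code t)"
  by (induction t) auto

lemma code_ne [simp]: "code t \<noteq> []"
  by (cases t) auto

lemma top_code: "top_sym (code t) = (if t = Lf then Zero else One)"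
  by (cases t) auto

text \<open>Register \<open>b+2\<close> counts in unary the subtrees still to be read: a node
  replaces one pending subtree by two, a leaf completes one. The loop stops exactly at the end of
  the first subtree.\<close>

definition split_loop :: "nat \<Rightarrow> cmd" where
  "split_loop b = CWhile (b+2) nonblank
     (CSeq (CIf b (\<lambda>s. s = One) (Push (b+2) One) (Pop (b+2))) (xfer b (b+1)))"

text \<open>The rest of the run is a hypothesis (continuation style), because the two subtrees of a
  node are consumed by one and the same loop.\<close>

lemma split_loop:
  assumes "R b = code t @ rest" "R (b+2) = One # C"
    and "exec (split_loop b) (R(b := rest, b+1 := rev (code t) @ R (b+1), b+2 := C)) n R'"
  shows "exec (split_loop b) R (7 * length (code t) + n) R'"
  using assms
proof (induction t arbitrary: R rest C n)
  case Lf
  let ?R = "R(b+2 := C)"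
  have 1: "exec (CIf b (\<lambda>s. s = One) (Push (b+2) One) (Pop (b+2))) R 2 ?R"
    by (rule exec_eq[OF exec_IfF[OF _ exec_Pop]]) (use Lf in auto)
  have 2: "exec (xfer b (b+1)) ?R 4 (?R(b := rest, b+1 := Zero # ?R (b+1)))"
    by (rule xfer) (use Lf in auto)
  have eq: "?R(b := rest, b+1 := Zero # ?R (b+1)) =
      R(b := rest, b+1 := rev (code Lf) @ R (b+1), b+2 := C)"
    by (auto simp: fun_eq_iff)
  have 3: "exec (split_loop b) (?R(b := rest, b+1 := Zero # ?R (b+1))) n R'"
    unfolding eq by (rule Lf.prems(3))
  have "exec (split_loop b) R ((2 + 4) + n + 1) R'"
    unfolding split_loop_def
    by (rule exec_WhileT[OF _ exec_Seq[OF 1 2] 3[unfolded split_loop_def]])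
      (use Lf.prems in simp)
  then show ?case by (rule exec_relax) simp
next
  case (Nd s t)
  let ?R = "R(b+2 := One # One # C)"
  have 1: "exec (CIf b (\<lambda>s. s = One) (Push (b+2) One) (Pop (b+2))) R 2 ?R"
    by (rule exec_eq[OF exec_IfT[OF _ exec_Push]]) (use Nd in auto)
  let ?R1 = "?R(b := code s @ code t @ rest, b+1 := One # ?R (b+1))"
  have 2: "exec (xfer b (b+1)) ?R 4 ?R1"
    by (rule xfer) (use Nd in auto)
  let ?R2 = "?R1(b := code t @ rest, b+1 := rev (code s) @ ?R1 (b+1), b+2 := One # C)"
  let ?R3 = "?R2(b := rest, b+1 := rev (code t) @ ?R2 (b+1), b+2 := C)"
  have eq: "?R3 = R(b := rest, b+1 := rev (code (Nd s t)) @ R (b+1), b+2 := C)"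
    by (auto simp: fun_eq_iff)
  have 3: "exec (split_loop b) ?R3 n R'" unfolding eq by (rule Nd.prems(3))
  have 4: "exec (split_loop b) ?R2 (7 * length (code t) + n) R'"
    by (rule Nd.IH(2)[OF _ _ 3]) auto
  have 5: "exec (split_loop b) ?R1 (7 * length (code s) + (7 * length (code t) + n)) R'"
    by (rule Nd.IH(1)[OF _ _ 4]) auto
  have "exec (split_loop b) R ((2 + 4) + (7 * length (code s) + (7 * length (code t) + n)) + 1) R'"
    unfolding split_loop_def
    by (rule exec_WhileT[OF _ exec_Seq[OF 1 2] 5[unfolded split_loop_def]])
      (use Nd.prems in simp)
  then show ?case by (rule exec_relax) simp
qed

definition split :: "nat \<Rightarrow> cmd" where
  "split b = CSeq (Pop b) (CSeq (Push (b+2) One) (CSeq (split_loop b)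
     (CSeq (mv b (b+3)) (CSeq (mv (b+1) b) (mv (b+3) (b+1))))))"

lemma split:
  assumes "R b = code (Nd s t)" "\<forall>j>b. R j = []"
  shows "exec (split b) R (27 * length (R b) + 20) (R(b := code s, b+1 := code t))"
proof -
  let ?R = "R(b := code s @ code t, b+2 := [One])"
  let ?R1 = "?R(b := code t, b+1 := rev (code s) @ ?R (b+1), b+2 := [])"
  have 0: "exec (split_loop b) ?R1 1 ?R1"
    unfolding split_loop_def by (rule exec_WhileF) auto
  have 1: "exec (split_loop b) ?R (7 * length (code s) + 1) ?R1"
    by (rule split_loop[OF _ _ 0]) auto
  have 2: "exec (CSeq (mv b (b+3)) (CSeq (mv (b+1) b) (mv (b+3) (b+1)))) ?R1
      (20 * length (R b)) (R(b := code s, b+1 := code t))"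
    by (rule exec_eq[OF exec_Seq[OF mv exec_Seq[OF mv mv]]]) (use assms in \<open>auto simp: fun_eq_iff\<close>)
  have 3: "exec (Pop b) R 1 (R(b := code s @ code t))"
    by (rule exec_eq[OF exec_Pop]) (use assms in auto)
  have 4: "exec (Push (b+2) One) (R(b := code s @ code t)) 1 ?R"
    by (rule exec_eq[OF exec_Push]) (use assms in auto)
  show ?thesis unfolding split_def
    by (rule exec_eq[OF exec_Seq[OF 3 exec_Seq[OF 4 exec_Seq[OF 1 2]]] refl]) (use assms in simp)
qed

section \<open>Functions computable in polynomial time\<close>

class enc =
  fixes enc :: "'a \<Rightarrow> tree"

definition sz :: "'a::enc \<Rightarrow> nat" where
  "sz x = length (code (enc x))"

lemma length_code_enc [simp]: "length (code (enc x)) = sz x"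
  by (simp add: sz_def)

text \<open>This is polynomial growth as an upper bound. With base at least 2, a single exponent
  absorbs constants, sums and products.\<close>

definition poly :: "(nat \<Rightarrow> nat) \<Rightarrow> bool" where
  "poly T \<longleftrightarrow> (\<exists>k. \<forall>s. T s \<le> (s + 2) ^ k)"

lemma poly_const: "poly (\<lambda>_. c)"
proof -
  have "c \<le> (s + 2) ^ c" for s :: nat
    by (rule order.trans[OF less_imp_le[OF less_exp] power_mono]) auto
  then show ?thesis unfolding poly_def by blast
qed

lemma poly_id: "poly (\<lambda>s. s)"
  unfolding poly_def by (rule exI[of _ 1]) simp

lemma poly_power: "poly (\<lambda>s. (s + 2) ^ k)"
  unfolding poly_def by blast

lemma poly_add:
  assumes "poly T" "poly U" shows "poly (\<lambda>s. T s + U s)"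
proof -
  obtain a b where ab: "\<And>s. T s \<le> (s + 2) ^ a" "\<And>s. U s \<le> (s + 2) ^ b"
    using assms unfolding poly_def by blast
  have "T s + U s \<le> (s + 2) ^ (max a b + 1)" for s
  proof -
    have "T s \<le> (s + 2) ^ max a b" "U s \<le> (s + 2) ^ max a b"
      using ab[of s] power_increasing[of a "max a b" "s + 2"] power_increasing[of b "max a b" "s + 2"]
      by (meson le_trans max.cobounded1 max.cobounded2 le_add2 one_le_numeral order.trans)+
    then have "T s + U s \<le> 2 * (s + 2) ^ max a b" by simp
    also have "\<dots> \<le> (s + 2) * (s + 2) ^ max a b" by (rule mult_le_mono1) simp
    finally show ?thesis by simp
  qed
  then show ?thesis unfolding poly_def by blast
qed

lemma poly_mult:
  assumes "poly T" "poly U" shows "poly (\<lambda>s. T s * U s)"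
proof -
  obtain a b where ab: "\<And>s. T s \<le> (s + 2) ^ a" "\<And>s. U s \<le> (s + 2) ^ b"
    using assms unfolding poly_def by blast
  have "T s * U s \<le> (s + 2) ^ (a + b)" for s
    using mult_le_mono[OF ab(1)[of s] ab(2)[of s]] by (simp add: power_add)
  then show ?thesis unfolding poly_def by blast
qed

lemma poly_comp_power:
  assumes "poly T" shows "poly (\<lambda>s. (T s + 2) ^ k)"
proof -
  obtain a where a: "\<And>s. T s \<le> (s + 2) ^ a" using assms unfolding poly_def by blast
  have "(T s + 2) ^ k \<le> (s + 2) ^ ((a + 2) * k)" for s
  proof -
    have 1: "1 \<le> (s + 2) ^ a" by simp
    have "T s + 2 \<le> (s + 2) ^ a + 2" using a by simp
    also have "\<dots> \<le> 4 * (s + 2) ^ a" using 1 by linarith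
    also have "\<dots> \<le> (s + 2) ^ 2 * (s + 2) ^ a"
      by (rule mult_le_mono1) (simp add: power2_eq_square)
    also have "\<dots> = (s + 2) ^ (a + 2)" by (simp only: power_add mult.commute)
    finally have "(T s + 2) ^ k \<le> ((s + 2) ^ (a + 2)) ^ k" by (rule power_mono) simp
    then show ?thesis by (simp only: power_mult)
  qed
  then show ?thesis unfolding poly_def by blast
qed

lemmas poly_intros = poly_const poly_id poly_power poly_add poly_mult poly_comp_power

text \<open>The calling convention: argument and result are in register \<open>b\<close>, all
  registers above \<open>b\<close> are scratch space that is empty before and after, and those below
  are preserved. The program exists uniformly for every \<open>b\<close>, so a call can be made on
  top of saved data.\<close>

definition computes ::
  "(nat \<Rightarrow> cmd) \<Rightarrow> (nat \<Rightarrow> nat) \<Rightarrow> 'a::enc set \<Rightarrow> ('a \<Rightarrow> 'b::enc) \<Rightarrow> bool" where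
  "computes c T D f \<longleftrightarrow> (\<forall>b R x. x \<in> D \<longrightarrow> R b = code (enc x) \<longrightarrow> (\<forall>j>b. R j = []) \<longrightarrow>
     exec (c b) R (T (sz x)) (R(b := code (enc (f x)))))"

text \<open>The domain serves branches: \<open>hd\<close> or \<open>tl\<close> has to be computed
  only where the preceding test has succeeded.\<close>

definition PT_on :: "'a::enc set \<Rightarrow> ('a \<Rightarrow> 'b::enc) \<Rightarrow> bool" where
  "PT_on D f \<longleftrightarrow> (\<exists>c k. computes c (\<lambda>s. (s + 2) ^ k) D f)"

abbreviation PT :: "('a::enc \<Rightarrow> 'b::enc) \<Rightarrow> bool" where
  "PT f \<equiv> PT_on UNIV f"

lemma PT_onI:
  assumes "poly T"
    and "\<And>b R x. x \<in> D \<Longrightarrow> R b = code (enc x) \<Longrightarrow> (\<forall>j>b. R j = []) \<Longrightarrow>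
      exec (c b) R (T (sz x)) (R(b := code (enc (f x))))"
  shows "PT_on D f"
proof -
  obtain k where "\<And>s. T s \<le> (s + 2) ^ k" using assms(1) unfolding poly_def by blast
  then have "computes c (\<lambda>s. (s + 2) ^ k) D f"
    unfolding computes_def using assms(2) exec_relax by blast
  then show ?thesis unfolding PT_on_def by blast
qed

lemma computesD:
  assumes "computes c T D f" "x \<in> D" "R b = code (enc x)" "\<forall>j>b. R j = []"
  shows "exec (c b) R (T (sz x)) (R(b := code (enc (f x))))"
  using assms unfolding computes_def by blast

text \<open>A step pushes at most one symbol, so a time bound is also a size bound for the
  result.\<close>

lemma computes_size:
  assumes "computes c T D f" "x \<in> D"
  shows "sz (f x) \<le> sz x + T (sz x)"
  using exec_length[OF computesD[OF assms, of "(\<lambda>_. [])(0 := code (enc x))" 0], of 0] by simp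

lemma PT_on_size:
  assumes "PT_on D f"
  shows "\<exists>T. poly T \<and> mono T \<and> (\<forall>x\<in>D. sz (f x) \<le> T (sz x))"
proof -
  obtain c k where c: "computes c (\<lambda>s. (s + 2) ^ k) D f" using assms by (auto simp: PT_on_def)
  have "mono (\<lambda>s :: nat. s + (s + 2) ^ k)"
    by (intro monoI add_mono power_mono) auto
  moreover have "poly (\<lambda>s. s + (s + 2) ^ k)" by (intro poly_intros)
  ultimately show ?thesis using computes_size[OF c] by blast
qed

lemma PT_on_subset: "PT_on E f \<Longrightarrow> D \<subseteq> E \<Longrightarrow> PT_on D f"
proof -
  assume "PT_on E f" "D \<subseteq> E"
  then obtain c k where "computes c (\<lambda>s. (s + 2) ^ k) E f" by (auto simp: PT_on_def)
  then have "computes c (\<lambda>s. (s + 2) ^ k) D f"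
    using \<open>D \<subseteq> E\<close> unfolding computes_def by blast
  then show ?thesis unfolding PT_on_def by blast
qed

lemma PT_on_id: "PT_on D (\<lambda>x. x)"
proof (rule PT_onI[where T = "\<lambda>_. 1" and c = "\<lambda>b. clr (b + 1)"])
  fix b :: nat and R :: regs and x assume "x \<in> D" "R b = code (enc x)" "\<forall>j>b. R j = []"
  then show "exec (clr (b + 1)) R 1 (R(b := code (enc x)))"
    by (intro exec_eq[OF clr]) (auto simp: fun_eq_iff)
qed (intro poly_intros)

lemma PT_on_const: "PT_on D (\<lambda>_. y)"
proof (rule PT_onI[where T = "\<lambda>s. 2 * s + sz y + 2" and c = "\<lambda>b. CSeq (clr b) (pushes b (code (enc y)))"])
  fix b :: nat and R :: regs and x assume "x \<in> D" "R b = code (enc x)" "\<forall>j>b. R j = []"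
  then show "exec (CSeq (clr b) (pushes b (code (enc y)))) R (2 * sz x + sz y + 2)
      (R(b := code (enc y)))"
    by (intro exec_eq[OF exec_Seq[OF clr pushes]]) (auto simp: fun_eq_iff)
qed (intro poly_intros)

lemma PT_on_comp:
  assumes "PT_on E g" "PT_on D f" "f ` D \<subseteq> E"
  shows "PT_on D (\<lambda>x. g (f x))"
proof -
  obtain cf k where f: "computes cf (\<lambda>s. (s + 2) ^ k) D f" using assms by (auto simp: PT_on_def)
  obtain cg m where g: "computes cg (\<lambda>s. (s + 2) ^ m) E g" using assms by (auto simp: PT_on_def)
  show ?thesis
  proof (rule PT_onI[where T = "\<lambda>s. (s + 2) ^ k + ((s + (s + 2) ^ k) + 2) ^ m"
        and c = "\<lambda>b. CSeq (cf b) (cg b)"])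
    fix b :: nat and R :: regs and x assume x: "x \<in> D" "R b = code (enc x)" "\<forall>j>b. R j = []"
    have 1: "exec (cf b) R ((sz x + 2) ^ k) (R(b := code (enc (f x))))"
      using computesD[OF f] x by simp
    have 2: "exec (cg b) (R(b := code (enc (f x)))) ((sz (f x) + 2) ^ m)
        ((R(b := code (enc (f x))))(b := code (enc (g (f x)))))"
      by (rule computesD[OF g]) (use x assms(3) in auto)
    have 3: "(sz (f x) + 2) ^ m \<le> ((sz x + (sz x + 2) ^ k) + 2) ^ m"
      by (rule power_mono) (use computes_size[OF f x(1)] in auto)
    show "exec (CSeq (cf b) (cg b)) R ((sz x + 2) ^ k + ((sz x + (sz x + 2) ^ k) + 2) ^ m)
        (R(b := code (enc (g (f x)))))"
      by (rule exec_eq[OF exec_Seq[OF 1 2]]) (use 3 in auto)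
  qed (intro poly_intros)
qed

lemma PT_comp: "PT g \<Longrightarrow> PT f \<Longrightarrow> PT (\<lambda>x. g (f x))"
  by (rule PT_on_comp) auto

text \<open>The second component is computed first, on a copy above the argument; after the swap the
  argument is again the topmost register, as required to run the program for the first one.\<close>

lemma PT_on_node:
  assumes "PT_on D f" "PT_on D g" "\<And>x. x \<in> D \<Longrightarrow> enc (h x) = Nd (enc (f x)) (enc (g x))"
  shows "PT_on D h"
proof -
  obtain cf k where f: "computes cf (\<lambda>s. (s + 2) ^ k) D f" using assms by (auto simp: PT_on_def)
  obtain cg m where g: "computes cg (\<lambda>s. (s + 2) ^ m) D g" using assms by (auto simp: PT_on_def)
  let ?c = "\<lambda>b. CSeq (dup b (b+1) (b+2)) (CSeq (cg (b+1)) (CSeq (swap b) (CSeq (cf (b+1))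
     (CSeq (mv (b+1) (b+2)) (CSeq (mv (b+2) b) (Push b One))))))"
  let ?T = "\<lambda>s. 13 * s + 2 + ((s + 2) ^ m + ((10 * (s + (s + 2) ^ m) + 10 * s + 4)
     + ((s + 2) ^ k + ((5 * (s + (s + 2) ^ k) + 1) + ((5 * (s + (s + 2) ^ k) + 1) + 1)))))"
  show ?thesis
  proof (rule PT_onI[where T = ?T and c = ?c])
    fix b :: nat and R :: regs and x assume x: "x \<in> D" "R b = code (enc x)" "\<forall>j>b. R j = []"
    let ?s1 = "R(b+1 := code (enc x))"
    let ?s2 = "R(b+1 := code (enc (g x)))"
    let ?s3 = "R(b := code (enc (g x)), b+1 := code (enc x))"
    let ?s4 = "R(b := code (enc (g x)), b+1 := code (enc (f x)))"
    let ?s5 = "R(b := code (enc (g x)), b+2 := rev (code (enc (f x))))"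
    let ?s6 = "R(b := code (enc (f x)) @ code (enc (g x)))"
    have 1: "exec (dup b (b+1) (b+2)) R (13 * sz x + 2) ?s1"
      by (rule exec_eq[OF dup]) (use x in \<open>auto simp: fun_eq_iff\<close>)
    have 2: "exec (cg (b+1)) ?s1 ((sz x + 2) ^ m) ?s2"
      by (rule exec_eq[OF computesD[OF g x(1)]]) (use x in \<open>auto simp: fun_eq_iff\<close>)
    have 3: "exec (swap b) ?s2 (10 * (sz x + (sz x + 2) ^ m) + 10 * sz x + 4) ?s3"
      by (rule exec_eq[OF swap]) (use x computes_size[OF g x(1)] in \<open>auto simp: fun_eq_iff\<close>)
    have 4: "exec (cf (b+1)) ?s3 ((sz x + 2) ^ k) ?s4"
      by (rule exec_eq[OF computesD[OF f x(1)]]) (use x in \<open>auto simp: fun_eq_iff\<close>)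
    have 5: "exec (mv (b+1) (b+2)) ?s4 (5 * (sz x + (sz x + 2) ^ k) + 1) ?s5"
      by (rule exec_eq[OF mv]) (use x computes_size[OF f x(1)] in \<open>auto simp: fun_eq_iff\<close>)
    have 6: "exec (mv (b+2) b) ?s5 (5 * (sz x + (sz x + 2) ^ k) + 1) ?s6"
      by (rule exec_eq[OF mv]) (use x computes_size[OF f x(1)] in \<open>auto simp: fun_eq_iff\<close>)
    have 7: "exec (Push b One) ?s6 1 (R(b := code (enc (h x))))"
      by (rule exec_eq[OF exec_Push]) (use assms(3)[OF x(1)] in auto)
    show "exec (?c b) R (?T (sz x)) (R(b := code (enc (h x))))"
      by (rule exec_Seq[OF 1 exec_Seq[OF 2 exec_Seq[OF 3 exec_Seq[OF 4 exec_Seq[OF 5 exec_Seq[OF 6 7]]]]]])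
  qed (intro poly_intros)
qed

lemma PT_on_left:
  assumes "\<And>x. x \<in> D \<Longrightarrow> \<exists>t. enc x = Nd (enc (f x)) t"
  shows "PT_on D f"
proof (rule PT_onI[where T = "\<lambda>s. (27 * s + 20) + (2 * s + 1)" and c = "\<lambda>b. CSeq (split b) (clr (b+1))"])
  fix b :: nat and R :: regs and x assume x: "x \<in> D" "R b = code (enc x)" "\<forall>j>b. R j = []"
  obtain t where t: "enc x = Nd (enc (f x)) t" using assms[OF x(1)] by blast
  have s: "sz x = 1 + sz (f x) + length (code t)" by (simp add: sz_def t del: length_code_enc)
  have 1: "exec (split b) R (27 * sz x + 20) (R(b := code (enc (f x)), b+1 := code t))"
    by (rule exec_eq[OF split[where s = "enc (f x)" and t = t]]) (use x t s in auto)
  have 2: "exec (clr (b+1)) (R(b := code (enc (f x)), b+1 := code t)) (2 * sz x + 1)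
      (R(b := code (enc (f x))))"
    by (rule exec_eq[OF clr]) (use x s in \<open>auto simp: fun_eq_iff\<close>)
  show "exec (CSeq (split b) (clr (b+1))) R ((27 * sz x + 20) + (2 * sz x + 1)) (R(b := code (enc (f x))))"
    by (rule exec_Seq[OF 1 2])
qed (intro poly_intros)

lemma PT_on_right:
  assumes "\<And>x. x \<in> D \<Longrightarrow> \<exists>t. enc x = Nd t (enc (f x))"
  shows "PT_on D f"
proof (rule PT_onI[where T = "\<lambda>s. (27 * s + 20) + ((2 * s + 1) + (10 * s + 2))"
      and c = "\<lambda>b. CSeq (split b) (CSeq (clr b) (relocate (b+1) b (b+2)))"])
  fix b :: nat and R :: regs and x assume x: "x \<in> D" "R b = code (enc x)" "\<forall>j>b. R j = []"
  obtain t where t: "enc x = Nd t (enc (f x))" using assms[OF x(1)] by blast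
  have s: "sz x = 1 + sz (f x) + length (code t)" by (simp add: sz_def t del: length_code_enc)
  have 1: "exec (split b) R (27 * sz x + 20) (R(b := code t, b+1 := code (enc (f x))))"
    by (rule exec_eq[OF split[where s = t and t = "enc (f x)"]]) (use x t s in auto)
  have 2: "exec (clr b) (R(b := code t, b+1 := code (enc (f x)))) (2 * sz x + 1)
      (R(b := [], b+1 := code (enc (f x))))"
    by (rule exec_eq[OF clr]) (use x s in \<open>auto simp: fun_eq_iff\<close>)
  have 3: "exec (relocate (b+1) b (b+2)) (R(b := [], b+1 := code (enc (f x)))) (10 * sz x + 2)
      (R(b := code (enc (f x))))"
    by (rule exec_eq[OF relocate]) (use x s in \<open>auto simp: fun_eq_iff\<close>)
  show "exec (CSeq (split b) (CSeq (clr b) (relocate (b+1) b (b+2)))) R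
      ((27 * sz x + 20) + ((2 * sz x + 1) + (10 * sz x + 2))) (R(b := code (enc (f x))))"
    by (rule exec_Seq[OF 1 exec_Seq[OF 2 3]])
qed (intro poly_intros)

text \<open>The test inspects only the top symbol of a code. Hence one rule serves booleans,
  emptiness of lists and vanishing of numbers.\<close>

lemma PT_on_if_enc:
  assumes "PT_on D p" "PT_on {x \<in> D. enc (p x) \<noteq> Lf} f" "PT_on {x \<in> D. enc (p x) = Lf} g"
  shows "PT_on D (\<lambda>x. if enc (p x) \<noteq> Lf then f x else g x)"
proof -
  obtain cp i where p: "computes cp (\<lambda>s. (s + 2) ^ i) D p" using assms by (auto simp: PT_on_def)
  obtain cf k where f: "computes cf (\<lambda>s. (s + 2) ^ k) {x \<in> D. enc (p x) \<noteq> Lf} f"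
    using assms by (auto simp: PT_on_def)
  obtain cg m where g: "computes cg (\<lambda>s. (s + 2) ^ m) {x \<in> D. enc (p x) = Lf} g"
    using assms by (auto simp: PT_on_def)
  let ?c = "\<lambda>b. CSeq (dup b (b+1) (b+2)) (CSeq (cp (b+1)) (CIf (b+1) (\<lambda>s. s = One)
     (CSeq (clr (b+1)) (cf b)) (CSeq (clr (b+1)) (cg b))))"
  let ?T = "\<lambda>s. 13 * s + 2 + ((s + 2) ^ i + (((2 * (s + (s + 2) ^ i) + 1) + ((s + 2) ^ k + (s + 2) ^ m)) + 1))"
  show ?thesis
  proof (rule PT_onI[where T = ?T and c = ?c])
    fix b :: nat and R :: regs and x assume x: "x \<in> D" "R b = code (enc x)" "\<forall>j>b. R j = []"
    let ?s1 = "R(b+1 := code (enc x))"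
    let ?s2 = "R(b+1 := code (enc (p x)))"
    let ?r = "if enc (p x) \<noteq> Lf then f x else g x"
    have 1: "exec (dup b (b+1) (b+2)) R (13 * sz x + 2) ?s1"
      by (rule exec_eq[OF dup]) (use x in \<open>auto simp: fun_eq_iff\<close>)
    have 2: "exec (cp (b+1)) ?s1 ((sz x + 2) ^ i) ?s2"
      by (rule exec_eq[OF computesD[OF p x(1)]]) (use x in \<open>auto simp: fun_eq_iff\<close>)
    have 3: "exec (clr (b+1)) ?s2 (2 * (sz x + (sz x + 2) ^ i) + 1) R"
      by (rule exec_eq[OF clr]) (use x computes_size[OF p x(1)] in \<open>auto simp: fun_eq_iff\<close>)
    have t: "top_sym (?s2 (b+1)) = (if enc (p x) = Lf then Zero else One)" by (simp add: top_code)
    have 4: "exec (CIf (b+1) (\<lambda>s. s = One) (CSeq (clr (b+1)) (cf b)) (CSeq (clr (b+1)) (cg b))) ?s2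
        ((2 * (sz x + (sz x + 2) ^ i) + 1) + ((sz x + 2) ^ k + (sz x + 2) ^ m) + 1)
        (R(b := code (enc ?r)))"
    proof (cases "enc (p x) = Lf")
      case True
      have 4: "exec (cg b) R ((sz x + 2) ^ m) (R(b := code (enc ?r)))"
        by (rule exec_eq[OF computesD[OF g]]) (use x True in auto)
      show ?thesis
        by (rule exec_eq[OF exec_IfF[OF _ exec_Seq[OF 3 4]] refl]) (use t True in auto)
    next
      case False
      have 4: "exec (cf b) R ((sz x + 2) ^ k) (R(b := code (enc ?r)))"
        by (rule exec_eq[OF computesD[OF f]]) (use x False in auto)
      show ?thesis
        by (rule exec_eq[OF exec_IfT[OF _ exec_Seq[OF 3 4]] refl]) (use t False in auto)
    qed
    show "exec (?c b) R (?T (sz x)) (R(b := code (enc ?r)))"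
      by (rule exec_Seq[OF 1 exec_Seq[OF 2 4]])
  qed (intro poly_intros)
qed

text \<open>A word serves as a unary counter whose contents are ignored; the body runs one register
  higher and so leaves the counter intact.\<close>

definition loop :: "(nat \<Rightarrow> cmd) \<Rightarrow> nat \<Rightarrow> cmd" where
  "loop c b = CWhile b nonblank (CSeq (Pop b) (c (b+1)))"

lemma loop:
  fixes f :: "'a::enc \<Rightarrow> 'a"
  assumes "computes c (\<lambda>s. (s + 2) ^ k) UNIV f" "R b = xs" "Blank \<notin> set xs"
    "R (b+1) = code (enc y)" "\<forall>j>b+1. R j = []"
    "\<forall>j\<le>length xs. sz ((f ^^ j) y) \<le> B"
  shows "exec (loop c b) R (length xs * ((B + 2) ^ k + 2) + 1)
    (R(b := [], b+1 := code (enc ((f ^^ length xs) y))))"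
  using assms(2-)
proof (induction xs arbitrary: R y)
  case Nil
  have "exec (loop c b) R 1 R" unfolding loop_def by (rule exec_WhileF) (use Nil in simp)
  then show ?case by (rule exec_eq) (use Nil in \<open>auto simp: fun_eq_iff\<close>)
next
  case (Cons s xs)
  let ?R = "R(b := xs)"
  let ?R1 = "?R(b+1 := code (enc (f y)))"
  have 1: "exec (Pop b) R 1 ?R" by (rule exec_eq[OF exec_Pop]) (use Cons in auto)
  have "sz y \<le> B" using Cons.prems(5) by (auto dest: spec[of _ 0])
  then have B: "(sz y + 2) ^ k \<le> (B + 2) ^ k" by (intro power_mono) auto
  have 2: "exec (c (b+1)) ?R ((B + 2) ^ k) ?R1"
    by (rule exec_relax[OF computesD[OF assms(1), of y] B]) (use Cons.prems in auto)
  have "\<forall>j\<le>length xs. sz ((f ^^ j) (f y)) \<le> B"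
    using Cons.prems(5) by (auto simp: funpow_swap1[symmetric] dest: spec[of _ "Suc _"])
  then have 3: "exec (loop c b) ?R1 (length xs * ((B + 2) ^ k + 2) + 1)
      (?R1(b := [], b+1 := code (enc ((f ^^ length xs) (f y)))))"
    by (intro Cons.IH) (use Cons.prems in auto)
  have "exec (loop c b) R ((1 + (B + 2) ^ k) + (length xs * ((B + 2) ^ k + 2) + 1) + 1)
      (?R1(b := [], b+1 := code (enc ((f ^^ length xs) (f y)))))"
    unfolding loop_def
    by (rule exec_WhileT[OF _ exec_Seq[OF 1 2] 3[unfolded loop_def]]) (use Cons.prems in auto)
  then show ?case
    by (rule exec_eq) (auto simp: fun_eq_iff funpow_swap1)
qed

text \<open>The number of rounds is the length of the code of \<open>n e\<close>. The bound
  \<open>U\<close> on all iterates is the crux: a map that merely doubles its argument would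
  otherwise lead to exponential size.\<close>

lemma PT_funpow_pair:
  fixes f :: "'a::enc \<Rightarrow> 'a" and na :: "'e::enc \<Rightarrow> 'p::enc" and n :: "'e \<Rightarrow> 'n::enc"
  assumes "PT f" "PT na" "poly U" "\<And>e. enc (na e) = Nd (enc (n e)) (enc (a e))"
    "\<And>e i. i \<le> sz (n e) \<Longrightarrow> sz ((f ^^ i) (a e)) \<le> U (sz e)"
  shows "PT (\<lambda>e. (f ^^ sz (n e)) (a e))"
proof -
  obtain cf k where f: "computes cf (\<lambda>s. (s + 2) ^ k) UNIV f" using assms by (auto simp: PT_on_def)
  obtain cn m where n: "computes cn (\<lambda>s. (s + 2) ^ m) UNIV na" using assms by (auto simp: PT_on_def)
  let ?N = "\<lambda>s. s + (s + 2) ^ m"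
  let ?c = "\<lambda>b. CSeq (cn b) (CSeq (split b) (CSeq (loop cf b) (relocate (b+1) b (b+2))))"
  let ?T = "\<lambda>s. (s + 2) ^ m + ((27 * ?N s + 20) + ((?N s * ((U s + 2) ^ k + 2) + 1) + (10 * U s + 2)))"
  show ?thesis
  proof (rule PT_onI[where T = ?T and c = ?c])
    fix b :: nat and R :: regs and x :: 'e assume xU: "x \<in> UNIV" and x: "R b = code (enc x)" "\<forall>j>b. R j = []"
    let ?s1 = "R(b := code (enc (na x)))"
    let ?s2 = "R(b := code (enc (n x)), b+1 := code (enc (a x)))"
    let ?r = "(f ^^ sz (n x)) (a x)"
    let ?s3 = "R(b := [], b+1 := code (enc ?r))"
    have N: "sz (na x) \<le> ?N (sz x)" using computes_size[OF n] by simp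
    have nN: "sz (n x) \<le> sz (na x)" by (simp add: sz_def assms(4) del: length_code_enc)
    have 1: "exec (cn b) R ((sz x + 2) ^ m) ?s1"
      by (rule computesD[OF n]) (use x in auto)
    have 2: "exec (split b) ?s1 (27 * ?N (sz x) + 20) ?s2"
      by (rule exec_eq[OF split[where s = "enc (n x)" and t = "enc (a x)"]])
        (use x N assms(4)[of x] in \<open>auto simp: fun_eq_iff sz_def simp del: length_code_enc\<close>)
    have 3: "exec (loop cf b) ?s2 (sz (n x) * ((U (sz x) + 2) ^ k + 2) + 1) ?s3"
      by (rule exec_eq[OF loop[OF f, where xs = "code (enc (n x))" and y = "a x" and B = "U (sz x)"]])
        (use x assms(5) in \<open>auto simp: fun_eq_iff\<close>)
    have 3: "exec (loop cf b) ?s2 (?N (sz x) * ((U (sz x) + 2) ^ k + 2) + 1) ?s3"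
      by (rule exec_relax[OF 3 add_le_mono1[OF mult_le_mono1[OF order.trans[OF nN N]]]])
    have 4: "exec (relocate (b+1) b (b+2)) ?s3 (10 * U (sz x) + 2) (R(b := code (enc ?r)))"
      by (rule exec_eq[OF relocate]) (use x assms(5)[of "sz (n x)" x] in \<open>auto simp: fun_eq_iff\<close>)
    show "exec (?c b) R (?T (sz x)) (R(b := code (enc ?r)))"
      by (rule exec_Seq[OF 1 exec_Seq[OF 2 exec_Seq[OF 3 4]]])
  qed (intro poly_intros assms(3))
qed

section \<open>Data types\<close>

lemma PT_size: "PT f \<Longrightarrow> \<exists>k. \<forall>x. sz (f x) \<le> (sz x + 2) ^ k"
  using PT_on_size[of UNIV f] unfolding poly_def by (meson UNIV_I order.trans)

lemma PT_size_poly: "PT f \<Longrightarrow> \<exists>T. poly T \<and> (\<forall>x. sz (f x) \<le> T (sz x))"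
  using PT_size poly_power by meson

instantiation bool :: enc
begin
definition "enc b = (if b then Nd Lf Lf else Lf)"
instance ..
end

instantiation prod :: (enc, enc) enc
begin
definition "enc p = Nd (enc (fst p)) (enc (snd p))"
instance ..
end

instantiation list :: (enc) enc
begin
definition "enc xs = foldr (\<lambda>x t. Nd (enc x) t) xs Lf"
instance ..
end

text \<open>The tests for \<open>Sep\<close> and \<open>One\<close> are then the two projections of
  the code. \<open>Blank\<close> shares its code with \<open>Zero\<close>, which is harmless as
  words handed to the machine contain no blank.\<close>

instantiation sym :: enc
begin
definition "enc s = Nd (enc (s = Sep)) (enc (s = One))"
instance ..
end

text \<open>Numbers are stored in binary, least significant bit first. Both bits get codes of the same
  length, so that the size of a number depends only on its number of bits.\<close>

definition bit_tree :: "bool \<Rightarrow> tree" where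
  "bit_tree b = Nd (enc b) (enc (\<not> b))"

fun nat_tree :: "nat \<Rightarrow> tree" where
  "nat_tree n = (if n = 0 then Lf else Nd (bit_tree (odd n)) (nat_tree (n div 2)))"

fun bitlen :: "nat \<Rightarrow> nat" where
  "bitlen n = (if n = 0 then 0 else Suc (bitlen (n div 2)))"

declare nat_tree.simps [simp del] bitlen.simps [simp del]

instantiation nat :: enc
begin
definition "enc n = nat_tree n"
instance ..
end

lemma enc_list_simps [simp]: "enc ([] :: 'a::enc list) = Lf" "enc (x # xs) = Nd (enc x) (enc xs)"
  by (simp_all add: enc_list_def)

lemma enc_pair [simp]: "enc (a, b) = Nd (enc a) (enc b)"
  by (simp add: enc_prod_def)

lemma enc_nat_0 [simp]: "enc (0 :: nat) = Lf"
  by (simp add: enc_nat_def nat_tree.simps)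

lemma enc_nat_pos: "n > 0 \<Longrightarrow> enc (n :: nat) = Nd (bit_tree (odd n)) (enc (n div 2))"
  by (simp add: enc_nat_def nat_tree.simps[of n])

lemma enc_Lf_iff [simp]:
  "enc xs = Lf \<longleftrightarrow> xs = []" "enc b = Lf \<longleftrightarrow> \<not> b" "enc n = Lf \<longleftrightarrow> n = 0"
  for xs :: "'a::enc list" and b :: bool and n :: nat
    apply (cases xs; simp)
   apply (simp add: enc_bool_def)
  apply (cases "n = 0"; simp add: enc_nat_pos)
  done

lemma sz_pair [simp]: "sz (a, b) = 1 + sz a + sz b"
  by (simp add: sz_def del: length_code_enc)

lemma sz_prod: "sz p = 1 + sz (fst p) + sz (snd p)"
  by (cases p) simp

lemma sz_Nil [simp]: "sz ([] :: 'a::enc list) = 1"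
  by (simp add: sz_def del: length_code_enc)

lemma sz_Cons [simp]: "sz (x # xs) = 1 + sz x + sz xs"
  by (simp add: sz_def del: length_code_enc)

lemma sz_bool: "sz (b :: bool) \<le> 3"
  by (simp add: sz_def enc_bool_def del: length_code_enc)

text \<open>Six symbols per bit: one node of the spine and five for the pair of complementary
  flags.\<close>

lemma sz_nat: "sz n = 6 * bitlen n + 1"
proof (induction n rule: bitlen.induct)
  case (1 n)
  show ?case
  proof (cases "n = 0")
    case True
    then show ?thesis by (simp add: sz_def bitlen.simps del: length_code_enc)
  next
    case False
    have "sz n = 6 + sz (n div 2)"
      using False by (simp add: sz_def enc_nat_pos bit_tree_def enc_bool_def del: length_code_enc)
    then show ?thesis using 1 False by (simp add: bitlen.simps[of n])
  qed
qed

lemma sz_pos: "0 < sz x"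
  by (simp add: sz_def del: length_code_enc)

lemma sz_append: "sz (xs @ ys) + 1 = sz xs + sz ys"
  by (induction xs) auto

lemma sz_elem: "x \<in> set xs \<Longrightarrow> sz x \<le> sz xs"
  by (induction xs) auto

lemma length_le_sz: "length xs \<le> sz xs"
  by (induction xs) auto

lemma sz_drop: "sz (drop i xs) \<le> sz xs"
  using sz_append[of "take i xs" "drop i xs"] sz_pos[of "take i xs"] by simp

lemma sz_list_le: "(\<And>x. x \<in> set xs \<Longrightarrow> sz x \<le> B) \<Longrightarrow> sz xs \<le> length xs * (B + 1) + 1"
proof (induction xs)
  case (Cons x xs)
  then have "sz x \<le> B" "sz xs \<le> length xs * (B + 1) + 1" by auto
  then show ?case by simp
qed simp

lemma less_two_power_bitlen: "n < 2 ^ bitlen n"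
proof (induction n rule: bitlen.induct)
  case (1 n)
  then show ?case by (cases "n = 0") (auto simp: bitlen.simps[of n])
qed

lemma bitlen_le_iff: "bitlen n \<le> k \<longleftrightarrow> n < 2 ^ k"
proof
  assume "bitlen n \<le> k"
  then have "(2::nat) ^ bitlen n \<le> 2 ^ k" by simp
  then show "n < 2 ^ k" using less_two_power_bitlen[of n] by linarith
next
  show "n < 2 ^ k \<Longrightarrow> bitlen n \<le> k"
  proof (induction n arbitrary: k rule: bitlen.induct)
    case (1 n)
    show ?case
    proof (cases "n = 0")
      case True then show ?thesis by (simp add: bitlen.simps)
    next
      case False
      then obtain k' where "k = Suc k'" using "1.prems" by (cases k) auto
      then show ?thesis using 1 False by (simp add: bitlen.simps[of n])
    qed
  qed
qed

lemma bitlen_mono: "m \<le> n \<Longrightarrow> bitlen m \<le> bitlen n"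
  using bitlen_le_iff less_two_power_bitlen by (meson le_less_trans)

lemma bitlen_0 [simp]: "bitlen 0 = 0"
  by (simp add: bitlen.simps)

lemma bitlen_add: "bitlen (m + n) \<le> bitlen m + bitlen n"
proof (cases "m = 0 \<or> n = 0")
  case False
  then have "bitlen m > 0" "bitlen n > 0" by (simp_all add: bitlen.simps)
  then obtain a b where ab: "bitlen m = Suc a" "bitlen n = Suc b" by (metis gr0_implies_Suc)
  have "m + n < 2 ^ Suc a + 2 ^ Suc b"
    using less_two_power_bitlen[of m] less_two_power_bitlen[of n] ab by simp
  also have "\<dots> = 2 * 2 ^ a + 2 * 2 ^ b" by simp
  also have "\<dots> \<le> 2 * (2 ^ a * 2 ^ b) + 2 * (2 ^ a * 2 ^ b)"
    by (intro add_mono mult_le_mono2) auto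
  also have "\<dots> = 2 ^ (bitlen m + bitlen n)" by (simp add: ab power_add)
  finally show ?thesis by (simp add: bitlen_le_iff)
qed auto

lemma bitlen_mult: "bitlen (m * n) \<le> bitlen m + bitlen n"
  unfolding bitlen_le_iff power_add
  by (intro mult_strict_mono' less_two_power_bitlen) auto

lemma bitlen_le: "bitlen n \<le> n"
  by (simp add: bitlen_le_iff)

lemma bitlen_Suc: "bitlen (Suc n) \<le> Suc (bitlen n)"
  using bitlen_add[of n 1] by (simp add: bitlen.simps[of "Suc 0"])

lemma bitlen_double: "bitlen (2 * n + of_bool b) \<le> Suc (bitlen n)"
  unfolding bitlen_le_iff using less_two_power_bitlen[of n] by auto

subsection \<open>Closure properties\<close>

lemma PT_cong: "PT f \<Longrightarrow> (\<And>x. f x = g x) \<Longrightarrow> PT g"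
  using ext[of f g] by simp

lemma PT_id: "PT (\<lambda>x. x)"
  by (rule PT_on_id)

lemma PT_const: "PT (\<lambda>_. y)"
  by (rule PT_on_const)

lemma PT_Pair: "PT f \<Longrightarrow> PT g \<Longrightarrow> PT (\<lambda>x. (f x, g x))"
  by (rule PT_on_node) auto

lemma PT_fst: "PT f \<Longrightarrow> PT (\<lambda>x. fst (f x))"
  by (rule PT_comp[OF PT_on_left]) (auto simp: enc_prod_def)

lemma PT_snd: "PT f \<Longrightarrow> PT (\<lambda>x. snd (f x))"
  by (rule PT_comp[OF PT_on_right]) (auto simp: enc_prod_def)

lemma PT_Cons: "PT f \<Longrightarrow> PT g \<Longrightarrow> PT (\<lambda>x. f x # g x)"
  by (rule PT_on_node) auto

lemma PT_if:
  assumes "PT p" "PT f" "PT g"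
  shows "PT (\<lambda>x. if p x then f x else g x)"
  using PT_on_if_enc[of UNIV p f g] assms by (auto intro: PT_on_subset)

lemma PT_not: "PT p \<Longrightarrow> PT (\<lambda>x. \<not> p x)"
  by (rule PT_cong[OF PT_if[of p "\<lambda>_. False" "\<lambda>_. True"]]) (auto intro: PT_const)

lemma PT_conj: "PT p \<Longrightarrow> PT q \<Longrightarrow> PT (\<lambda>x. p x \<and> q x)"
  by (rule PT_cong[OF PT_if[of p q "\<lambda>_. False"]]) (auto intro: PT_const)

lemma PT_disj: "PT p \<Longrightarrow> PT q \<Longrightarrow> PT (\<lambda>x. p x \<or> q x)"
  using PT_not[OF PT_conj[OF PT_not PT_not]] by simp

lemma PT_null: "PT f \<Longrightarrow> PT (\<lambda>x. f x = [])"
  by (rule PT_cong[OF PT_on_if_enc[of UNIV f "\<lambda>_. False" "\<lambda>_. True"]]) (auto intro: PT_on_const)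

lemma PT_eq_0: "PT f \<Longrightarrow> PT (\<lambda>x. f x = (0 :: nat))"
  by (rule PT_cong[OF PT_on_if_enc[of UNIV f "\<lambda>_. False" "\<lambda>_. True"]]) (auto intro: PT_on_const)

lemma PT_on_hd: "PT_on {xs. xs \<noteq> []} hd"
  by (rule PT_on_left) (auto simp: neq_Nil_conv)

lemma PT_on_tl: "PT_on {xs. xs \<noteq> []} tl"
  by (rule PT_on_right) (auto simp: neq_Nil_conv)

text \<open>\<open>take 1\<close> is a total substitute for \<open>hd\<close>; the auction is
  phrased with it for this reason.\<close>

lemma PT_take1:
  assumes "PT f" shows "PT (\<lambda>x. take 1 (f x))"
proof -
  have "PT (\<lambda>xs :: 'b list. if enc xs \<noteq> Lf then [hd xs] else [])"
    by (rule PT_on_if_enc) (auto intro!: PT_id PT_on_const PT_on_node[OF PT_on_hd PT_on_const[of _ "[] :: 'b list"]])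
  from PT_comp[OF this assms] show ?thesis
    by (rule back_subst[of PT]) (auto simp: fun_eq_iff take_Suc)
qed

text \<open>The state is the remaining list, the accumulator and a fixed parameter. Once the list is
  exhausted the step idles, so running more rounds than the list has elements, namely as many as its
  size, does no harm.\<close>

lemma funpow_fold_step:
  "((\<lambda>s. if fst (fst s) \<noteq> [] then ((tl (fst (fst s)), g (hd (fst (fst s))) (snd (fst s)) (snd s)), snd s)
      else s) ^^ i) ((xs, acc), e) = ((drop i xs, fold (\<lambda>x acc. g x acc e) (take i xs) acc), e)"
proof (induction i arbitrary: xs acc)
  case (Suc i)
  show ?case by (cases xs) (simp_all only: funpow_Suc_right o_apply, simp_all add: Suc)
qed simp

lemma PT_fold:
  fixes g :: "'x::enc \<Rightarrow> 'a::enc \<Rightarrow> 'e::enc \<Rightarrow> 'a"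
  assumes g: "PT (\<lambda>p. g (fst p) (fst (snd p)) (snd (snd p)))" and l: "PT l" and a: "PT a"
    and U: "poly U" "\<And>e i. sz (fold (\<lambda>x acc. g x acc e) (take i (l e)) (a e)) \<le> U (sz e)"
  shows "PT (\<lambda>e. fold (\<lambda>x acc. g x acc e) (l e) (a e))"
proof -
  let ?D = "{s :: ('x list \<times> 'a) \<times> 'e. enc (fst (fst s)) \<noteq> Lf}"
  let ?f = "\<lambda>s :: ('x list \<times> 'a) \<times> 'e. ((tl (fst (fst s)), g (hd (fst (fst s))) (snd (fst s)) (snd s)), snd s)"
  let ?st = "\<lambda>s. if fst (fst s) \<noteq> [] then ?f s else s"
  have ff: "PT (\<lambda>s :: ('x list \<times> 'a) \<times> 'e. fst (fst s))" by (intro PT_fst PT_id)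
  have hd: "PT_on ?D (\<lambda>s. hd (fst (fst s)))"
    by (rule PT_on_comp[OF PT_on_hd PT_on_subset[OF ff]]) auto
  have tl: "PT_on ?D (\<lambda>s. tl (fst (fst s)))"
    by (rule PT_on_comp[OF PT_on_tl PT_on_subset[OF ff]]) auto
  have arg: "PT_on ?D (\<lambda>s. (hd (fst (fst s)), snd (fst s), snd s))"
    by (rule PT_on_node[OF hd PT_on_subset[of UNIV "\<lambda>s. (snd (fst s), snd s)"]])
       (auto intro!: PT_Pair PT_fst PT_snd PT_id)
  have gg: "PT_on ?D (\<lambda>s. g (hd (fst (fst s))) (snd (fst s)) (snd s))"
    using PT_on_comp[OF g arg] by simp
  have sd: "PT (\<lambda>s :: ('x list \<times> 'a) \<times> 'e. snd s)" by (intro PT_snd PT_id)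
  have "PT_on ?D (\<lambda>s. (tl (fst (fst s)), g (hd (fst (fst s))) (snd (fst s)) (snd s)))"
    by (rule PT_on_node[OF tl gg]) auto
  then have f: "PT_on ?D ?f"
    by (rule PT_on_node[OF _ PT_on_subset[OF sd]]) auto
  have st: "PT ?st"
    by (rule PT_cong[OF PT_on_if_enc[of UNIV "\<lambda>s. fst (fst s)" ?f "\<lambda>s. s"]])
       (use f ff PT_on_id in auto)
  obtain T where T: "poly T" "\<And>e. sz (l e) \<le> T (sz e)" using PT_size_poly[OF l] by blast
  have na: "PT (\<lambda>e. (l e, (l e, a e), e))" by (intro PT_Pair l a PT_id)
  have "PT (\<lambda>e. (?st ^^ sz (l e)) ((l e, a e), e))"
  proof (rule PT_funpow_pair[OF st na, where U = "\<lambda>s. 2 + T s + U s + s"])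
    show "poly (\<lambda>s. 2 + T s + U s + s)" by (intro poly_intros T U)
    fix e i
    have "sz ((?st ^^ i) ((l e, a e), e)) =
        2 + sz (drop i (l e)) + sz (fold (\<lambda>x acc. g x acc e) (take i (l e)) (a e)) + sz e"
      unfolding funpow_fold_step by simp
    also have "\<dots> \<le> 2 + T (sz e) + U (sz e) + sz e"
      using sz_drop[of i "l e"] T(2)[of e] U(2)[of e i] by linarith
    finally show "sz ((?st ^^ i) ((l e, a e), e)) \<le> 2 + T (sz e) + U (sz e) + sz e" .
  qed simp
  then have "PT (\<lambda>e. snd (fst ((?st ^^ sz (l e)) ((l e, a e), e))))" by (intro PT_snd PT_fst)
  then show ?thesis
    unfolding funpow_fold_step by (simp add: take_all length_le_sz)
qed

text \<open>The increment of the size may depend on the element and the parameter but not on the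
  accumulator, so growth adds up over the list instead of compounding.\<close>

lemma PT_fold_additive:
  fixes g :: "'x::enc \<Rightarrow> 'a::enc \<Rightarrow> 'e::enc \<Rightarrow> 'a"
  assumes g: "PT (\<lambda>p. g (fst p) (fst (snd p)) (snd (snd p)))" and l: "PT l" and a: "PT a"
    and k: "\<And>x acc e. sz (g x acc e) \<le> sz acc + (sz x + sz e + 2) ^ k"
  shows "PT (\<lambda>e. fold (\<lambda>x acc. g x acc e) (l e) (a e))"
proof -
  obtain T where T: "poly T" "\<And>e. sz (l e) \<le> T (sz e)" using PT_size_poly[OF l] by blast
  obtain A where A: "poly A" "\<And>e. sz (a e) \<le> A (sz e)" using PT_size_poly[OF a] by blast
  have *: "sz (fold (\<lambda>x acc. g x acc e) ys b) \<le> sz b + length ys * (B + sz e + 2) ^ k"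
    if "\<And>y. y \<in> set ys \<Longrightarrow> sz y \<le> B" for ys b e B
    using that
  proof (induction ys arbitrary: b)
    case (Cons y ys)
    have "sz (fold (\<lambda>x acc. g x acc e) (y # ys) b) \<le> sz (g y b e) + length ys * (B + sz e + 2) ^ k"
      using Cons by simp
    also have "sz (g y b e) \<le> sz b + (sz y + sz e + 2) ^ k" by (rule k)
    also have "(sz y + sz e + 2) ^ k \<le> (B + sz e + 2) ^ k"
      using Cons.prems by (intro power_mono) auto
    finally show ?case by simp
  qed simp
  show ?thesis
  proof (rule PT_fold[OF g l a, where U = "\<lambda>s. A s + T s * (T s + s + 2) ^ k"])
    show "poly (\<lambda>s. A s + T s * (T s + s + 2) ^ k)" by (intro poly_intros A T)
    fix e i
    have "sz y \<le> T (sz e)" if "y \<in> set (take i (l e))" for y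
      using sz_elem[of y "l e"] T(2)[of e] in_set_takeD[OF that] by simp
    then have "sz (fold (\<lambda>x acc. g x acc e) (take i (l e)) (a e))
        \<le> sz (a e) + length (take i (l e)) * (T (sz e) + sz e + 2) ^ k" by (rule *)
    also have "\<dots> \<le> A (sz e) + T (sz e) * (T (sz e) + sz e + 2) ^ k"
    proof (intro add_mono mult_le_mono1 A)
      show "length (take i (l e)) \<le> T (sz e)" using length_le_sz[of "l e"] T(2)[of e] by simp
    qed
    finally show "sz (fold (\<lambda>x acc. g x acc e) (take i (l e)) (a e))
        \<le> A (sz e) + T (sz e) * (T (sz e) + sz e + 2) ^ k" .
  qed
qed

section \<open>List functions obtained as folds\<close>

lemma PT_rev:
  assumes "PT f" shows "PT (\<lambda>e. rev (f e))"
proof -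
  have 1: "PT (\<lambda>p :: 'b \<times> 'b list \<times> 'a. fst p # fst (snd p))"
    by (intro PT_Cons PT_fst PT_snd PT_id)
  have "PT (\<lambda>e. fold (\<lambda>x acc. x # acc) (f e) [])"
    by (rule PT_fold_additive[where k = 1, OF 1 assms PT_const]) simp
  then show ?thesis by (simp add: fold_Cons_rev)
qed

lemma PT_append:
  assumes "PT f" "PT g" shows "PT (\<lambda>e. f e @ g e)"
proof -
  have 1: "PT (\<lambda>p :: 'b \<times> 'b list \<times> 'a. fst p # fst (snd p))"
    by (intro PT_Cons PT_fst PT_snd PT_id)
  have "PT (\<lambda>e. fold (\<lambda>x acc. x # acc) (rev (f e)) (g e))"
    by (rule PT_fold_additive[where k = 1, OF 1 PT_rev[OF assms(1)] assms(2)]) simp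
  then show ?thesis by (simp add: fold_Cons_rev)
qed

lemma PT_map:
  assumes "PT (\<lambda>p. h (fst p) (snd p))" "PT l"
  shows "PT (\<lambda>e. map (\<lambda>x. h x e) (l e))"
proof -
  let ?h = "\<lambda>p. h (fst p) (snd p)"
  obtain k where k: "\<And>x e. sz (h x e) \<le> (sz (x, e) + 2) ^ k"
    using PT_size[OF assms(1)] by (metis fst_conv snd_conv)
  have 1: "PT (\<lambda>p :: 'a \<times> 'c list \<times> 'b. h (fst p) (snd (snd p)) # fst (snd p))"
    by (rule PT_Cons[OF PT_comp[OF assms(1), of "\<lambda>p. (fst p, snd (snd p))", simplified]])
       (intro PT_Pair PT_fst PT_snd PT_id)+
  have "1 + sz (h x e) \<le> (sz x + sz e + 2) ^ (2 * k + 1)" for x e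
  proof -
    have "sz (x, e) + 2 = sz x + sz e + 3" by simp
    then have "1 + (sz (x, e) + 2) ^ k \<le> 2 * (sz x + sz e + 3) ^ k"
      using one_le_power[of "sz x + sz e + 3" k] by (simp only:) linarith
    also have "(sz x + sz e + 3) ^ k \<le> ((sz x + sz e + 2) ^ 2) ^ k"
      by (rule power_mono) (auto simp: power2_eq_square)
    also have "2 * ((sz x + sz e + 2) ^ 2) ^ k \<le> (sz x + sz e + 2) * ((sz x + sz e + 2) ^ 2) ^ k"
      by (rule mult_le_mono1) simp
    also have "\<dots> = (sz x + sz e + 2) ^ (2 * k + 1)" by (simp add: power_mult)
    finally show ?thesis using k[of x e] by simp
  qed
  then have "PT (\<lambda>e. fold (\<lambda>x acc. h x e # acc) (l e) [])"
    by (intro PT_fold_additive[where k = "2 * k + 1", OF 1 assms(2) PT_const]) simp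
  then have "PT (\<lambda>e. rev (fold (\<lambda>x acc. h x e # acc) (l e) []))" by (rule PT_rev)
  moreover have "fold (\<lambda>x acc. h x e # acc) xs ys = rev (map (\<lambda>x. h x e) xs) @ ys" for e xs ys
    by (induction xs arbitrary: ys) auto
  ultimately show ?thesis by simp
qed

lemma PT_concat:
  assumes "PT l" shows "PT (\<lambda>e. concat (l e))"
proof -
  have 1: "PT (\<lambda>p :: 'b list \<times> 'b list \<times> 'a. fst (snd p) @ fst p)"
    by (intro PT_append PT_fst PT_snd PT_id)
  have 2: "sz (acc @ x) \<le> sz acc + (sz x + sz e + 2) ^ 1" for x acc :: "'b list" and e :: 'a
    using sz_append[of acc x] by simp
  have "PT (\<lambda>e. fold (\<lambda>x acc. acc @ x) (l e) [])"
    by (rule PT_fold_additive[OF 1 assms PT_const 2])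
  moreover have "fold (\<lambda>x acc. acc @ x) xs ys = ys @ concat xs" for xs and ys :: "'b list"
    by (induction xs arbitrary: ys) auto
  ultimately show ?thesis by simp
qed

lemma PT_filter:
  assumes "PT (\<lambda>p. h (fst p) (snd p))" "PT l"
  shows "PT (\<lambda>e. filter (\<lambda>x. h x e) (l e))"
proof -
  have *: "concat (map (\<lambda>x. if h x e then [x] else []) xs) = filter (\<lambda>x. h x e) xs" for e xs
    by (induction xs) auto
  show ?thesis
    by (rule PT_cong[OF PT_concat[OF PT_map[where h = "\<lambda>x e. if h x e then [x] else []", OF _ assms(2)]]])
       (intro PT_if assms PT_Cons PT_fst PT_id PT_const, rule *)
qed

lemma PT_bex:
  assumes "PT (\<lambda>p. h (fst p) (snd p))" "PT l"
  shows "PT (\<lambda>e. \<exists>x\<in>set (l e). h x e)"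
  by (rule PT_cong[OF PT_not[OF PT_null[OF PT_filter[OF assms]]]]) (auto simp: filter_empty_conv)

lemma PT_ball:
  assumes "PT (\<lambda>p. h (fst p) (snd p))" "PT l"
  shows "PT (\<lambda>e. \<forall>x\<in>set (l e). h x e)"
  by (rule PT_cong[OF PT_null[OF PT_filter[OF PT_not[OF assms(1)] assms(2)]]])
     (auto simp: filter_empty_conv)

subsection \<open>Binary arithmetic\<close>

lemma PT_on_pos_parts: "PT_on {n :: nat. n \<noteq> 0} odd" "PT_on {n :: nat. n \<noteq> 0} (\<lambda>n. n div 2)"
proof -
  \<comment> \<open>\<open>bit_tree (odd n)\<close> is literally the code of this pair.\<close>
  have "PT_on {n :: nat. n \<noteq> 0} (\<lambda>n. (odd n, even n))"
    by (rule PT_on_left) (auto simp: enc_nat_pos bit_tree_def)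
  from PT_on_comp[OF PT_fst[OF PT_id] this] show "PT_on {n :: nat. n \<noteq> 0} odd" by simp
  show "PT_on {n :: nat. n \<noteq> 0} (\<lambda>n. n div 2)"
    by (rule PT_on_right) (auto simp: enc_nat_pos)
qed

lemma PT_odd:
  assumes "PT f" shows "PT (\<lambda>e. odd (f e :: nat))"
proof -
  have "PT (\<lambda>n :: nat. if enc n \<noteq> Lf then odd n else False)"
    by (rule PT_on_if_enc) (simp_all add: PT_id PT_on_const PT_on_pos_parts[simplified])
  then have "PT (odd :: nat \<Rightarrow> bool)" by (rule PT_cong) auto
  from PT_comp[OF this assms] show ?thesis .
qed

lemma PT_div2:
  assumes "PT f" shows "PT (\<lambda>e. (f e :: nat) div 2)"
proof -
  have "PT (\<lambda>n :: nat. if enc n \<noteq> Lf then n div 2 else 0)"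
    by (rule PT_on_if_enc) (simp_all add: PT_id PT_on_const PT_on_pos_parts[simplified])
  then have "PT (\<lambda>n :: nat. n div 2)" by (rule PT_cong) auto
  from PT_comp[OF this assms] show ?thesis .
qed

text \<open>Prepending a bit to the code is correct unless both the number and the bit vanish: that
  would create a leading zero, while the code of 0 is a leaf.\<close>

lemma PT_bit_shift:
  assumes "PT f" "PT g"
  shows "PT (\<lambda>e. 2 * (f e :: nat) + of_bool (g e))"
proof -
  let ?D = "{p :: nat \<times> bool. fst p \<noteq> 0 \<or> snd p}"
  let ?h = "\<lambda>p :: nat \<times> bool. 2 * fst p + of_bool (snd p)"
  have "PT_on ?D ?h"
  proof (rule PT_on_node)
    show "PT_on ?D (\<lambda>p. (snd p, \<not> snd p))"
      by (rule PT_on_subset[of UNIV]) (auto intro!: PT_Pair PT_not PT_snd PT_id)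
    show "PT_on ?D (\<lambda>p. fst p)"
      by (rule PT_on_subset[of UNIV]) (auto intro!: PT_fst PT_id)
    show "enc (?h p) = Nd (enc (snd p, \<not> snd p)) (enc (fst p))" if "p \<in> ?D" for p
      using that by (subst enc_nat_pos) (auto simp: bit_tree_def)
  qed
  then have "PT_on {p \<in> UNIV. enc (fst p \<noteq> (0::nat) \<or> snd p) \<noteq> Lf} ?h" by simp
  moreover have "PT (\<lambda>p :: nat \<times> bool. fst p \<noteq> 0 \<or> snd p)"
    by (intro PT_disj PT_not PT_eq_0 PT_fst PT_snd PT_id)
  ultimately have "PT (\<lambda>p. if enc (fst p \<noteq> (0::nat) \<or> snd p) \<noteq> Lf then ?h p else 0)"
    by (intro PT_on_if_enc PT_on_const)
  then have "PT ?h" by (rule PT_cong) auto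
  from PT_comp[OF this PT_Pair[OF assms]] show ?thesis by simp
qed

text \<open>The most significant bit comes first. This is how the step functions below leave their
  output, since they start at the least significant bit and cons.\<close>

definition bits_value :: "bool list \<Rightarrow> nat" where
  "bits_value bs = fold (\<lambda>b n. 2 * n + of_bool b) bs 0"

lemma bits_value_fold: "fold (\<lambda>b n. 2 * n + of_bool b) bs n = n * 2 ^ length bs + bits_value bs"
proof (induction bs arbitrary: n)
  case (Cons b bs)
  have "bits_value (b # bs) = of_bool b * 2 ^ length bs + bits_value bs"
    using Cons[of "of_bool b"] by (simp add: bits_value_def)
  then show ?case using Cons[of "2 * n + of_bool b"] by (simp add: algebra_simps)
qed (simp add: bits_value_def)

lemma bits_value_Cons: "bits_value (b # bs) = of_bool b * 2 ^ length bs + bits_value bs"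
  using bits_value_fold[of bs "of_bool b"] by (simp add: bits_value_def)

lemma PT_bits_value:
  assumes "PT f" shows "PT (\<lambda>e. bits_value (f e))"
proof -
  have 1: "PT (\<lambda>p :: bool \<times> nat \<times> 'a. 2 * fst (snd p) + of_bool (fst p))"
    by (intro PT_bit_shift PT_fst PT_snd PT_id)
  have 2: "sz (2 * n + of_bool b) \<le> sz n + (sz b + sz e + 2) ^ 3" for b and n :: nat and e :: 'a
  proof -
    \<comment> \<open>A further bit costs six symbols.\<close>
    have "6 \<le> (2::nat) ^ 3" by simp
    also have "\<dots> \<le> (sz b + sz e + 2) ^ 3" by (rule power_mono) auto
    finally show ?thesis using bitlen_double[of n b] unfolding sz_nat by linarith
  qed
  show ?thesis unfolding bits_value_def
    by (rule PT_fold_additive[OF 1 assms PT_const 2])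
qed

lemma sz_bool_list: "sz (bs :: bool list) \<le> length bs * 4 + 1"
  using sz_list_le[of bs 3] sz_bool by simp

lemma bitlen_le_sz: "bitlen n \<le> sz n"
  by (simp add: sz_nat)

lemma div_power_Suc: "a div 2 ^ Suc i = a div 2 ^ i div 2" for a :: nat
  by (simp only: power_Suc2 div_mult2_eq)

lemma sz_div: "sz (n div m :: nat) \<le> sz n"
  using bitlen_mono[of "n div m" n] by (simp add: sz_nat)

lemma div_power_sz:
  assumes "sz (n :: nat) \<le> i" shows "n div 2 ^ i = 0"
  using assms bitlen_le_sz[of n] bitlen_le_iff[of n i] by simp

text \<open>A full adder: the new carry is the majority of the two bits and the old carry, the
  output bit their parity, both written with connectives whose closure is known.\<close>

definition add_step :: "((nat \<times> nat) \<times> bool) \<times> bool list \<Rightarrow> ((nat \<times> nat) \<times> bool) \<times> bool list" where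
  "add_step s = (let a = fst (fst (fst s)); b = snd (fst (fst s)); c = snd (fst s) in
     (((a div 2, b div 2), (odd a \<and> odd b) \<or> (c \<and> (odd a \<or> odd b))),
      ((odd a \<and> odd b \<and> c) \<or> (odd a \<and> \<not> odd b \<and> \<not> c) \<or> (\<not> odd a \<and> odd b \<and> \<not> c) \<or>
        (\<not> odd a \<and> \<not> odd b \<and> c)) # snd s))"

lemma add_step_invariant:
  "\<exists>c out. (add_step ^^ i) (((a, b), False), []) = (((a div 2 ^ i, b div 2 ^ i), c), out) \<and>
     length out = i \<and> a + b = bits_value out + 2 ^ i * (a div 2 ^ i + b div 2 ^ i + of_bool c)"
proof (induction i)
  case 0
  show ?case by (auto simp: bits_value_def intro!: exI[of _ False])
next
  case (Suc i)
  then obtain c out where IH: "(add_step ^^ i) (((a, b), False), []) = (((a div 2 ^ i, b div 2 ^ i), c), out)"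
    "length out = i" "a + b = bits_value out + 2 ^ i * (a div 2 ^ i + b div 2 ^ i + of_bool c)" by blast
  define x y where "x = a div 2 ^ i" and "y = b div 2 ^ i"
  define c' where "c' = ((odd x \<and> odd y) \<or> (c \<and> (odd x \<or> odd y)))"
  define z where "z = ((odd x \<and> odd y \<and> c) \<or> (odd x \<and> \<not> odd y \<and> \<not> c) \<or> (\<not> odd x \<and> odd y \<and> \<not> c) \<or>
        (\<not> odd x \<and> \<not> odd y \<and> c))"
  have xy: "a div 2 ^ Suc i = x div 2" "b div 2 ^ Suc i = y div 2"
    by (simp_all only: x_def y_def div_power_Suc)
  have st: "(add_step ^^ Suc i) (((a, b), False), []) = (((x div 2, y div 2), c'), z # out)"
    using IH(1) by (simp add: add_step_def Let_def c'_def z_def x_def y_def)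
  have "of_bool (odd x) + of_bool (odd y) + of_bool c = of_bool z + 2 * (of_bool c' :: nat)"
    unfolding z_def c'_def by (cases c; cases "odd x"; cases "odd y"; simp)
  moreover have "x = 2 * (x div 2) + of_bool (odd x)" "y = 2 * (y div 2) + of_bool (odd y)"
    by simp_all
  ultimately have "x + y + of_bool c = of_bool z + (2 * (x div 2) + 2 * (y div 2) + 2 * of_bool c')"
    by linarith
  then have "x + y + of_bool c = of_bool z + 2 * (x div 2 + y div 2 + of_bool c')"
    by (simp only: distrib_left)
  then have "a + b = bits_value (z # out) + 2 ^ Suc i * (x div 2 + y div 2 + of_bool c')"
    using IH(2,3) unfolding x_def[symmetric] y_def[symmetric]
    by (simp add: bits_value_Cons algebra_simps)
  then show ?case unfolding xy using st IH(2) by (intro exI[of _ c'] exI[of _ "z # out"]) simp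
qed

lemma PT_add:
  assumes "PT f" "PT g"
  shows "PT (\<lambda>e. (f e :: nat) + g e)"
proof -
  let ?N = "\<lambda>p :: nat \<times> nat. p" and ?A = "\<lambda>p :: nat \<times> nat. ((p, False), [] :: bool list)"
  have st: "PT add_step"
    unfolding add_step_def Let_def
    by (intro PT_Pair PT_Cons PT_conj PT_disj PT_not PT_odd PT_div2 PT_fst PT_snd PT_id)
  have na: "PT (\<lambda>p. (?N p, ?A p))" by (intro PT_Pair PT_id PT_const)
  have "PT (\<lambda>p. (add_step ^^ sz (?N p)) (?A p))"
  proof (rule PT_funpow_pair[OF st na, where U = "\<lambda>s. 8 + s + 4 * s"])
    show "poly (\<lambda>s. 8 + s + 4 * s)" by (intro poly_intros)
    fix p :: "nat \<times> nat" and i assume i: "i \<le> sz p"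
    obtain a b where p: "p = (a, b)" by (cases p)
    obtain c out where co: "(add_step ^^ i) (((a, b), False), []) = (((a div 2 ^ i, b div 2 ^ i), c), out)"
      "length out = i" using add_step_invariant by blast
    have "sz out \<le> 4 * sz p + 1" using sz_bool_list[of out] co(2) i by simp
    moreover have "1 + sz (a div 2 ^ i) + sz (b div 2 ^ i) \<le> sz p"
      using sz_div[of a "2 ^ i"] sz_div[of b "2 ^ i"] by (simp add: p)
    ultimately show "sz ((add_step ^^ i) ((p, False), [])) \<le> 8 + sz p + 4 * sz p"
      using sz_bool[of c] by (simp add: p co)
  qed simp
  from PT_bits_value[OF PT_snd[OF this]]
  have "PT (\<lambda>p :: nat \<times> nat. bits_value (snd ((add_step ^^ sz p) ((p, False), []))))" .
  then have "PT (\<lambda>p :: nat \<times> nat. fst p + snd p)"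
  proof (rule PT_cong)
    fix p :: "nat \<times> nat"
    obtain a b where p: "p = (a, b)" by (cases p)
    have d: "a div 2 ^ sz p = 0" "b div 2 ^ sz p = 0" by (rule div_power_sz; simp add: p)+
    obtain c out where co: "(add_step ^^ sz p) (((a, b), False), []) = (((0, 0), c), out)"
      "a + b = bits_value out + 2 ^ sz p * of_bool c"
      using add_step_invariant[of "sz p" a b] unfolding d by auto
    \<comment> \<open>After \<open>sz p\<close> rounds the operands are used up, and a remaining
      carry would be worth \<open>2 ^ sz p\<close>, more than the sum.\<close>
    have "bitlen (a + b) \<le> sz p" using bitlen_add[of a b] by (simp add: p sz_nat)
    then have "a + b < 2 ^ sz p" by (simp add: bitlen_le_iff)
    then have "\<not> c" using co(2) by auto
    then show "bits_value (snd ((add_step ^^ sz p) ((p, False), []))) = fst p + snd p"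
      using co by (simp add: p)
  qed
  from PT_comp[OF this PT_Pair[OF assms]] show ?thesis by simp
qed

definition bits_step :: "nat \<times> bool list \<Rightarrow> nat \<times> bool list" where
  "bits_step s = (fst s div 2, odd (fst s) # snd s)"

lemma bits_step_invariant:
  "\<exists>out. (bits_step ^^ i) (a, []) = (a div 2 ^ i, out) \<and>
     length out = i \<and> a = bits_value out + 2 ^ i * (a div 2 ^ i)"
proof (induction i)
  case 0
  show ?case by (simp add: bits_value_def)
next
  case (Suc i)
  then obtain out where IH: "(bits_step ^^ i) (a, []) = (a div 2 ^ i, out)"
    "length out = i" "a = bits_value out + 2 ^ i * (a div 2 ^ i)" by blast
  define x where "x = a div 2 ^ i"
  have x: "a div 2 ^ Suc i = x div 2"
    by (simp only: x_def div_power_Suc)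
  have "x = 2 * (x div 2) + of_bool (odd x)" by simp
  then have "a = bits_value out + 2 ^ i * (2 * (x div 2) + of_bool (odd x))"
    using IH(3) unfolding x_def[symmetric] by presburger
  then have "a = bits_value (odd x # out) + 2 ^ Suc i * (x div 2)"
    unfolding bits_value_Cons IH(2) by (simp add: algebra_simps)
  moreover have "(bits_step ^^ Suc i) (a, []) = (x div 2, odd x # out)"
    using IH(1) by (simp add: bits_step_def x_def)
  ultimately show ?case unfolding x using IH(2) by (intro exI[of _ "odd x # out"]) simp
qed

text \<open>Horner's scheme over the bits of \<open>f e\<close>. Doubling adds one bit and adding
  \<open>g e\<close> at most the bits of \<open>g e\<close>, so the size grows additively although
  the value doubles.\<close>

lemma PT_mult:
  assumes "PT f" "PT g"
  shows "PT (\<lambda>e. (f e :: nat) * g e)"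
proof -
  have st: "PT bits_step"
    unfolding bits_step_def by (intro PT_Pair PT_Cons PT_odd PT_div2 PT_fst PT_snd PT_id)
  have na: "PT (\<lambda>n :: nat. (n, n, [] :: bool list))" by (intro PT_Pair PT_id PT_const)
  have "PT (\<lambda>n. (bits_step ^^ sz n) (n, []))"
  proof (rule PT_funpow_pair[OF st na, where U = "\<lambda>s. 2 + s + 4 * s"])
    show "poly (\<lambda>s. 2 + s + 4 * s)" by (intro poly_intros)
    fix n i :: nat assume i: "i \<le> sz n"
    obtain out where co: "(bits_step ^^ i) (n, []) = (n div 2 ^ i, out)" "length out = i"
      using bits_step_invariant by blast
    show "sz ((bits_step ^^ i) (n, [])) \<le> 2 + sz n + 4 * sz n"
      using sz_bool_list[of out] sz_div[of n "2 ^ i"] i by (simp add: co)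
  qed simp
  then have bl: "PT (\<lambda>e. snd ((bits_step ^^ sz (f e)) (f e, [])))"
    using PT_comp[OF _ assms(1)] PT_snd by blast
  let ?h = "\<lambda>b acc m. acc + acc + (if b then m else 0) :: nat"
  have 1: "PT (\<lambda>p :: bool \<times> nat \<times> 'a. fst (snd p) + fst (snd p) + (if fst p then g (snd (snd p)) else 0))"
    by (intro PT_add PT_if PT_comp[OF assms(2)] PT_fst PT_snd PT_id PT_const)
  obtain k where k: "\<And>e. sz (g e) \<le> (sz e + 2) ^ k" using PT_size[OF assms(2)] by blast
  have 2: "sz (?h b n (g e)) \<le> sz n + (sz b + sz e + 2) ^ (k + 3)" for b n and e :: 'a
  proof -
    have "bitlen (?h b n (g e)) \<le> bitlen (n + n) + bitlen (g e)"
      using bitlen_add[of "n + n" "g e"] by simp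
    also have "bitlen (n + n) \<le> Suc (bitlen n)" using bitlen_double[of n False] by (simp add: mult_2)
    finally have "sz (?h b n (g e)) \<le> sz n + (6 + sz (g e))" by (simp add: sz_nat)
    also have "6 + sz (g e) \<le> 6 + (sz e + 2) ^ k" using k by simp
    also have "\<dots> \<le> 8 * (sz e + 2) ^ k"
      using one_le_power[of "sz e + 2" k] by linarith
    also have "\<dots> = 2 ^ 3 * (sz e + 2) ^ k" by simp
    also have "\<dots> \<le> (sz b + sz e + 2) ^ 3 * (sz b + sz e + 2) ^ k"
      by (intro mult_le_mono power_mono) auto
    also have "\<dots> = (sz b + sz e + 2) ^ (k + 3)" by (simp add: power_add mult.commute)
    finally show ?thesis by simp
  qed
  have "PT (\<lambda>e. fold (\<lambda>b acc. ?h b acc (g e)) (snd ((bits_step ^^ sz (f e)) (f e, []))) 0)"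
    by (rule PT_fold_additive[OF 1 bl PT_const 2])
  then show ?thesis
  proof (rule PT_cong)
    fix e
    have *: "fold (\<lambda>b acc. ?h b acc m) bs n = n * 2 ^ length bs + bits_value bs * m" for bs n m
      by (induction bs arbitrary: n) (auto simp: bits_value_Cons algebra_simps, simp add: bits_value_def)
    obtain out where "(bits_step ^^ sz (f e)) (f e, []) = (0, out)" "f e = bits_value out"
      using bits_step_invariant[of "sz (f e)" "f e"] div_power_sz[of "f e", OF order.refl] by auto
    then show "fold (\<lambda>b acc. ?h b acc (g e)) (snd ((bits_step ^^ sz (f e)) (f e, []))) 0 = f e * g e"
      by (simp add: *)
  qed
qed

text \<open>Bits are compared from the least significant one on, so a later difference overrides the
  verdict reached so far; where the bits differ, the number with the larger bit wins.\<close>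

definition le_step :: "(nat \<times> nat) \<times> bool \<Rightarrow> (nat \<times> nat) \<times> bool" where
  "le_step s = (let a = fst (fst s); b = snd (fst s) in
     ((a div 2, b div 2), if odd a \<and> odd b \<or> \<not> odd a \<and> \<not> odd b then snd s else odd b))"

lemma le_step_invariant:
  "(le_step ^^ i) ((a, b), True) = ((a div 2 ^ i, b div 2 ^ i), a mod 2 ^ i \<le> b mod 2 ^ i)"
proof (induction i)
  case (Suc i)
  define x y where "x = a div 2 ^ i" and "y = b div 2 ^ i"
  have xy: "a div 2 ^ Suc i = x div 2" "b div 2 ^ Suc i = y div 2"
    by (simp_all only: x_def y_def div_power_Suc)
  have m: "a mod 2 ^ Suc i = 2 ^ i * of_bool (odd x) + a mod 2 ^ i"
    "b mod 2 ^ Suc i = 2 ^ i * of_bool (odd y) + b mod 2 ^ i"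
    using mod_mult2_eq[of a "2 ^ i" 2] mod_mult2_eq[of b "2 ^ i" 2]
    by (simp_all add: x_def y_def mult.commute mod_2_eq_odd)
  have lt: "a mod 2 ^ i < 2 ^ i" "b mod 2 ^ i < 2 ^ i" by simp_all
  have "(le_step ^^ Suc i) ((a, b), True) = le_step ((x, y), a mod 2 ^ i \<le> b mod 2 ^ i)"
    using Suc by (simp add: x_def y_def)
  also have "\<dots> = ((x div 2, y div 2), a mod 2 ^ Suc i \<le> b mod 2 ^ Suc i)"
    unfolding m using lt by (auto simp: le_step_def Let_def simp del: mod_less_divisor)
  finally show ?case by (simp only: xy)
qed simp

lemma PT_le:
  assumes "PT f" "PT g"
  shows "PT (\<lambda>e. (f e :: nat) \<le> g e)"
proof -
  have st: "PT le_step"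
    unfolding le_step_def Let_def
    by (intro PT_if PT_Pair PT_conj PT_disj PT_not PT_odd PT_div2 PT_fst PT_snd PT_id)
  have na: "PT (\<lambda>p :: nat \<times> nat. (p, p, True))" by (intro PT_Pair PT_id PT_const)
  have "PT (\<lambda>p. (le_step ^^ sz p) (p, True))"
  proof (rule PT_funpow_pair[OF st na, where U = "\<lambda>s. 4 + s"])
    show "poly (\<lambda>s. 4 + s)" by (intro poly_intros)
    fix p :: "nat \<times> nat" and i
    obtain a b where p: "p = (a, b)" by (cases p)
    show "sz ((le_step ^^ i) (p, True)) \<le> 4 + sz p"
      using sz_div[of a "2 ^ i"] sz_div[of b "2 ^ i"] sz_bool[of "a mod 2 ^ i \<le> b mod 2 ^ i"]
      by (simp add: p le_step_invariant)
  qed simp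
  from PT_snd[OF this] have "PT (\<lambda>p :: nat \<times> nat. fst p \<le> snd p)"
  proof (rule PT_cong)
    fix p :: "nat \<times> nat"
    obtain a b where p: "p = (a, b)" by (cases p)
    have "bitlen a \<le> sz p" "bitlen b \<le> sz p" by (simp_all add: p sz_nat)
    then have "a mod 2 ^ sz p = a" "b mod 2 ^ sz p = b"
      unfolding bitlen_le_iff by simp_all
    then show "snd ((le_step ^^ sz p) (p, True)) = (fst p \<le> snd p)"
      using le_step_invariant[of "sz p" a b] unfolding p fst_conv snd_conv by simp
  qed
  from PT_comp[OF this PT_Pair[OF assms]] show ?thesis by simp
qed

lemma PT_less: "PT f \<Longrightarrow> PT g \<Longrightarrow> PT (\<lambda>e. (f e :: nat) < g e)"
  by (rule PT_cong[OF PT_not[OF PT_le[of g f]]]) auto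

lemma PT_eq: "PT f \<Longrightarrow> PT g \<Longrightarrow> PT (\<lambda>e. (f e :: nat) = g e)"
  by (rule PT_cong[OF PT_conj[OF PT_le[of f g] PT_le[of g f]]]) auto

section \<open>Sums, products and indexing of lists\<close>

lemma PT_sum_list:
  assumes "PT f" shows "PT (\<lambda>e. sum_list (f e :: nat list))"
proof -
  have 1: "PT (\<lambda>p :: nat \<times> nat \<times> 'a. fst (snd p) + fst p)"
    by (intro PT_add PT_fst PT_snd PT_id)
  have 2: "sz (n + x) \<le> sz n + (sz x + sz e + 2) ^ 1" for n x :: nat and e :: 'a
    using bitlen_add[of n x] by (simp add: sz_nat)
  have "PT (\<lambda>e. fold (\<lambda>x n. n + x) (f e) 0)"
    by (rule PT_fold_additive[OF 1 assms PT_const 2])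
  moreover have "fold (\<lambda>x n. n + x) xs n = n + sum_list xs" for n :: nat and xs
    by (induction xs arbitrary: n) auto
  ultimately show ?thesis by simp
qed

lemma PT_length: "PT f \<Longrightarrow> PT (\<lambda>e. length (f e))"
  by (rule PT_cong[OF PT_sum_list[OF PT_map[where h = "\<lambda>_ _. 1"]]]) (auto intro: PT_const simp: sum_list_triv)

lemma PT_prod_list:
  assumes "PT f" shows "PT (\<lambda>e. prod_list (f e :: nat list))"
proof -
  have 1: "PT (\<lambda>p :: nat \<times> nat \<times> 'a. fst (snd p) * fst p)"
    by (intro PT_mult PT_fst PT_snd PT_id)
  have 2: "sz (n * x) \<le> sz n + (sz x + sz e + 2) ^ 1" for n x :: nat and e :: 'a
    using bitlen_mult[of n x] by (simp add: sz_nat)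
  have "PT (\<lambda>e. fold (\<lambda>x n. n * x) (f e) 1)"
    by (rule PT_fold_additive[OF 1 assms PT_const 2])
  moreover have "fold (\<lambda>x n. n * x) xs n = n * prod_list xs" for n :: nat and xs
    by (induction xs arbitrary: n) auto
  ultimately show ?thesis by simp
qed

text \<open>The default makes indexing total, so that the algorithm is defined on arbitrary lists
  and not only on encoded instances.\<close>

definition nth0 :: "nat list \<Rightarrow> nat \<Rightarrow> nat" where
  "nth0 xs i = (if i < length xs then xs ! i else 0)"

lemma PT_nth0:
  assumes "PT f" "PT g" shows "PT (\<lambda>e. nth0 (f e) (g e))"
proof -
  let ?h = "\<lambda>x s i. (fst s + 1, if fst s = i then x else snd s) :: nat \<times> nat"
  have 1: "PT (\<lambda>p :: nat \<times> (nat \<times> nat) \<times> 'a. ?h (fst p) (fst (snd p)) (g (snd (snd p))))"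
    by (intro PT_Pair PT_if PT_eq PT_add PT_comp[OF assms(2)] PT_fst PT_snd PT_id PT_const)
  have 2: "sz (?h x s (g e)) \<le> sz s + (sz x + sz e + 2) ^ 3" for x s and e :: 'a
  proof -
    have "sz (?h x s (g e)) \<le> sz s + (6 + sz x)"
    proof -
      have "sz (if fst s = g e then x else snd s) \<le> sz x + sz (snd s)" by simp
      moreover have "sz (fst s + 1) \<le> sz (fst s) + 6" using bitlen_Suc[of "fst s"] by (simp add: sz_nat)
      ultimately show ?thesis by (simp only: sz_pair sz_prod[of s])
    qed
    also have "6 + sz x \<le> (sz x + sz e + 2) ^ 3"
    proof -
      have "6 + sz x \<le> 4 * (sz x + sz e + 2)" by simp
      also have "\<dots> \<le> (sz x + sz e + 2) ^ 2 * (sz x + sz e + 2)"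
        by (rule mult_le_mono1) (simp add: power2_eq_square)
      finally show ?thesis by (simp add: power3_eq_cube power2_eq_square)
    qed
    finally show ?thesis by simp
  qed
  have *: "snd (fold (\<lambda>x s. ?h x s i) xs (j, r)) =
      (if j \<le> i \<and> i < j + length xs then xs ! (i - j) else r)" for i j r xs
    by (induction xs arbitrary: j r) (auto simp: nth_Cons')
  have "PT (\<lambda>e. snd (fold (\<lambda>x s. ?h x s (g e)) (f e) (0, 0)))"
    by (rule PT_snd[OF PT_fold_additive[OF 1 assms(1) PT_const 2]])
  then show ?thesis by (rule PT_cong) (simp only: *, simp add: nth0_def)
qed

text \<open>The next index is the length of the accumulator, so its size depends on the accumulator
  and the additive rule does not apply. As every index is at most the length of the list, all
  prefixes are bounded directly.\<close>

lemma PT_indices: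
  assumes "PT f" shows "PT (\<lambda>e. [0..<length (f e)])"
proof -
  have 1: "PT (\<lambda>p :: 'b \<times> nat list \<times> 'a. length (fst (snd p)) # fst (snd p))"
    by (intro PT_Cons PT_length PT_fst PT_snd PT_id)
  have *: "fold (\<lambda>_ l. length l # l) xs (rev [0..<n]) = rev [0..<n + length xs]" for n and xs :: "'b list"
  proof (induction xs arbitrary: n)
    case (Cons x xs)
    show ?case using Cons[of "Suc n"] by simp
  qed simp
  obtain T where T: "poly T" "\<And>e. sz (f e) \<le> T (sz e)" using PT_size_poly[OF assms] by blast
  have "PT (\<lambda>e. fold (\<lambda>_ l. length l # l) (f e) [])"
  proof (rule PT_fold[OF 1 assms PT_const, where U = "\<lambda>s. T s * (6 * T s + 1 + 1) + 1"])
    show "poly (\<lambda>s. T s * (6 * T s + 1 + 1) + 1)" by (intro poly_intros T)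
    fix e i
    let ?m = "length (take i (f e))"
    have m: "?m \<le> T (sz e)" using length_le_sz[of "f e"] T(2)[of e] by simp
    have "sz (rev [0..<?m]) \<le> length (rev [0..<?m]) * (6 * T (sz e) + 1 + 1) + 1"
    proof (rule sz_list_le)
      fix x assume "x \<in> set (rev [0..<?m])"
      then have "x \<le> T (sz e)" using m by auto
      then show "sz x \<le> 6 * T (sz e) + 1" using bitlen_le[of x] by (simp add: sz_nat)
    qed
    also have "\<dots> \<le> T (sz e) * (6 * T (sz e) + 1 + 1) + 1"
      using m by (intro add_le_mono1 mult_le_mono1) simp
    finally show "sz (fold (\<lambda>_ l. length l # l) (take i (f e)) []) \<le> T (sz e) * (6 * T (sz e) + 1 + 1) + 1"
      using *[of _ 0] by simp
  qed
  from PT_rev[OF this] show ?thesis using *[of _ 0] by simp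
qed

section \<open>Bipartite matching\<close>

definition matching :: "('a \<times> 'b) set \<Rightarrow> ('a \<times> 'b) set \<Rightarrow> bool" where
  "matching A M \<longleftrightarrow> M \<subseteq> A \<and> inj_on fst M \<and> inj_on snd M"

text \<open>\<open>Q\<close> together with the left vertices outside \<open>Z\<close> is a vertex
  cover; this is the dual object of a matching.\<close>

definition is_cover :: "('a \<times> 'b) set \<Rightarrow> 'a set \<Rightarrow> 'b set \<Rightarrow> bool" where
  "is_cover A Z Q \<longleftrightarrow> (\<forall>y i. (y, i) \<in> A \<longrightarrow> y \<in> Z \<longrightarrow> i \<in> Q)"

text \<open>Weak duality: edges starting in \<open>Z\<close> are mapped injectively into
  \<open>Q\<close> by \<open>snd\<close>, the others outside \<open>Z\<close> by
  \<open>fst\<close>.\<close>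

lemma matching_le_cover:
  assumes "matching A M" "is_cover A Z Q" "finite A" "finite Q"
  shows "card M \<le> card Q + card (fst ` A - Z)"
proof -
  have M: "M \<subseteq> A" "inj_on fst M" "inj_on snd M" "finite M"
    using assms finite_subset by (auto simp: matching_def)
  let ?M1 = "{p \<in> M. fst p \<in> Z}" and ?M2 = "{p \<in> M. fst p \<notin> Z}"
  have "card ?M1 \<le> card Q"
    by (rule card_inj_on_le[of snd])
       (use M assms in \<open>auto simp: is_cover_def intro: inj_on_subset\<close>)
  moreover have "card ?M2 \<le> card (fst ` A - Z)"
    by (rule card_inj_on_le[of fst]) (use M assms in \<open>auto intro: inj_on_subset\<close>)
  moreover have "card M = card ?M1 + card ?M2"
    by (subst card_Un_disjoint[symmetric]) (use M in \<open>auto intro: arg_cong[of _ _ card]\<close>)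
  ultimately show ?thesis by simp
qed

subsection \<open>An auction for bipartite matching\<close>

text \<open>The state is the list of all bids, most recent first. The price of an object is the number of
  bids on it, and it belongs to the last bidder. A bidder without an object bids on a cheapest
  acceptable one, and gives up once all of these cost more than the number of objects.\<close>

definition price :: "('a \<times> 'b) list \<Rightarrow> 'b \<Rightarrow> nat" where
  "price H i = length (filter (\<lambda>p. snd p = i) H)"

definition holds :: "('a \<times> 'b) list \<Rightarrow> 'a \<Rightarrow> 'b \<Rightarrow> bool" where
  "holds H y i \<longleftrightarrow> (\<exists>p\<in>set (take 1 (filter (\<lambda>p. snd p = i) H)). fst p = y)"

definition bid :: "nat \<Rightarrow> ('a \<times> 'b) list \<Rightarrow> ('a \<times> 'b) list \<Rightarrow> 'a \<times> 'b \<Rightarrow> bool" where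
  "bid n A H p \<longleftrightarrow> \<not> (\<exists>q\<in>set A. holds H (fst p) (snd q)) \<and> price H (snd p) \<le> n \<and>
     (\<forall>q\<in>set A. fst q = fst p \<longrightarrow> price H (snd p) \<le> price H (snd q))"

definition auction_step :: "nat \<Rightarrow> ('a \<times> 'b) list \<Rightarrow> ('a \<times> 'b) list \<Rightarrow> ('a \<times> 'b) list" where
  "auction_step n A H = take 1 (filter (\<lambda>p. bid n A H p) A) @ H"

lemma price_simps [simp]:
  "price [] i = 0" "price (p # H) i = (if snd p = i then Suc (price H i) else price H i)"
  by (auto simp: price_def)

lemma holds_simps [simp]:
  "holds [] y i \<longleftrightarrow> False" "holds (p # H) y i \<longleftrightarrow> (if snd p = i then fst p = y else holds H y i)"
  by (auto simp: holds_def)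

lemma price_pos_iff: "price H i > 0 \<longleftrightarrow> (\<exists>y. holds H y i)"
  by (induction H) auto

lemma holds_in: "holds H y i \<Longrightarrow> (y, i) \<in> set H"
  by (induction H) (auto split: if_splits)

lemma holds_unique: "holds H y i \<Longrightarrow> holds H z i \<Longrightarrow> y = z"
  by (induction H) (auto split: if_splits)

text \<open>The last clause is complementary slackness up to one unit. It holds because bids go to
  cheapest acceptable objects, each bid raises a price by one, and later bids only raise the prices
  of alternatives.\<close>

definition auction_inv :: "nat \<Rightarrow> ('a \<times> 'b) list \<Rightarrow> ('a \<times> 'b) list \<Rightarrow> bool" where
  "auction_inv n A H \<longleftrightarrow> set H \<subseteq> set A \<and> (\<forall>i. price H i \<le> n + 1) \<and>
     (\<forall>y i j. holds H y i \<longrightarrow> holds H y j \<longrightarrow> i = j) \<and>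
     (\<forall>y i j. holds H y i \<longrightarrow> (y, j) \<in> set A \<longrightarrow> price H i \<le> price H j + 1)"

lemma auction_inv_Cons:
  assumes inv: "auction_inv n A H" and p: "p \<in> set A" "bid n A H p"
  shows "auction_inv n A (p # H)"
proof -
  obtain x k where pk: "p = (x, k)" by (cases p)
  have free: "\<not> holds H x i" for i
  proof
    assume h: "holds H x i"
    then have "(x, i) \<in> set A" using holds_in[OF h] inv by (auto simp: auction_inv_def)
    then show False using h p(2) by (force simp: bid_def pk)
  qed
  have cheap: "price H k \<le> n" "\<And>j. (x, j) \<in> set A \<Longrightarrow> price H k \<le> price H j"
    using p(2) by (auto simp: bid_def pk)
  have "price (p # H) i \<le> n + 1" for i
    using inv cheap by (auto simp: auction_inv_def pk)
  moreover have "i = j" if "holds (p # H) y i" "holds (p # H) y j" for y i j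
    using that inv free by (auto simp: auction_inv_def pk split: if_splits)
  moreover have "price (p # H) i \<le> price (p # H) j + 1" if "holds (p # H) y i" "(y, j) \<in> set A" for y i j
  proof (cases "i = k")
    case True
    then show ?thesis using that cheap(2)[of j] by (auto simp: pk)
  next
    case False
    then have "price H i \<le> price H j + 1" using that inv by (auto simp: auction_inv_def pk)
    then show ?thesis using False by (auto simp: pk)
  qed
  moreover have "set (p # H) \<subseteq> set A" using inv p by (auto simp: auction_inv_def)
  ultimately show ?thesis unfolding auction_inv_def by blast
qed

lemma auction_step_cases:
  "(auction_step n A H = H \<and> (\<forall>p\<in>set A. \<not> bid n A H p)) \<or>
   (\<exists>p\<in>set A. bid n A H p \<and> auction_step n A H = p # H)"
proof (cases "filter (\<lambda>p. bid n A H p) A")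
  case Nil
  then show ?thesis by (simp add: auction_step_def filter_empty_conv)
next
  case (Cons p ps)
  have "p \<in> set (filter (\<lambda>p. bid n A H p) A)" unfolding Cons by simp
  then have "p \<in> set A" "bid n A H p" by simp_all
  moreover have "auction_step n A H = p # H" unfolding auction_step_def Cons by simp
  ultimately show ?thesis by blast
qed

text \<open>A step is determined by \<open>H\<close>, so the auction stays at rest once nobody bids;
  before that, every step has added exactly one bid.\<close>

lemma auction_iterate:
  "auction_inv n A ((auction_step n A ^^ k) []) \<and>
   (length ((auction_step n A ^^ k) []) = k \<or>
     (\<forall>p\<in>set A. \<not> bid n A ((auction_step n A ^^ k) []) p))"
proof (induction k)
  case 0
  show ?case by (simp add: auction_inv_def)
next
  case (Suc k)
  let ?H = "(auction_step n A ^^ k) []"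
  show ?case using auction_step_cases[of n A ?H] Suc auction_inv_Cons[of n A ?H] by auto
qed

lemma length_eq_sum_price:
  assumes "finite P" "snd ` set H \<subseteq> P"
  shows "length H = (\<Sum>i\<in>P. price H i)"
  using assms(2)
proof (induction H)
  case (Cons p H)
  have "(\<Sum>i\<in>P. price (p # H) i) = (\<Sum>i\<in>P. price H i + (if i = snd p then 1 else 0))"
    by (intro sum.cong) auto
  also have "\<dots> = Suc (\<Sum>i\<in>P. price H i)"
    using Cons.prems assms(1) by (simp add: sum.distrib)
  finally show ?case using Cons by simp
qed simp

text \<open>The number of bids is the sum of all prices, each of which is at most
  \<open>n + 1\<close>. Were the auction still active after \<open>k\<close> steps, the next bid
  would exceed this total.\<close>

lemma auction_final:
  assumes "(n + 1) * card (snd ` set A) \<le> k"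
  shows "auction_inv n A ((auction_step n A ^^ k) []) \<and>
     (\<forall>p\<in>set A. \<not> bid n A ((auction_step n A ^^ k) []) p)"
proof -
  let ?H = "(auction_step n A ^^ k) []" and ?P = "snd ` set A"
  have inv: "auction_inv n A ?H" using auction_iterate by blast
  show ?thesis
  proof (rule ccontr)
    assume contra: "\<not> ?thesis"
    have inv': "auction_inv n A ((auction_step n A ^^ Suc k) [])" using auction_iterate by blast
    have len: "length ?H = k" using contra auction_iterate[of n A k] by blast
    have "Suc k = length ((auction_step n A ^^ Suc k) [])"
      using contra inv len auction_step_cases[of n A ?H] by auto
    also have "\<dots> = (\<Sum>i\<in>?P. price ((auction_step n A ^^ Suc k) []) i)"
      by (rule length_eq_sum_price) (use inv' in \<open>auto simp: auction_inv_def\<close>)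
    also have "\<dots> \<le> (\<Sum>i\<in>?P. n + 1)"
      by (rule sum_mono) (use inv' in \<open>auto simp only: auction_inv_def\<close>)
    also have "\<dots> \<le> k" using assms by (simp only: sum_constant of_nat_id mult.commute)
    finally show False by simp
  qed
qed

text \<open>Some price level is not taken by any object: the bidders that gave up together with the owners
  of the objects above this level only accept objects above this level.\<close>

lemma auction_cover:
  assumes inv: "auction_inv n A H" and stop: "\<forall>p\<in>set A. \<not> bid n A H p"
    and n: "card (snd ` set A) \<le> n"
  shows "matching (set A) {p. holds H (fst p) (snd p)}"
    and "card {p. holds H (fst p) (snd p)} = card (snd ` set H)"
    and "\<exists>Z Q. is_cover (set A) Z Q \<and> finite Q \<and>
      card {p. holds H (fst p) (snd p)} = card Q + card (fst ` set A - Z)"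
proof -
  let ?M = "{p. holds H (fst p) (snd p)}" and ?P = "snd ` set A"
  have HA: "set H \<subseteq> set A" using inv by (simp add: auction_inv_def)
  have MA: "?M \<subseteq> set A"
  proof
    fix p assume "p \<in> ?M"
    then have "(fst p, snd p) \<in> set H" by (intro holds_in) simp
    then show "p \<in> set A" using HA by auto
  qed
  have uniq: "holds H y i \<Longrightarrow> holds H y j \<Longrightarrow> i = j" for y i j
    using inv by (auto simp: auction_inv_def)
  have inj: "inj_on fst ?M" "inj_on snd ?M"
    using uniq by (auto simp: inj_on_def dest: holds_unique)
  show "matching (set A) ?M" using MA inj by (simp add: matching_def)
  have "snd ` ?M = snd ` set H"
  proof -
    have "(\<exists>y. holds H y i) \<longleftrightarrow> i \<in> snd ` set H" for i
      unfolding price_pos_iff[symmetric] by (force simp: price_def filter_empty_conv)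
    moreover have "i \<in> snd ` ?M \<longleftrightarrow> (\<exists>y. holds H y i)" for i
      by (auto simp: image_iff)
    ultimately show ?thesis by (intro set_eqI) simp
  qed
  then show "card ?M = card (snd ` set H)" using card_image[OF inj(2)] by simp
  have finM: "finite ?M" using MA finite_subset by blast
  define F where "F = {y \<in> fst ` set A. \<forall>i. \<not> holds H y i}"
  \<comment> \<open>Otherwise a cheapest object acceptable to \<open>y\<close> would still attract a
    bid.\<close>
  have steep: "n < price H i" if yF: "y \<in> F" and yi: "(y, i) \<in> set A" for y i
  proof -
    let ?R = "{i. (y, i) \<in> set A}"
    have fin: "finite ?R" by (rule finite_subset[of _ "snd ` set A"]) force+
    obtain k where k: "k \<in> ?R" "\<forall>j\<in>?R. price H k \<le> price H j"
      using arg_min_if_finite(1)[of ?R "price H"] arg_min_least[of ?R _ "price H"] fin yi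
      by blast
    have "\<not> bid n A H (y, k)" using stop k by auto
    then have "n < price H k" using yF k by (auto simp: bid_def F_def)
    then show ?thesis using k(2) yi by force
  qed
  show "\<exists>Z Q. is_cover (set A) Z Q \<and> finite Q \<and> card ?M = card Q + card (fst ` set A - Z)"
  proof -
    \<comment> \<open>\<open>t\<close> is a price level between 1 and \<open>n\<close> at which
      there is no object. If every bidder owns an object, the default \<open>n + 1\<close> makes
      both \<open>Q\<close> and \<open>Z\<close> empty.\<close>
    obtain t where t: "\<forall>y\<in>F. \<forall>i. (y, i) \<in> set A \<longrightarrow> t < price H i" "\<forall>i\<in>?P. price H i \<noteq> t \<or> t = n + 1"
      "F \<noteq> {} \<or> t = n + 1"
    proof (cases "F = {}")
      case True
      then show ?thesis using that[of "n + 1"] by auto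
    next
      case False
      then obtain y where y: "y \<in> F" by blast
      then obtain i0 where i0: "(y, i0) \<in> set A" by (auto simp: F_def)
      have p0: "price H i0 > n" using steep y i0 by blast
      have i0P: "i0 \<in> ?P" using i0 by force
      \<comment> \<open>Pigeonhole: \<open>i0\<close> costs more than \<open>n\<close>, and the
        other objects, fewer than \<open>n\<close>, cannot occupy all levels from 1 to
        \<open>n\<close>.\<close>
      have "card (price H ` (?P - {i0})) \<le> card (?P - {i0})" by (rule card_image_le) simp
      also have "\<dots> < card ?P" by (rule card_Diff1_less) (use i0P in auto)
      also have "\<dots> \<le> card {1..n}" using n by simp
      finally have "\<not> {1..n} \<subseteq> price H ` (?P - {i0})"
        by (meson card_mono finite_Diff finite_imageI finite_set not_less)
      then obtain t where t: "t \<in> {1..n}" "t \<notin> price H ` (?P - {i0})" by blast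
      have "\<forall>i\<in>?P. price H i \<noteq> t" using t p0 by force
      moreover have "\<forall>y\<in>F. \<forall>i. (y, i) \<in> set A \<longrightarrow> t < price H i"
        using steep t by fastforce
      ultimately show ?thesis using that[of t] False by blast
    qed
    define Q where "Q = {i \<in> ?P. t < price H i}"
    define Z where "Z = F \<union> {y. \<exists>i\<in>Q. holds H y i}"
    have bound: "price H i \<le> n + 1" for i using inv by (auto simp: auction_inv_def)
    have cover: "is_cover (set A) Z Q"
      unfolding is_cover_def
    proof (intro allI impI)
      fix y i assume yi: "(y, i) \<in> set A" "y \<in> Z"
      then have iP: "i \<in> ?P" by force
      show "i \<in> Q"
      proof (cases "y \<in> F")
        case True then show ?thesis using t(1) yi iP by (auto simp: Q_def)
      next
        case False
        then obtain j where j: "j \<in> Q" "holds H y j" using yi(2) by (auto simp: Z_def)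
        \<comment> \<open>By slackness, an object acceptable to the owner of \<open>j\<close> costs
          at least \<open>t\<close>, hence more than \<open>t\<close>, since no object costs exactly
          \<open>t\<close>.\<close>
        then have "price H j \<le> price H i + 1" using inv yi(1) by (auto simp: auction_inv_def)
        moreover have "t < price H j" using j by (simp add: Q_def)
        moreover have "t \<noteq> n + 1" using bound[of j] \<open>t < price H j\<close> by simp
        ultimately show ?thesis using t(2) iP by (force simp: Q_def)
      qed
    qed
    have finQ: "finite Q" by (simp add: Q_def)
    \<comment> \<open>Owners of objects in \<open>Q\<close> correspond to \<open>Q\<close>, all
      other owners to the bidders outside \<open>Z\<close>: both estimates of
      \<open>matching_le_cover\<close> are tight.\<close>
    let ?M1 = "{p \<in> ?M. snd p \<in> Q}" and ?M2 = "{p \<in> ?M. snd p \<notin> Q}"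
    have e1: "snd ` ?M1 = Q"
    proof -
      have "\<exists>y. holds H y i" if "i \<in> Q" for i
        using that unfolding price_pos_iff[symmetric] by (auto simp: Q_def)
      then show ?thesis by (auto simp: image_iff)
    qed
    have "inj_on snd ?M1" by (rule inj_on_subset[OF inj(2)]) auto
    then have "card (snd ` ?M1) = card ?M1" by (rule card_image)
    then have c1: "card ?M1 = card Q" unfolding e1 by (rule sym)
    have e2: "fst ` ?M2 = fst ` set A - Z"
    proof
      show "fst ` ?M2 \<subseteq> fst ` set A - Z"
      proof
        fix y assume "y \<in> fst ` ?M2"
        then obtain i where i: "holds H y i" "i \<notin> Q" by auto
        have "(y, i) \<in> set A" using MA i(1) by auto
        then have yA: "y \<in> fst ` set A" by (rule image_eqI[rotated]) simp
        have "y \<notin> F" using i(1) by (auto simp: F_def)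
        moreover have "j \<notin> Q" if "holds H y j" for j using uniq[OF i(1) that] i(2) by simp
        ultimately have "y \<notin> Z" unfolding Z_def by blast
        with yA show "y \<in> fst ` set A - Z" by (rule DiffI)
      qed
      show "fst ` set A - Z \<subseteq> fst ` ?M2"
      proof
        fix y assume y: "y \<in> fst ` set A - Z"
        then have "y \<notin> F" "\<not> (\<exists>i\<in>Q. holds H y i)" unfolding Z_def by blast+
        then obtain i where "holds H y i" "i \<notin> Q" using y unfolding F_def by blast
        then have "(y, i) \<in> ?M2" by simp
        then show "y \<in> fst ` ?M2" by (rule image_eqI[rotated]) simp
      qed
    qed
    have "inj_on fst ?M2" by (rule inj_on_subset[OF inj(1)]) auto
    then have "card (fst ` ?M2) = card ?M2" by (rule card_image)
    then have c2: "card ?M2 = card (fst ` set A - Z)" unfolding e2 by (rule sym)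
    have "card ?M = card ?M1 + card ?M2"
      by (subst card_Un_disjoint[symmetric]) (use finM in \<open>auto intro: arg_cong[of _ _ card]\<close>)
    then have "card ?M = card Q + card (fst ` set A - Z)" by (simp only: c1 c2)
    then show ?thesis using cover finQ by blast
  qed
qed

text \<open>Applied to the edges at a set of left vertices, this is the rank function of the
  transversal matroid.\<close>

definition rank :: "('a \<times> 'b) set \<Rightarrow> nat" where
  "rank A = Max (card ` {M. matching A M})"

lemma matching_rank:
  assumes "finite A"
  shows "finite (card ` {M. matching A M})" "matching A M \<Longrightarrow> card M \<le> rank A"
    "\<exists>M. matching A M \<and> card M = rank A"
proof -
  have "{M. matching A M} \<subseteq> Pow A" by (auto simp: matching_def)
  then show fin: "finite (card ` {M. matching A M})"
    using assms finite_subset by blast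
  show "card M \<le> rank A" if "matching A M"
    unfolding rank_def using fin that by (auto intro: Max_ge)
  have "matching A {}" by (simp add: matching_def)
  then have "card ` {M. matching A M} \<noteq> {}" by blast
  from Max_in[OF fin this] show "\<exists>M. matching A M \<and> card M = rank A"
    unfolding rank_def by auto
qed

lemma rank_eqI:
  assumes "finite A" "matching A M" "is_cover A Z Q" "finite Q" "card M = card Q + card (fst ` A - Z)"
  shows "rank A = card M"
proof (rule antisym)
  obtain M' where "matching A M'" "card M' = rank A" using matching_rank(3)[OF assms(1)] by blast
  then show "rank A \<le> card M" using matching_le_cover[OF _ assms(3,1,4), of M'] assms(5) by simp
  show "card M \<le> rank A" by (rule matching_rank(2)[OF assms(1,2)])
qed

lemma auction_rank:
  assumes "card (snd ` set A) \<le> n" "(n + 1) * n \<le> k"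
  shows "card (snd ` set ((auction_step n A ^^ k) [])) = rank (set A)"
proof -
  have "(n + 1) * card (snd ` set A) \<le> k"
    using assms mult_le_mono2[OF assms(1), of "n + 1"] by linarith
  from auction_final[OF this] have "auction_inv n A ((auction_step n A ^^ k) [])"
    "\<forall>p\<in>set A. \<not> bid n A ((auction_step n A ^^ k) []) p" by auto
  note c = auction_cover[OF this assms(1)]
  let ?H = "(auction_step n A ^^ k) []"
  obtain Z Q where ZQ: "is_cover (set A) Z Q" "finite Q"
    "card {p. holds ?H (fst p) (snd p)} = card Q + card (fst ` set A - Z)" using c(3) by blast
  from rank_eqI[OF finite_set c(1) ZQ] c(2) show ?thesis by simp
qed

text \<open>An auction on any listing of \<open>A\<close>, run until it rests, provides a matching
  and a cover of the same size.\<close>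

lemma koenig:
  assumes "finite A"
  shows "\<exists>Z Q. is_cover A Z Q \<and> finite Q \<and> rank A = card Q + card (fst ` A - Z)"
proof -
  obtain L where L: "set L = A" using assms finite_list by blast
  let ?n = "card (snd ` A)"
  let ?H = "(auction_step ?n L ^^ ((?n + 1) * ?n)) []"
  have "(?n + 1) * card (snd ` set L) \<le> (?n + 1) * ?n" by (simp add: L)
  from auction_final[OF this]
  have H: "auction_inv ?n L ?H" "\<forall>p\<in>set L. \<not> bid ?n L ?H p" by blast+
  have "card (snd ` set L) \<le> card (snd ` A)" by (simp add: L)
  note c = auction_cover[OF H this, unfolded L]
  obtain Z Q where ZQ: "is_cover A Z Q" "finite Q"
    "card {p. holds ?H (fst p) (snd p)} = card Q + card (fst ` A - Z)" using c(3) by blast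
  from rank_eqI[OF assms c(1) ZQ] ZQ show ?thesis by auto
qed

section \<open>The transversal matroid of matchable sets\<close>

definition matchable :: "('a \<times> 'b) set \<Rightarrow> 'a set \<Rightarrow> bool" where
  "matchable A S \<longleftrightarrow> (\<exists>M. matching A M \<and> fst ` M = S)"

lemma matchable_rank:
  assumes "finite A" "matchable A S" shows "finite S" "card S \<le> rank A"
proof -
  obtain M where M: "matching A M" "fst ` M = S" using assms by (auto simp: matchable_def)
  have "finite M" using M assms finite_subset by (auto simp: matching_def)
  then show "finite S" using M by auto
  have "card S = card M" using M card_image[of fst M] by (auto simp: matching_def)
  then show "card S \<le> rank A" using matching_rank(2)[OF assms(1) M(1)] by simp
qed

lemma matching_mono: "matching A M \<Longrightarrow> A \<subseteq> B \<Longrightarrow> matching B M"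
  by (auto simp: matching_def)

lemma matching_restrict: "matching A M \<Longrightarrow> M \<subseteq> B \<Longrightarrow> matching B M"
  by (auto simp: matching_def)

lemma rank_mono: "finite B \<Longrightarrow> A \<subseteq> B \<Longrightarrow> rank A \<le> rank B"
  using matching_rank(3)[of A] matching_rank(2)[of B] matching_mono finite_subset by metis

text \<open>If y cannot be added to the matched set S, then by Koenig's theorem some set Z of bidders
  containing y is saturated: its members accept only objects that are matched within Z.\<close>

lemma saturated_set:
  assumes fin: "finite A" and M: "matching A M" "fst ` M = S" and y: "y \<in> fst ` A" "y \<notin> S"
    and no: "\<not> matchable A (insert y S)"
  shows "\<exists>Z Q. y \<in> Z \<and> is_cover A Z Q \<and> Q \<subseteq> snd ` {p \<in> M. fst p \<in> Z}"
proof -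
  \<comment> \<open>On the edges at \<open>insert y S\<close> the maximum matching size is just
    \<open>card S\<close>, one short of saturating all left vertices.\<close>
  let ?B = "{p \<in> A. fst p \<in> insert y S}"
  have finB: "finite ?B" using fin by simp
  have MA: "M \<subseteq> A" "inj_on fst M" "inj_on snd M" using M by (auto simp: matching_def)
  have finM: "finite M" using MA fin finite_subset by blast
  have finS: "finite S" using finM M by auto
  have fB: "fst ` ?B = insert y S" using y MA M(2) by force
  have "matching ?B M" using M by (auto simp: matching_def)
  from matching_rank(2)[OF finB this] have ge: "card S \<le> rank ?B"
    using card_image[OF MA(2)] M(2) by simp
  have le: "rank ?B \<le> card S"
  proof -
    obtain M' where M': "matching ?B M'" "card M' = rank ?B" using matching_rank(3)[OF finB] by blast
    have "matching A M'" using M' by (auto simp: matching_def)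
    then have "fst ` M' \<noteq> insert y S" using no by (auto simp: matchable_def)
    moreover have "fst ` M' \<subseteq> insert y S" using M' fB by (auto simp: matching_def)
    ultimately have "card (fst ` M') < card (insert y S)"
      by (intro psubset_card_mono) (use finS in auto)
    moreover have "card (fst ` M') = card M'" using M' by (intro card_image) (simp add: matching_def)
    ultimately show ?thesis using M'(2) y finS by simp
  qed
  obtain Z0 Q where ZQ0: "is_cover ?B Z0 Q" "finite Q" "rank ?B = card Q + card (fst ` ?B - Z0)"
    using koenig[OF finB] by blast
  note ZQ = ZQ0(1,2) ZQ0(3)[unfolded fB]
  let ?Z = "Z0 \<inter> insert y S"
  let ?N = "{p \<in> M. fst p \<in> ?Z}"
  have "card (insert y S) = card ?Z + card (insert y S - Z0)"
    using card_Int_Diff[of "insert y S" Z0] finS by (simp add: Int_commute)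
  \<comment> \<open>\<open>?Z\<close> has one member more than \<open>Q\<close>, yet
    \<open>M\<close> embeds \<open>?Z\<close> without \<open>y\<close> into \<open>Q\<close>. Hence
    \<open>y\<close> belongs to \<open>?Z\<close>, and by counting \<open>M\<close> uses up all of
    \<open>Q\<close>.\<close>
  then have cZ: "card ?Z = Suc (card Q)" using ZQ(3) le ge y finS by simp
  have cover: "is_cover A ?Z Q" using ZQ(1) by (auto simp: is_cover_def)
  have NQ: "snd ` ?N \<subseteq> Q"
  proof
    fix i assume "i \<in> snd ` ?N"
    then obtain z where "(z, i) \<in> M" "z \<in> ?Z" by auto
    then show "i \<in> Q" using MA(1) cover unfolding is_cover_def by blast
  qed
  have NM: "?N \<subseteq> M" by blast
  have cN: "card (snd ` ?N) = card (fst ` ?N)"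
    unfolding card_image[OF inj_on_subset[OF MA(2) NM]] card_image[OF inj_on_subset[OF MA(3) NM]] ..
  have fN: "fst ` ?N = Z0 \<inter> S" using M(2) y by auto
  have yZ: "y \<in> Z0"
  proof (rule ccontr)
    assume "y \<notin> Z0"
    then have "?Z = Z0 \<inter> S" by auto
    then have "card ?Z = card (snd ` ?N)" using cN fN by simp
    also have "\<dots> \<le> card Q" using NQ ZQ(2) by (rule card_mono[rotated])
    finally show False using cZ by simp
  qed
  have "?Z = insert y (Z0 \<inter> S)" using yZ by auto
  then have "card ?Z = Suc (card (Z0 \<inter> S))" using y finS by simp
  then have "card (snd ` ?N) = card Q" using cZ cN fN by simp
  then have "snd ` ?N = Q" using card_subset_eq[OF ZQ(2) NQ] by blast
  then have "Q \<subseteq> snd ` ?N" by simp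
  moreover have "y \<in> ?Z" using yZ by simp
  ultimately show ?thesis using cover by (intro exI[of _ ?Z] exI[of _ Q] conjI)
qed

text \<open>This is the matroid property: a maximal matchable set is of maximum size. Saturated sets
  are closed under union; the union over all left vertices outside \<open>S\<close>, with its
  objects, gives a cover of size at most \<open>card S\<close>.\<close>

lemma maximal_matchable:
  assumes fin: "finite A" and S: "matchable A S"
    and no: "\<And>y. y \<in> fst ` A - S \<Longrightarrow> \<not> matchable A (insert y S)"
  shows "rank A = card S"
proof -
  obtain M where M: "matching A M" "fst ` M = S" using S by (auto simp: matchable_def)
  have MA: "M \<subseteq> A" "inj_on fst M" "inj_on snd M" "finite M"
    using M fin finite_subset by (auto simp: matching_def)
  define P where "P = (\<lambda>y Z Q. y \<in> Z \<and> is_cover A Z Q \<and> Q \<subseteq> snd ` {p \<in> M. fst p \<in> Z})"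
  have "\<exists>Z Q. P y Z Q" if "y \<in> fst ` A - S" for y
    unfolding P_def by (rule saturated_set[OF fin M _ _ no[OF that]]) (use that in auto)
  then obtain Z Q where "\<And>y. y \<in> fst ` A - S \<Longrightarrow> P y (Z y) (Q y)" by metis
  then have ZQ: "y \<in> Z y" "is_cover A (Z y) (Q y)" "Q y \<subseteq> snd ` {p \<in> M. fst p \<in> Z y}"
    if "y \<in> fst ` A - S" for y using that unfolding P_def by blast+
  let ?Z = "\<Union>y\<in>fst ` A - S. Z y" and ?Q = "\<Union>y\<in>fst ` A - S. Q y"
  let ?N = "{p \<in> M. fst p \<in> ?Z}"
  have cover: "is_cover A ?Z ?Q" using ZQ(2) unfolding is_cover_def by blast
  have QN: "?Q \<subseteq> snd ` ?N"
  proof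
    fix i assume "i \<in> ?Q"
    then obtain y where y: "y \<in> fst ` A - S" "i \<in> Q y" by blast
    then obtain p where "p \<in> M" "fst p \<in> Z y" "i = snd p" using ZQ(3)[OF y(1)] by blast
    then show "i \<in> snd ` ?N" using y(1) by (intro image_eqI[of _ _ p]) auto
  qed
  have finQ: "finite ?Q" by (rule finite_subset[OF QN]) (use MA(4) in simp)
  have "card ?Q \<le> card (snd ` ?N)" using QN MA(4) by (intro card_mono) auto
  also have "\<dots> \<le> card ?N" by (rule card_image_le) (use MA in auto)
  also have "\<dots> = card (fst ` ?N)" by (rule card_image[symmetric]) (use MA in \<open>auto intro: inj_on_subset\<close>)
  also have "fst ` ?N = S \<inter> ?Z" using M(2) by auto
  finally have 1: "card ?Q \<le> card (S \<inter> ?Z)" .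
  have "finite S" using MA M by auto
  have "fst ` A - ?Z \<subseteq> S - ?Z" using ZQ(1) by blast
  then have 2: "card (fst ` A - ?Z) \<le> card (S - ?Z)" using \<open>finite S\<close> by (intro card_mono) auto
  obtain M' where M': "matching A M'" "card M' = rank A" using matching_rank(3)[OF fin] by blast
  have "rank A \<le> card ?Q + card (fst ` A - ?Z)"
    using matching_le_cover[OF M'(1) cover fin finQ] M' by simp
  also have "\<dots> \<le> card (S \<inter> ?Z) + card (S - ?Z)" using 1 2 by (rule add_mono)
  also have "\<dots> = card S" using card_Int_Diff[OF \<open>finite S\<close>] by simp
  finally show ?thesis using matchable_rank[OF fin S] by simp
qed

subsection \<open>Greedy choice of a cheapest matchable set\<close>

definition precedes :: "(nat \<Rightarrow> nat) \<Rightarrow> nat \<Rightarrow> nat \<Rightarrow> bool" where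
  "precedes w v x \<longleftrightarrow> w v < w x \<or> (w v = w x \<and> v \<le> x)"

text \<open>The greedy rule in non-adaptive form: a vertex is taken iff its edges raise the rank of
  the initial segment before it. Each vertex can thus be tested without knowledge of earlier
  choices.\<close>

definition chosen :: "(nat \<Rightarrow> nat) \<Rightarrow> (nat \<times> 'b) set \<Rightarrow> nat \<Rightarrow> bool" where
  "chosen w A x \<longleftrightarrow>
     rank {p \<in> A. precedes w (fst p) x \<and> fst p \<noteq> x} < rank {p \<in> A. precedes w (fst p) x}"

definition downset :: "(nat \<Rightarrow> nat) \<Rightarrow> nat set \<Rightarrow> nat set \<Rightarrow> bool" where
  "downset w L D \<longleftrightarrow> D \<subseteq> L \<and> (\<forall>x\<in>D. \<forall>v\<in>L. precedes w v x \<longrightarrow> v \<in> D)"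

lemma precedes_total: "precedes w v x \<or> precedes w x v"
  by (auto simp: precedes_def)

lemma precedes_trans: "precedes w v x \<Longrightarrow> precedes w x y \<Longrightarrow> precedes w v y"
  by (auto simp: precedes_def)

lemma precedes_antisym: "precedes w v x \<Longrightarrow> precedes w x v \<Longrightarrow> v = x"
  by (auto simp: precedes_def)

lemma precedes_refl: "precedes w v v"
  by (auto simp: precedes_def)

lemma precedes_greatest:
  assumes "finite D" "D \<noteq> {}" shows "\<exists>x\<in>D. \<forall>v\<in>D. precedes w v x"
  using assms
proof (induction rule: finite_ne_induct)
  case (singleton x)
  then show ?case by (simp add: precedes_refl)
next
  case (insert y F)
  then obtain x where x: "x \<in> F" "\<forall>v\<in>F. precedes w v x" by blast
  show ?case
  proof (cases "precedes w y x")
    case True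
    then show ?thesis using x by auto
  next
    case False
    then have "precedes w x y" using precedes_total by blast
    then show ?thesis using x precedes_trans precedes_refl by (metis insert_iff)
  qed
qed

text \<open>The chosen vertices form a basis of every initial segment. When the last vertex
  \<open>x\<close> raises the rank, the basis of the shorter segment is no longer maximal; only
  \<open>x\<close> can extend it, since within the shorter segment it already has maximum
  size.\<close>

lemma chosen_downset:
  assumes fin: "finite A" and D: "downset w (fst ` A) D"
  shows "matchable {p \<in> A. fst p \<in> D} {x \<in> D. chosen w A x} \<and>
    rank {p \<in> A. fst p \<in> D} = card {x \<in> D. chosen w A x}"
proof -
  have "finite D" using D fin finite_subset by (auto simp: downset_def)
  then show ?thesis using D
  proof (induction "card D" arbitrary: D)
    case 0
    then have "D = {}" by simp
    moreover have "rank ({} :: (nat \<times> 'b) set) = 0"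
      using rank_eqI[of "{} :: (nat \<times> 'b) set" "{}" "{}" "{}"] by (simp add: matching_def is_cover_def)
    ultimately show ?case by (simp add: matchable_def matching_def)
  next
    case (Suc n)
    then have "D \<noteq> {}" by auto
    then obtain x where x: "x \<in> D" "\<forall>v\<in>D. precedes w v x"
      using precedes_greatest Suc.prems(1) by blast
    let ?D = "D - {x}"
    have dD: "downset w (fst ` A) ?D"
      using Suc.prems(2) x precedes_antisym unfolding downset_def
      by (metis Diff_iff Diff_subset order_trans singletonD singletonI)
    let ?A = "{p \<in> A. fst p \<in> D}" and ?A' = "{p \<in> A. fst p \<in> ?D}"
    let ?S = "{v \<in> D. chosen w A v}" and ?S' = "{v \<in> ?D. chosen w A v}"
    have IH: "matchable ?A' ?S'" "rank ?A' = card ?S'"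
      using Suc.hyps(1)[of ?D] Suc.hyps(2) Suc.prems(1) x(1) dD by auto
    have finA: "finite ?A" "finite ?A'" using fin by auto
    have "?A = {p \<in> A. precedes w (fst p) x}"
      using x Suc.prems(2) by (auto simp: downset_def)
    moreover from this have "?A' = {p \<in> A. precedes w (fst p) x \<and> fst p \<noteq> x}" by auto
    ultimately have ch: "chosen w A x \<longleftrightarrow> rank ?A' < rank ?A" by (simp add: chosen_def)
    have sub: "?A' \<subseteq> ?A" by auto
    have mS': "matchable ?A ?S'" using IH(1) matching_mono[OF _ sub] by (auto simp: matchable_def)
    show ?case
    proof (cases "chosen w A x")
      case False
      then have "?S = ?S'" by auto
      moreover have "rank ?A = rank ?A'" using ch False rank_mono[OF finA(1) sub] by simp
      ultimately show ?thesis using mS' IH by simp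
    next
      case True
      then have S: "?S = insert x ?S'" using x by auto
      have finS': "finite ?S'" using Suc.prems(1) by simp
      have mS: "matchable ?A ?S"
      proof (rule ccontr)
        assume no: "\<not> matchable ?A ?S"
        have "\<not> matchable ?A (insert y ?S')" if y: "y \<in> fst ` ?A - ?S'" for y
        proof
          assume m: "matchable ?A (insert y ?S')"
          have "y \<noteq> x" using no m S by auto
          then have yD: "y \<in> ?D" using y by auto
          obtain M where M: "matching ?A M" "fst ` M = insert y ?S'"
            using m by (auto simp: matchable_def)
          have "M \<subseteq> ?A'"
          proof
            fix p assume p: "p \<in> M"
            then have "fst p \<in> insert y ?S'" using M(2) by blast
            then show "p \<in> ?A'" using p M(1) yD by (auto simp: matching_def)
          qed
          then have "matchable ?A' (insert y ?S')"
            unfolding matchable_def using M(2) matching_restrict[OF M(1)] by blast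
          then have "card (insert y ?S') \<le> card ?S'" using matchable_rank(2)[OF finA(2)] IH(2) by simp
          then show False using y finS' by simp
        qed
        from maximal_matchable[OF finA(1) mS' this] show False using ch True IH(2) by simp
      qed
      \<comment> \<open>A matching contains at most one edge at \<open>x\<close>, and dropping it
        leaves a matching of \<open>?A'\<close>.\<close>
      have "rank ?A \<le> Suc (rank ?A')"
      proof -
        obtain M where M: "matching ?A M" "card M = rank ?A" using matching_rank(3)[OF finA(1)] by blast
        have finM: "finite M" using M finA finite_subset by (auto simp: matching_def)
        let ?M1 = "{p \<in> M. fst p \<noteq> x}" and ?M2 = "{p \<in> M. fst p = x}"
        have "matching ?A' ?M1" using M by (auto simp: matching_def intro: inj_on_subset)
        then have "card ?M1 \<le> rank ?A'" by (rule matching_rank(2)[OF finA(2)])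
        moreover have "card ?M2 \<le> card {x}"
          by (rule card_inj_on_le[of fst]) (use M in \<open>auto simp: matching_def intro: inj_on_subset\<close>)
        moreover have "card M = card ?M1 + card ?M2"
          by (subst card_Un_disjoint[symmetric]) (use finM in \<open>auto intro: arg_cong[of _ _ card]\<close>)
        ultimately show ?thesis using M(2) by simp
      qed
      moreover have "card ?S = Suc (card ?S')" using S finS' by simp
      moreover have "card ?S \<le> rank ?A" by (rule matchable_rank(2)[OF finA(1) mS])
      ultimately show ?thesis using mS IH(2) by simp
    qed
  qed
qed

text \<open>The layer-cake formula; it reduces the comparison of weights to that of cardinalities
  above each threshold.\<close>

lemma sum_nat_layers:
  fixes w :: "'a \<Rightarrow> nat"
  assumes "finite S" "\<And>v. v \<in> S \<Longrightarrow> w v \<le> W"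
  shows "sum w S = (\<Sum>c<W. card {v \<in> S. c < w v})"
proof -
  have "sum w S = (\<Sum>v\<in>S. \<Sum>c<W. if c < w v then 1 else 0)"
  proof (rule sum.cong)
    fix v assume "v \<in> S"
    then have "{..<W} \<inter> {c. c < w v} = {..<w v}" using assms(2) by force
    then show "w v = (\<Sum>c<W. if c < w v then 1 else 0)" by (simp add: sum.If_cases)
  qed simp
  also have "\<dots> = (\<Sum>c<W. \<Sum>v\<in>S. if c < w v then 1 else 0)" by (rule sum.swap)
  also have "\<dots> = (\<Sum>c<W. card {v \<in> S. c < w v})"
    using assms(1) by (simp add: sum.If_cases Int_def)
  finally show ?thesis .
qed

text \<open>For each threshold \<open>c\<close> the vertices of weight at most \<open>c\<close> form
  an initial segment, in which the chosen ones are at least as many as those of any matchable set.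
  As the total cardinalities agree, at most as many chosen ones lie above \<open>c\<close>;
  summation over \<open>c\<close> gives the claim.\<close>

theorem chosen_optimal:
  fixes A :: "(nat \<times> 'b) set"
  assumes fin: "finite A"
  shows "matchable A {x \<in> fst ` A. chosen w A x}"
    and "card {x \<in> fst ` A. chosen w A x} = rank A"
    and "matchable A T \<Longrightarrow> card T = rank A \<Longrightarrow> sum w {x \<in> fst ` A. chosen w A x} \<le> sum w T"
proof -
  let ?L = "fst ` A"
  let ?S = "{x \<in> ?L. chosen w A x}"
  have "downset w ?L ?L" by (auto simp: downset_def)
  from chosen_downset[OF fin this]
  have 1: "matchable {p \<in> A. fst p \<in> ?L} ?S" "rank {p \<in> A. fst p \<in> ?L} = card ?S" by auto
  have A: "{p \<in> A. fst p \<in> ?L} = A" by auto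
  show "matchable A ?S" "card ?S = rank A" using 1 unfolding A by auto
  assume T: "matchable A T" "card T = rank A"
  have finT: "finite T" by (rule matchable_rank(1)[OF fin T(1)])
  have finS: "finite ?S" using fin by auto
  obtain M where M: "matching A M" "fst ` M = T" using T by (auto simp: matchable_def)
  have TL: "T \<subseteq> ?L" using M by (auto simp: matching_def)
  let ?W = "Max (insert 0 (w ` ?L))"
  have W: "w v \<le> ?W" if "v \<in> ?L" for v using that fin by (intro Max_ge) auto
  have layer: "card {v \<in> ?S. c < w v} \<le> card {v \<in> T. c < w v}" for c
  proof -
    let ?D = "{v \<in> ?L. w v \<le> c}"
    have "downset w ?L ?D" by (auto simp: downset_def precedes_def)
    from chosen_downset[OF fin this]
    have r: "rank {p \<in> A. fst p \<in> ?D} = card {x \<in> ?D. chosen w A x}" by blast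
    have "matching {p \<in> A. fst p \<in> ?D} {p \<in> M. fst p \<in> ?D}"
      using M by (auto simp: matching_def intro: inj_on_subset)
    moreover have "fst ` {p \<in> M. fst p \<in> ?D} = {v \<in> T. w v \<le> c}" using M(2) TL by force
    ultimately have "matchable {p \<in> A. fst p \<in> ?D} {v \<in> T. w v \<le> c}" by (auto simp: matchable_def)
    from matchable_rank(2)[OF _ this] have "card {v \<in> T. w v \<le> c} \<le> card {x \<in> ?D. chosen w A x}"
      using fin r by simp
    moreover have "{x \<in> ?D. chosen w A x} = {v \<in> ?S. w v \<le> c}" by auto
    moreover have split: "card X = card {v \<in> X. w v \<le> c} + card {v \<in> X. c < w v}"
      if "finite X" for X
      by (subst card_Un_disjoint[symmetric]) (use that in \<open>auto intro: arg_cong[of _ _ card]\<close>)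
    ultimately show ?thesis
      using split[OF finS] split[OF finT] T(2) \<open>card ?S = rank A\<close> by simp
  qed
  have "sum w ?S = (\<Sum>c<?W. card {v \<in> ?S. c < w v})"
    by (rule sum_nat_layers[OF finS]) (use W in auto)
  also have "\<dots> \<le> (\<Sum>c<?W. card {v \<in> T. c < w v})" by (intro sum_mono layer)
  also have "\<dots> = sum w T"
    by (rule sum_nat_layers[OF finT, symmetric]) (rule W[OF subsetD[OF TL]])
  finally show "sum w ?S \<le> sum w T" .
qed

section \<open>Allocations on stars\<close>

lemma Ball_Suc: "(\<forall>i\<in>{1..n}. P i) \<longleftrightarrow> (\<forall>k<n. P (Suc k))"
  unfolding image_Suc_lessThan[symmetric] by auto

lemma connected_avoiding_centre:
  assumes "E = {{c, v} | v. v \<in> V \<and> v \<noteq> c}" "induces_connected E X" "c \<notin> X" "x \<in> X" "y \<in> X"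
  shows "x = y"
proof (rule ccontr)
  assume "x \<noteq> y"
  have "(x, y) \<in> {(a, b). a \<in> X \<and> b \<in> X \<and> {a, b} \<in> E}\<^sup>*"
    using assms by (auto simp: induces_connected_def)
  then obtain z where "z \<in> X" "{x, z} \<in> E"
    using \<open>x \<noteq> y\<close> by (cases rule: converse_rtranclE) auto
  then have "c \<in> {x, z}" using assms(1) by auto
  then show False using assms \<open>z \<in> X\<close> by auto
qed

lemma connected_with_centre:
  assumes "E = {{c, v} | v. v \<in> V \<and> v \<noteq> c}" "X \<subseteq> V" "c \<in> X"
  shows "induces_connected E X"
  unfolding induces_connected_def
proof (intro ballI)
  fix x y assume xy: "x \<in> X" "y \<in> X"
  let ?R = "{(a, b). a \<in> X \<and> b \<in> X \<and> {a, b} \<in> E}"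
  have "(x, c) \<in> ?R\<^sup>*"
  proof (cases "x = c")
    case False
    then have "{x, c} \<in> E" using assms xy by (auto simp: insert_commute)
    then show ?thesis using xy assms by (intro r_into_rtrancl) auto
  qed simp
  moreover have "(c, y) \<in> ?R\<^sup>*"
  proof (cases "y = c")
    case False
    then have "{c, y} \<in> E" using assms xy by auto
    then show ?thesis using xy assms by (intro r_into_rtrancl) auto
  qed simp
  ultimately show "(x, y) \<in> ?R\<^sup>*" by (rule rtrancl_trans)
qed

text \<open>Player j takes the centre; w k is an integral multiple of the utility function of player k.\<close>

definition acceptable ::
  "nat set \<Rightarrow> nat \<Rightarrow> nat \<Rightarrow> (nat \<Rightarrow> nat \<Rightarrow> nat) \<Rightarrow> nat \<Rightarrow> (nat \<times> nat) set" where
  "acceptable V c n w j =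
     {(v, k). v \<in> V \<and> v \<noteq> c \<and> k < n \<and> k \<noteq> j \<and> sum (w k) V \<le> n * w k v}"

lemma chosen_in: "chosen w A x \<Longrightarrow> x \<in> fst ` A"
proof (rule ccontr)
  assume "chosen w A x" "x \<notin> fst ` A"
  then have "{p \<in> A. precedes w (fst p) x \<and> fst p \<noteq> x} = {p \<in> A. precedes w (fst p) x}" by auto
  then show False using \<open>chosen w A x\<close> by (simp add: chosen_def)
qed

lemma star_allocation_iff:
  assumes star: "E = {{c, v} | v. v \<in> V \<and> v \<noteq> c}" and c: "c \<in> V" and fin: "finite V"
    and n: "n > 0"
    and u: "\<And>k v. k < n \<Longrightarrow> v \<in> V \<Longrightarrow> u (Suc k) v = of_nat (w k v) / of_nat (sum (w k) V)"
    and pos: "\<And>k. k < n \<Longrightarrow> sum (w k) V > 0"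
  shows "has_proportional_allocation V E n u \<longleftrightarrow>
    (\<exists>j<n. rank (acceptable V c n w j) + 1 = n \<and>
      sum (w j) V \<le> n * sum (w j) {v \<in> V. v = c \<or> \<not> chosen (w j) (acceptable V c n w j) v})"
proof -
  have share: "1 / of_nat n \<le> sum (u (Suc k)) X \<longleftrightarrow> sum (w k) V \<le> n * sum (w k) X"
    if k: "k < n" and X: "X \<subseteq> V" for k X
  proof -
    have "sum (u (Suc k)) X = (\<Sum>v\<in>X. of_nat (w k v) / of_nat (sum (w k) V))"
      using u[OF k] X by (intro sum.cong) auto
    also have "\<dots> = of_nat (sum (w k) X) / of_nat (sum (w k) V)"
      by (simp only: sum_divide_distrib of_nat_sum)
    finally have s: "sum (u (Suc k)) X = of_nat (sum (w k) X) / of_nat (sum (w k) V)" .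
    have "1 / of_nat n \<le> sum (u (Suc k)) X \<longleftrightarrow>
        (of_nat (sum (w k) V) :: rat) \<le> of_nat n * of_nat (sum (w k) X)"
      unfolding s using n pos[OF k] by (simp add: field_simps del: of_nat_sum)
    also have "\<dots> \<longleftrightarrow> sum (w k) V \<le> n * sum (w k) X"
      by (simp only: of_nat_mult[symmetric] of_nat_le_iff)
    finally show ?thesis .
  qed
  let ?A = "acceptable V c n w"
  have finA: "finite (?A j)" for j
    by (rule finite_subset[of _ "V \<times> {..<n}"]) (use fin in \<open>auto simp: acceptable_def\<close>)
  have players: "card ({..<n} - {j}) = n - 1" if "j < n" for j using that by simp
  \<comment> \<open>The right vertices are the players other than \<open>j\<close>; hence
    \<open>rank (?A j) + 1 = n\<close> means that all of them can be served.\<close>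
  have rank_le: "rank (?A j) \<le> n - 1" if j: "j < n" for j
  proof -
    obtain M where M: "matching (?A j) M" "card M = rank (?A j)" using matching_rank(3)[OF finA] by blast
    have "card M \<le> card ({..<n} - {j})"
      by (rule card_inj_on_le[of snd]) (use M in \<open>auto simp: matching_def acceptable_def\<close>)
    then show ?thesis using M players[OF j] by simp
  qed
  let ?S = "\<lambda>j. {x \<in> fst ` ?A j. chosen (w j) (?A j) x}"
  have rest: "{v \<in> V. v = c \<or> \<not> chosen (w j) (?A j) v} = V - ?S j" for j
    using chosen_in by (fastforce simp: acceptable_def)
  have SV: "?S j \<subseteq> V" for j by (auto simp: acceptable_def)
  show ?thesis
  proof
    assume "has_proportional_allocation V E n u"
    then obtain \<pi> where raw: "\<forall>k<n. \<pi> (Suc k) \<subseteq> V \<and> induces_connected E (\<pi> (Suc k))"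
        "\<forall>k<n. \<forall>l<n. Suc k \<noteq> Suc l \<longrightarrow> \<pi> (Suc k) \<inter> \<pi> (Suc l) = {}"
        "\<forall>k<n. 1 / of_nat n \<le> sum (u (Suc k)) (\<pi> (Suc k))"
      unfolding has_proportional_allocation_def valid_allocation_def proportional_def Ball_Suc
      by blast
    have \<pi>: "\<pi> (Suc k) \<subseteq> V" "induces_connected E (\<pi> (Suc k))"
        "l < n \<Longrightarrow> k \<noteq> l \<Longrightarrow> \<pi> (Suc k) \<inter> \<pi> (Suc l) = {}"
        "sum (w k) V \<le> n * sum (w k) (\<pi> (Suc k))" if "k < n" for k l
      using raw share[OF that, of "\<pi> (Suc k)"] that by simp_all
    obtain j where j: "j < n" "\<And>k. k < n \<Longrightarrow> k \<noteq> j \<Longrightarrow> c \<notin> \<pi> (Suc k)"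
    proof (cases "\<exists>j<n. c \<in> \<pi> (Suc j)")
      case True
      then obtain j where "j < n" "c \<in> \<pi> (Suc j)" by blast
      then show ?thesis using \<pi>(3) by (intro that[of j]) blast+
    next
      case False
      \<comment> \<open>If nobody holds the centre, any player may act as \<open>j\<close>; the
        bundle of that player is still disjoint from the leaves of the others.\<close>
      then show ?thesis using n by (intro that[of 0]) auto
    qed
    \<comment> \<open>A proportional bundle has positive value, so it is not empty, and without the
      centre connectedness leaves room for one vertex only.\<close>
    have "\<exists>v. \<pi> (Suc k) = {v}" if k: "k < n" "k \<noteq> j" for k
    proof -
      have "\<pi> (Suc k) \<noteq> {}" using \<pi>(4)[OF k(1)] pos[OF k(1)] by auto
      then show ?thesis
        using connected_avoiding_centre[OF star \<pi>(2)[OF k(1)] j(2)[OF k]] by blast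
    qed
    then obtain f where f: "\<And>k. k < n \<Longrightarrow> k \<noteq> j \<Longrightarrow> \<pi> (Suc k) = {f k}" by metis
    let ?P = "{..<n} - {j}"
    let ?M = "(\<lambda>k. (f k, k)) ` ?P" and ?T = "f ` ?P"
    have inj: "inj_on f ?P" using f \<pi>(3) by (fastforce intro!: inj_onI)
    have "(f k, k) \<in> ?A j" if "k \<in> ?P" for k
      using that f[of k] \<pi>(1)[of k] \<pi>(4)[of k] j(2)[of k] by (auto simp: acceptable_def)
    then have M: "matching (?A j) ?M"
      using inj by (auto simp: matching_def inj_on_def)
    have fM: "fst ` ?M = ?T" by force
    have mT: "matchable (?A j) ?T" using M fM unfolding matchable_def by blast
    have cT: "card ?T = n - 1" using card_image[OF inj] players[OF j(1)] by simp
    have rk: "rank (?A j) = n - 1"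
      using matchable_rank(2)[OF finA mT] cT rank_le[OF j(1)] by simp
    have opt: "sum (w j) (?S j) \<le> sum (w j) ?T"
      by (rule chosen_optimal(3)[OF finA mT]) (simp add: cT rk)
    have TV: "?T \<subseteq> V" using f \<pi>(1) by fastforce
    have disj: "\<pi> (Suc j) \<inter> ?T = {}" using f \<pi>(3)[OF _ j(1)] by fastforce
    have "sum (w j) (\<pi> (Suc j)) \<le> sum (w j) (V - ?T)"
      by (rule sum_mono2) (use fin \<pi>(1)[OF j(1)] disj in auto)
    also have "\<dots> \<le> sum (w j) (V - ?S j)"
      using opt sum.subset_diff[OF TV fin, of "w j"] sum.subset_diff[OF SV[of j] fin, of "w j"] by linarith
    finally have "n * sum (w j) (\<pi> (Suc j)) \<le> n * sum (w j) (V - ?S j)" by (rule mult_le_mono2)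
    then have "sum (w j) V \<le> n * sum (w j) (V - ?S j)" using \<pi>(4)[OF j(1)] by linarith
    then show "\<exists>j<n. rank (?A j) + 1 = n \<and>
        sum (w j) V \<le> n * sum (w j) {v \<in> V. v = c \<or> \<not> chosen (w j) (?A j) v}"
      unfolding rest using j(1) rk n by (intro exI[of _ j]) auto
  next
    assume "\<exists>j<n. rank (?A j) + 1 = n \<and>
        sum (w j) V \<le> n * sum (w j) {v \<in> V. v = c \<or> \<not> chosen (w j) (?A j) v}"
    then obtain j where j: "j < n" "rank (?A j) + 1 = n" "sum (w j) V \<le> n * sum (w j) (V - ?S j)"
      unfolding rest by blast
    have "matchable (?A j) (?S j)" by (rule chosen_optimal(1)[OF finA])
    then obtain M where M: "matching (?A j) M" "fst ` M = ?S j" by (auto simp: matchable_def)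
    have MA: "M \<subseteq> ?A j" "inj_on fst M" "inj_on snd M" using M by (auto simp: matching_def)
    have "card (snd ` M) = card M" using MA by (intro card_image)
    also have "\<dots> = card (?S j)" using card_image[OF MA(2)] M(2) by simp
    also have "\<dots> = card ({..<n} - {j})"
      using chosen_optimal(2)[OF finA] j players[OF j(1)] by simp
    finally have sM: "snd ` M = {..<n} - {j}"
      by (intro card_subset_eq) (use MA in \<open>auto simp: acceptable_def\<close>)
    have "\<exists>v. (v, k) \<in> M" if "k < n" "k \<noteq> j" for k
    proof -
      have "k \<in> snd ` M" unfolding sM using that by simp
      then show ?thesis by auto
    qed
    then obtain f where f: "\<And>k. k < n \<Longrightarrow> k \<noteq> j \<Longrightarrow> (f k, k) \<in> M" by metis
    have fA: "(f k, k) \<in> ?A j" if "k < n" "k \<noteq> j" for k using f[OF that] MA by blast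
    have fS: "f k \<in> ?S j" if "k < n" "k \<noteq> j" for k
      using f[OF that] unfolding M(2)[symmetric] by force
    have finj: "f k = f l \<Longrightarrow> k = l" if "k < n" "k \<noteq> j" "l < n" "l \<noteq> j" for k l
      using inj_onD[OF MA(2), of "(f k, k)" "(f l, l)"] f[of k] f[of l] that by auto
    define \<pi> where "\<pi> i = (if i = Suc j then V - ?S j else {f (i - 1)})" for i
    have \<pi>j: "\<pi> (Suc j) = V - ?S j" and \<pi>k: "k \<noteq> j \<Longrightarrow> \<pi> (Suc k) = {f k}" for k
      by (simp_all add: \<pi>_def)
    have cS: "c \<notin> ?S j" by (auto simp: acceptable_def)
    have sub: "\<pi> (Suc k) \<subseteq> V" if "k < n" for k
      using fA[of k] that by (cases "k = j") (auto simp: \<pi>j \<pi>k acceptable_def)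
    have conn: "induces_connected E (\<pi> (Suc k))" for k
    proof (cases "k = j")
      case True
      then show ?thesis using connected_with_centre[OF star, of "V - ?S j"] c cS \<pi>j by auto
    next
      case False
      then show ?thesis by (simp add: \<pi>k induces_connected_def)
    qed
    have disj: "\<pi> (Suc k) \<inter> \<pi> (Suc l) = {}" if "k < n" "l < n" "k \<noteq> l" for k l
      using that fS[of k] fS[of l] finj[of k l]
      by (cases "k = j"; cases "l = j"; auto simp: \<pi>j \<pi>k)
    have enough: "sum (w k) V \<le> n * sum (w k) (\<pi> (Suc k))" if "k < n" for k
      using j(3) fA[of k] that by (cases "k = j") (auto simp: \<pi>j \<pi>k acceptable_def)
    show "has_proportional_allocation V E n u"
      unfolding has_proportional_allocation_def valid_allocation_def proportional_def Ball_Suc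
      using sub conn disj enough share by (intro exI[of _ \<pi>]) auto
  qed
qed

text \<open>The centre is not part of the encoding, but incidence with all edges identifies it. A
  second such vertex exists only in the star with two vertices, where either one may serve as
  centre.\<close>

lemma star_centre:
  assumes "is_star V E" "c \<in> V" "\<forall>e\<in>E. c \<in> e"
  shows "E = {{c, v} | v. v \<in> V \<and> v \<noteq> c}"
proof -
  obtain d where d: "d \<in> V" "E = {{d, v} | v. v \<in> V \<and> v \<noteq> d}"
    using assms(1) by (auto simp: is_star_def)
  show ?thesis
  proof (cases "c = d")
    case True
    then show ?thesis using d by simp
  next
    case False
    have "v = c" if "v \<in> V" "v \<noteq> d" for v
      using assms(3) d that False by auto
    then have "V = {c, d}" using assms(2) d(1) by auto
    then have "E = {{d, c}}" using d(2) False by auto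
    then show ?thesis using \<open>V = {c, d}\<close> False by (auto simp: insert_commute)
  qed
qed

lemma star_centre_exists:
  assumes "is_star V E" shows "\<exists>c\<in>V. \<forall>e\<in>E. c \<in> e"
  using assms by (auto simp: is_star_def)

section \<open>The algorithm\<close>

subsection \<open>The decision procedure on lists of numbers\<close>

definition item_count :: "nat list \<Rightarrow> nat" where
  "item_count xs = nth0 xs 0"

definition player_count :: "nat list \<Rightarrow> nat" where
  "player_count xs = nth0 xs (2 + 2 * nth0 xs 1)"

text \<open>If there are players, both counts are at most the length of an encoded instance, so the ranges
  are cut out of its list of positions: a range up to a number in binary could be too long.\<close>

definition items :: "nat list \<Rightarrow> nat list" where
  "items xs = filter (\<lambda>v. v < item_count xs) [0..<length xs]"

definition players :: "nat list \<Rightarrow> nat list" where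
  "players xs = filter (\<lambda>k. k < player_count xs) [0..<length xs]"

text \<open>The offset of a numerator behind the header and the edges: the table is stored player by
  player, with two numbers per utility and players counted from 0.\<close>

definition entry :: "nat list \<Rightarrow> nat \<Rightarrow> nat \<Rightarrow> nat" where
  "entry xs k v = 3 + 2 * nth0 xs 1 + 2 * (k * item_count xs + v)"

definition denominator :: "nat list \<Rightarrow> nat \<Rightarrow> nat \<Rightarrow> nat" where
  "denominator xs k v = nth0 xs (1 + entry xs k v)"

text \<open>Utilities are scaled by the product of all denominators of the player, so that only integers
  have to be compared; by normalisation this product is also the total weight.\<close>

definition weight :: "nat list \<Rightarrow> nat \<Rightarrow> nat \<Rightarrow> nat" where
  "weight xs k v = nth0 xs (entry xs k v) *
     prod_list (map (\<lambda>v'. denominator xs k v') (filter (\<lambda>v'. \<not> v' = v) (items xs)))"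

definition total_weight :: "nat list \<Rightarrow> nat \<Rightarrow> nat" where
  "total_weight xs k = sum_list (map (\<lambda>v. weight xs k v) (items xs))"

text \<open>The leaf is the first component: leaves are the bidders and the elements of the matroid,
  players the objects.\<close>

definition pairs :: "nat list \<Rightarrow> nat \<Rightarrow> nat \<Rightarrow> (nat \<times> nat) list" where
  "pairs xs c j = concat (map (\<lambda>v. map (\<lambda>k. (v, k))
     (filter (\<lambda>k. \<not> k = j \<and> total_weight xs k \<le> player_count xs * weight xs k v) (players xs)))
     (filter (\<lambda>v. \<not> v = c) (items xs)))"

text \<open>The list \<open>xs\<close> repeated once for each of its elements is a unary counter of
  quadratic length. This suffices, as \<open>n\<close> players need at most
  \<open>(n + 1) * n\<close> rounds and an encoding has more than \<open>n\<close> numbers.\<close>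

definition bids :: "nat list \<Rightarrow> (nat \<times> nat) list \<Rightarrow> (nat \<times> nat) list" where
  "bids xs A = fold (\<lambda>_ H. auction_step (player_count xs) A H) (concat (map (\<lambda>_. xs) xs)) []"

text \<open>From its first bid on an object always has an owner, so the objects that received a bid
  count the edges of the matching.\<close>

definition matching_size :: "nat list \<Rightarrow> (nat \<times> nat) list \<Rightarrow> nat" where
  "matching_size xs A = length (filter (\<lambda>k. \<exists>p\<in>set (bids xs A). snd p = k) (players xs))"

definition not_after :: "nat list \<Rightarrow> nat \<Rightarrow> nat \<Rightarrow> nat \<Rightarrow> bool" where
  "not_after xs j v x \<longleftrightarrow> weight xs j v < weight xs j x \<or> (weight xs j v = weight xs j x \<and> v \<le> x)"

definition selected :: "nat list \<Rightarrow> nat \<Rightarrow> nat \<Rightarrow> nat \<Rightarrow> bool" where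
  "selected xs c j x \<longleftrightarrow>
     matching_size xs (filter (\<lambda>p. not_after xs j (fst p) x \<and> \<not> fst p = x) (pairs xs c j)) <
     matching_size xs (filter (\<lambda>p. not_after xs j (fst p) x) (pairs xs c j))"

definition feasible :: "nat list \<Rightarrow> nat \<Rightarrow> nat \<Rightarrow> bool" where
  "feasible xs c j \<longleftrightarrow> matching_size xs (pairs xs c j) + 1 = player_count xs \<and>
     total_weight xs j \<le> player_count xs *
       sum_list (map (\<lambda>v. weight xs j v) (filter (\<lambda>v. v = c \<or> \<not> selected xs c j v) (items xs)))"

definition is_centre :: "nat list \<Rightarrow> nat \<Rightarrow> bool" where
  "is_centre xs c \<longleftrightarrow> (\<forall>r\<in>set (filter (\<lambda>r. r < nth0 xs 1) [0..<length xs]).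
     nth0 xs (2 + 2 * r) = c \<or> nth0 xs (3 + 2 * r) = c)"

text \<open>Without players every allocation is vacuously proportional, but there is no candidate
  \<open>j\<close>; hence the separate case.\<close>

definition decide :: "nat list \<Rightarrow> bool" where
  "decide xs \<longleftrightarrow> player_count xs = 0 \<or>
     (\<exists>c\<in>set (items xs). is_centre xs c \<and> (\<exists>j\<in>set (players xs). feasible xs c j))"

text \<open>A curried function is analysed once, on the projections of a tuple, and may then be
  applied to arbitrary polynomial-time arguments.\<close>

lemma PT_app2:
  "PT (\<lambda>p. F (fst p) (snd p)) \<Longrightarrow> PT f \<Longrightarrow> PT g \<Longrightarrow> PT (\<lambda>e. F (f e) (g e))"
  using PT_comp[of "\<lambda>p. F (fst p) (snd p)" "\<lambda>e. (f e, g e)"] PT_Pair by force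

lemma PT_app3:
  "PT (\<lambda>p. F (fst p) (fst (snd p)) (snd (snd p))) \<Longrightarrow> PT f \<Longrightarrow> PT g \<Longrightarrow> PT h \<Longrightarrow>
    PT (\<lambda>e. F (f e) (g e) (h e))"
  using PT_app2[of "\<lambda>a b. F a (fst b) (snd b)" f "\<lambda>e. (g e, h e)"] PT_Pair by force

lemma PT_app4:
  "PT (\<lambda>p. F (fst p) (fst (snd p)) (fst (snd (snd p))) (snd (snd (snd p)))) \<Longrightarrow>
    PT f \<Longrightarrow> PT g \<Longrightarrow> PT h \<Longrightarrow> PT i \<Longrightarrow> PT (\<lambda>e. F (f e) (g e) (h e) (i e))"
  using PT_app3[of "\<lambda>a b c. F a b (fst c) (snd c)" f g "\<lambda>e. (h e, i e)"] PT_Pair by force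

lemma PT_imp: "PT p \<Longrightarrow> PT q \<Longrightarrow> PT (\<lambda>x. p x \<longrightarrow> q x)"
  by (rule PT_cong[OF PT_disj[OF PT_not[of p]]]) auto

lemmas PT_intros = PT_const PT_id PT_Pair PT_fst PT_snd PT_Cons PT_if PT_not PT_conj PT_disj PT_imp
  PT_take1 PT_append PT_map PT_filter PT_concat PT_bex PT_ball PT_add PT_mult PT_le PT_less PT_eq
  PT_length PT_sum_list PT_prod_list PT_nth0 PT_indices

lemma PT_item_count: "PT f \<Longrightarrow> PT (\<lambda>e. item_count (f e))"
  unfolding item_count_def by (intro PT_intros)

lemma PT_player_count: "PT f \<Longrightarrow> PT (\<lambda>e. player_count (f e))"
  unfolding player_count_def by (intro PT_intros)

lemma PT_items: "PT f \<Longrightarrow> PT (\<lambda>e. items (f e))"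
  by (rule PT_comp[of items]) (unfold items_def, intro PT_intros PT_item_count)

lemma PT_players: "PT f \<Longrightarrow> PT (\<lambda>e. players (f e))"
  by (rule PT_comp[of players]) (unfold players_def, intro PT_intros PT_player_count)

lemma PT_entry: "PT f \<Longrightarrow> PT g \<Longrightarrow> PT h \<Longrightarrow> PT (\<lambda>e. entry (f e) (g e) (h e))"
  by (rule PT_app3[of entry]) (unfold entry_def, intro PT_intros PT_item_count)

lemma PT_denominator: "PT f \<Longrightarrow> PT g \<Longrightarrow> PT h \<Longrightarrow> PT (\<lambda>e. denominator (f e) (g e) (h e))"
  by (rule PT_app3[of denominator]) (unfold denominator_def, intro PT_intros PT_entry)

lemma PT_weight: "PT f \<Longrightarrow> PT g \<Longrightarrow> PT h \<Longrightarrow> PT (\<lambda>e. weight (f e) (g e) (h e))"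
  by (rule PT_app3[of weight]) (unfold weight_def, intro PT_intros PT_entry PT_denominator PT_items)

lemma PT_total_weight: "PT f \<Longrightarrow> PT g \<Longrightarrow> PT (\<lambda>e. total_weight (f e) (g e))"
  by (rule PT_app2[of total_weight]) (unfold total_weight_def, intro PT_intros PT_weight PT_items)

lemma PT_pairs: "PT f \<Longrightarrow> PT g \<Longrightarrow> PT h \<Longrightarrow> PT (\<lambda>e. pairs (f e) (g e) (h e))"
  by (rule PT_app3[of pairs])
     (unfold pairs_def, intro PT_intros PT_weight PT_total_weight PT_items PT_players PT_player_count)

lemma PT_auction_step:
  fixes g h :: "'e::enc \<Rightarrow> (nat \<times> nat) list"
  assumes "PT f" "PT g" "PT h"
  shows "PT (\<lambda>e. auction_step (f e) (g e) (h e))"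
  by (rule PT_app3[of auction_step, OF _ assms])
     (unfold auction_step_def bid_def holds_def price_def, intro PT_intros)

lemma PT_bids:
  assumes "PT f" "PT g" shows "PT (\<lambda>e. bids (f e) (g e))"
proof (rule PT_app2[of bids, OF _ assms])
  have 1: "PT (\<lambda>q :: nat \<times> (nat \<times> nat) list \<times> nat list \<times> (nat \<times> nat) list.
      auction_step (player_count (fst (snd (snd q)))) (snd (snd (snd q))) (fst (snd q)))"
    by (intro PT_auction_step PT_player_count PT_intros)
  have 2: "PT (\<lambda>p :: nat list \<times> (nat \<times> nat) list. concat (map (\<lambda>_. fst p) (fst p)))"
    by (intro PT_intros PT_map[where h = "\<lambda>_ p. fst p"])
  \<comment> \<open>A round prepends at most one pair, and that pair is taken from the given
    list.\<close>
  have 3: "sz (auction_step (player_count (fst p)) (snd p) H) \<le> sz H + (sz x + sz p + 2) ^ 1"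
    for x :: nat and H and p :: "nat list \<times> (nat \<times> nat) list"
  proof -
    let ?n = "player_count (fst p)" and ?A = "snd p"
    consider "auction_step ?n ?A H = H" | q where "q \<in> set ?A" "auction_step ?n ?A H = q # H"
      using auction_step_cases by metis
    then show ?thesis
    proof cases
      case 2
      then show ?thesis using sz_elem[of q ?A] by (simp add: sz_prod[of p])
    qed simp
  qed
  show "PT (\<lambda>p. bids (fst p) (snd p))"
    unfolding bids_def
    by (rule PT_fold_additive[where g = "\<lambda>_ H p. auction_step (player_count (fst p)) (snd p) H",
          OF 1 2 PT_const 3])
qed

lemma PT_matching_size: "PT f \<Longrightarrow> PT g \<Longrightarrow> PT (\<lambda>e. matching_size (f e) (g e))"
  by (rule PT_app2[of matching_size])
     (unfold matching_size_def, intro PT_intros PT_bids PT_players)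

lemma PT_not_after:
  "PT f \<Longrightarrow> PT g \<Longrightarrow> PT h \<Longrightarrow> PT i \<Longrightarrow> PT (\<lambda>e. not_after (f e) (g e) (h e) (i e))"
  by (rule PT_app4[of not_after]) (unfold not_after_def, intro PT_intros PT_weight)

lemma PT_selected:
  "PT f \<Longrightarrow> PT g \<Longrightarrow> PT h \<Longrightarrow> PT i \<Longrightarrow> PT (\<lambda>e. selected (f e) (g e) (h e) (i e))"
  by (rule PT_app4[of selected])
     (unfold selected_def, intro PT_intros PT_matching_size PT_not_after PT_pairs)

lemma PT_feasible: "PT f \<Longrightarrow> PT g \<Longrightarrow> PT h \<Longrightarrow> PT (\<lambda>e. feasible (f e) (g e) (h e))"
  by (rule PT_app3[of feasible])
     (unfold feasible_def, intro PT_intros PT_matching_size PT_selected PT_pairs PT_weight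
       PT_total_weight PT_player_count PT_items)

lemma PT_is_centre: "PT f \<Longrightarrow> PT g \<Longrightarrow> PT (\<lambda>e. is_centre (f e) (g e))"
  by (rule PT_app2[of is_centre]) (unfold is_centre_def, intro PT_intros)

lemma PT_decide: "PT f \<Longrightarrow> PT (\<lambda>e. decide (f e))"
  by (rule PT_comp[of decide])
     (unfold decide_def, intro PT_intros PT_is_centre PT_feasible PT_items PT_players PT_player_count)

subsection \<open>Parsing\<close>

text \<open>The encoding lists the least significant bit first; consing reverses the bits into the
  order expected by \<open>bits_value\<close>.\<close>

definition parse_step :: "sym \<Rightarrow> bool list \<times> nat list \<Rightarrow> bool list \<times> nat list" where
  "parse_step s p = (if s = Sep then ([], bits_value (fst p) # snd p) else ((s = One) # fst p, snd p))"

definition parse :: "sym list \<Rightarrow> nat list" where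
  "parse w = rev (snd (fold parse_step w ([], [])))"

declare bits.simps [simp del]

lemma fold_parse_bits:
  "fold parse_step (bits n) (bs, xs) = (rev (map (\<lambda>s. s = One) (bits n)) @ bs, xs)"
proof -
  have "Sep \<notin> set (bits n)"
  proof (induction n rule: bits.induct)
    case (1 n)
    then show ?case by (cases "n = 0") (auto simp: bits.simps[of n] bits.simps[of 0])
  qed
  moreover have "Sep \<notin> set ss \<Longrightarrow>
      fold parse_step ss (bs, xs) = (rev (map (\<lambda>s. s = One) ss) @ bs, xs)" for ss bs
    by (induction ss arbitrary: bs) (auto simp: parse_step_def)
  ultimately show ?thesis by blast
qed

lemma bits_value_snoc: "bits_value (bs @ [b]) = 2 * bits_value bs + of_bool b"
  by (simp add: bits_value_def)

lemma bits_value_bits: "bits_value (rev (map (\<lambda>s. s = One) (bits n))) = n"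
proof (induction n rule: bits.induct)
  case (1 n)
  show ?case
  proof (cases "n = 0")
    case True
    then show ?thesis by (simp add: bits.simps[of 0] bits_value_def)
  next
    case False
    then have "bits_value (rev (map (\<lambda>s. s = One) (bits n))) = 2 * (n div 2) + of_bool (odd n)"
      using 1 by (simp add: bits.simps[of n] bits_value_snoc odd_iff_mod_2_eq_one)
    then show ?thesis by simp
  qed
qed

lemma parse_enc_nats: "parse (enc_nats xs) = xs"
proof -
  have "fold parse_step (enc_nats xs) ([], ys) = ([], rev xs @ ys)" for ys
  proof (induction xs arbitrary: ys)
    case (Cons x xs)
    have "enc_nats (x # xs) = bits x @ Sep # enc_nats xs" by (simp add: enc_nats_def)
    then show ?case using Cons by (simp add: fold_parse_bits parse_step_def[of Sep] bits_value_bits)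
  qed (simp add: enc_nats_def)
  then show ?thesis by (simp add: parse_def)
qed

lemma bits_value_less: "bits_value bs < 2 ^ length bs"
proof (induction bs)
  case (Cons b bs)
  then show ?case by (cases b) (simp_all add: bits_value_Cons)
qed (simp add: bits_value_def)

lemma PT_is_Sep: "PT f \<Longrightarrow> PT (\<lambda>e. f e = Sep)"
  by (rule PT_comp[OF PT_on_left]) (auto simp: enc_sym_def)

lemma PT_is_One: "PT f \<Longrightarrow> PT (\<lambda>e. f e = One)"
  by (rule PT_comp[OF PT_on_right]) (auto simp: enc_sym_def)

lemma PT_parse: "PT parse"
proof -
  \<comment> \<open>A potential argument: each pending bit reserves the six symbols it will occupy
    in a finished number, and a separator adds only two more. The additive rule does not apply,
    because the size of a finished number depends on the pending bits in the accumulator.\<close>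
  have inv: "sz (snd (fold parse_step w ([], []))) + 6 * length (fst (fold parse_step w ([], []))) \<le> 8 * length w + 1"
    for w
  proof (induction w rule: rev_induct)
    case (snoc s w)
    let ?p = "fold parse_step w ([], [])"
    have "bitlen (bits_value (fst ?p)) \<le> length (fst ?p)" by (simp add: bitlen_le_iff bits_value_less)
    then show ?case using snoc by (auto simp: parse_step_def[of s] sz_nat)
  qed simp
  have 1: "PT (\<lambda>q :: sym \<times> (bool list \<times> nat list) \<times> sym list. parse_step (fst q) (fst (snd q)))"
    unfolding parse_step_def by (intro PT_intros PT_bits_value PT_is_Sep PT_is_One)
  have "PT (\<lambda>w. fold parse_step w ([], []))"
  proof (rule PT_fold[where g = "\<lambda>s p _. parse_step s p" and U = "\<lambda>s. 12 * s + 4", OF 1 PT_id PT_const])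
    show "poly (\<lambda>s. 12 * s + 4)" by (intro poly_intros)
    fix w :: "sym list" and i
    let ?p = "fold parse_step (take i w) ([], [])"
    have "sz ?p = 1 + sz (fst ?p) + sz (snd ?p)" by (rule sz_prod)
    then have "sz ?p \<le> 8 * length (take i w) + 4" using inv[of "take i w"] sz_bool_list[of "fst ?p"] by simp
    also have "\<dots> \<le> 12 * sz w + 4" using length_le_sz[of w] by simp
    finally show "sz ?p \<le> 12 * sz w + 4" .
  qed
  from PT_rev[OF PT_snd[OF this]] show ?thesis by (rule PT_cong) (simp add: parse_def)
qed

subsection \<open>Correctness on encoded instances\<close>

lemma length_concat_uniform:
  "(\<And>ys. ys \<in> set xss \<Longrightarrow> length ys = k) \<Longrightarrow> length (concat xss) = length xss * k"
  by (induction xss) auto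

lemma nth_concat_uniform:
  assumes "\<And>ys. ys \<in> set xss \<Longrightarrow> length ys = k" "i < length xss" "r < k"
  shows "concat xss ! (i * k + r) = xss ! i ! r"
  using assms
proof (induction xss arbitrary: i)
  case (Cons ys xss)
  show ?case
  proof (cases i)
    case 0
    then show ?thesis using Cons.prems by (simp add: nth_append)
  next
    case (Suc i')
    then show ?thesis using Cons.prems Cons.IH[of i'] by (simp add: nth_append)
  qed
qed simp

definition instance_numbers :: "nat \<Rightarrow> (nat \<times> nat) list \<Rightarrow> nat \<Rightarrow> (nat \<Rightarrow> nat \<Rightarrow> rat) \<Rightarrow> nat list" where
  "instance_numbers m es n u = [m, length es] @ concat (map (\<lambda>(a, b). [a, b]) es) @ [n] @
      concat (concat (map (\<lambda>i. map (\<lambda>v. enc_rat (u i v)) [0..<m]) [1..<n+1]))"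

lemma enc_instance_numbers: "enc_instance m es n u = enc_nats (instance_numbers m es n u)"
  by (simp add: enc_instance_def instance_numbers_def)

context
  fixes m es n u xs
  assumes xs: "xs = instance_numbers m es n u"
begin

lemma instance_lengths:
  "length (concat (map (\<lambda>(a, b). [a, b]) es)) = 2 * length es"
  "length (concat (map (\<lambda>i. map (\<lambda>v. enc_rat (u i v)) [0..<m]) [1..<n+1])) = n * m"
  "length (concat (concat (map (\<lambda>i. map (\<lambda>v. enc_rat (u i v)) [0..<m]) [1..<n+1]))) = n * m * 2"
proof -
  show "length (concat (map (\<lambda>(a, b). [a, b]) es)) = 2 * length es"
    by (subst length_concat_uniform[where k = 2]) auto
  show 2: "length (concat (map (\<lambda>i. map (\<lambda>v. enc_rat (u i v)) [0..<m]) [1..<n+1])) = n * m"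
    by (subst length_concat_uniform[where k = m]) auto
  show "length (concat (concat (map (\<lambda>i. map (\<lambda>v. enc_rat (u i v)) [0..<m]) [1..<n+1]))) = n * m * 2"
    unfolding 2[symmetric]
    by (rule length_concat_uniform) (auto simp: enc_rat_def)
qed

lemma instance_length: "length xs = 3 + 2 * length es + 2 * (n * m)"
  unfolding xs instance_numbers_def by (simp only: length_append instance_lengths) simp

lemma instance_header:
  "item_count xs = m" "nth0 xs 1 = length es" "player_count xs = n"
proof -
  show 1: "nth0 xs 1 = length es" using instance_length by (simp add: nth0_def xs instance_numbers_def)
  show "item_count xs = m"
    using instance_length by (simp add: item_count_def nth0_def xs instance_numbers_def)
  have "xs ! (2 + 2 * length es) = n"
    using instance_lengths(1) by (simp add: xs instance_numbers_def nth_append)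
  then show "player_count xs = n"
    unfolding player_count_def 1 using instance_length by (simp add: nth0_def)
qed

lemma instance_edge:
  assumes "r < length es"
  shows "nth0 xs (2 + 2 * r) = fst (es ! r)" "nth0 xs (3 + 2 * r) = snd (es ! r)"
proof -
  let ?E = "concat (map (\<lambda>(a, b). [a, b]) es)"
  have e: "?E ! (r * 2 + i) = (map (\<lambda>(a, b). [a, b]) es) ! r ! i" if "i < 2" for i
    by (rule nth_concat_uniform) (use assms that in auto)
  have n: "xs ! (2 + i) = ?E ! i" if "i < 2 * length es" for i
    using that instance_lengths(1) by (simp add: xs instance_numbers_def nth_append)
  show "nth0 xs (2 + 2 * r) = fst (es ! r)"
    using n[of "2 * r"] e[of 0] assms instance_length
    by (simp add: nth0_def mult.commute split: prod.splits)
  have "3 + 2 * r = 2 + (1 + 2 * r)" by simp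
  then show "nth0 xs (3 + 2 * r) = snd (es ! r)"
    using n[of "1 + 2 * r"] e[of 1] assms instance_length
    by (simp only: nth0_def) (simp add: mult.commute split: prod.splits)
qed

lemma instance_entry:
  assumes "k < n" "v < m"
  shows "nth0 xs (entry xs k v) = nat (fst (quotient_of (u (Suc k) v)))"
    "denominator xs k v = nat (snd (quotient_of (u (Suc k) v)))"
proof -
  let ?I = "map (\<lambda>i. map (\<lambda>v. enc_rat (u i v)) [0..<m]) [1..<n+1]"
  have "k * m + v < n * m"
  proof -
    have "k * m + v < Suc k * m" using assms by simp
    also have "\<dots> \<le> n * m" using assms by (intro mult_le_mono1) simp
    finally show ?thesis .
  qed
  note lt = this
  have "concat ?I ! (k * m + v) = ?I ! k ! v"
    by (rule nth_concat_uniform) (use assms in \<open>auto simp del: upt_Suc\<close>)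
  also have "\<dots> = enc_rat (u (Suc k) v)" using assms by (simp del: upt_Suc)
  finally have I: "concat ?I ! (k * m + v) = enc_rat (u (Suc k) v)" .
  have e: "concat (concat ?I) ! ((k * m + v) * 2 + i) = concat ?I ! (k * m + v) ! i" if "i < 2" for i
    by (rule nth_concat_uniform[of "concat ?I" 2])
       (use lt that instance_lengths(2) in \<open>auto simp: enc_rat_def simp del: upt_Suc\<close>)
  have n: "xs ! (3 + 2 * length es + i) = concat (concat ?I) ! i" for i
    using instance_lengths(1) by (simp add: xs instance_numbers_def nth_append del: upt_Suc)
  have en: "entry xs k v = 3 + 2 * length es + (k * m + v) * 2"
    by (simp add: entry_def instance_header[simplified])
  show "nth0 xs (entry xs k v) = nat (fst (quotient_of (u (Suc k) v)))"
    unfolding en using n[of "(k * m + v) * 2"] e[of 0] lt instance_length I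
    by (simp add: nth0_def enc_rat_def del: upt_Suc)
  show "denominator xs k v = nat (snd (quotient_of (u (Suc k) v)))"
    unfolding denominator_def en using n[of "(k * m + v) * 2 + 1"] e[of 1] lt instance_length I
    by (simp add: nth0_def enc_rat_def del: upt_Suc)
qed

end

lemma fold_const: "fold (\<lambda>_. f) ys z = (f ^^ length ys) z"
  by (induction ys arbitrary: z) (auto simp: funpow_swap1)

lemma set_players: "player_count xs \<le> length xs \<Longrightarrow> set (players xs) = {..<player_count xs}"
  by (auto simp: players_def)

lemma set_items: "item_count xs \<le> length xs \<Longrightarrow> set (items xs) = {0..<item_count xs}"
  by (auto simp: items_def)

lemma distinct_items: "distinct (items xs)" and distinct_players: "distinct (players xs)"
  by (simp_all add: items_def players_def)

lemma matching_size_rank: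
  assumes n: "player_count xs < length xs" and A: "snd ` set A \<subseteq> {..<player_count xs}"
  shows "matching_size xs A = rank (set A)"
proof -
  let ?n = "player_count xs" and ?N = "length (concat (map (\<lambda>_. xs) xs))"
  let ?H = "(auction_step ?n A ^^ ?N) []"
  have H: "bids xs A = ?H" unfolding bids_def by (rule fold_const)
  have "?N = length xs * length xs" by (simp add: length_concat o_def sum_list_triv)
  moreover have "(?n + 1) * ?n \<le> length xs * length xs" using n by (intro mult_le_mono) auto
  ultimately have N: "(?n + 1) * ?n \<le> ?N" by simp
  have c: "card (snd ` set A) \<le> ?n" using card_mono[OF _ A] by simp
  have "set ?H \<subseteq> set A" using auction_iterate[of ?n A ?N] by (simp add: auction_inv_def)
  then have HP: "snd ` set ?H \<subseteq> {..<?n}" using A by blast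
  have "matching_size xs A = card (set (filter (\<lambda>k. \<exists>p\<in>set ?H. snd p = k) (players xs)))"
    unfolding matching_size_def H by (rule distinct_card[symmetric]) (simp add: distinct_players)
  also have "set (filter (\<lambda>k. \<exists>p\<in>set ?H. snd p = k) (players xs)) = snd ` set ?H"
    using HP set_players[of xs] n by auto
  also have "card (snd ` set ?H) = rank (set A)" by (rule auction_rank[OF c N])
  finally show ?thesis .
qed

lemma nonneg_rat_quotient:
  assumes "0 \<le> r"
  shows "r = of_nat (nat (fst (quotient_of r))) / of_nat (nat (snd (quotient_of r)))"
    and "nat (snd (quotient_of r)) > 0"
proof -
  obtain p q where pq: "quotient_of r = (p, q)" by (cases "quotient_of r")
  have q: "q > 0" by (rule quotient_of_denom_pos[OF pq])
  have r: "r = of_int p / of_int q" by (rule quotient_of_div[OF pq])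
  then have "p \<ge> 0" using assms q by (simp add: zero_le_divide_iff)
  then show "r = of_nat (nat (fst (quotient_of r))) / of_nat (nat (snd (quotient_of r)))"
    using r q pq by simp
  show "nat (snd (quotient_of r)) > 0" using q pq by simp
qed

section \<open>Correctness of the decision procedure\<close>

lemma decide_correct:
  assumes inst: "cfd_instance {0..<m} (edge_set es) n u" and star: "is_star {0..<m} (edge_set es)"
  shows "decide (instance_numbers m es n u) \<longleftrightarrow>
    has_proportional_allocation {0..<m} (edge_set es) n u"
proof (cases "n = 0")
  case True
  then show ?thesis
    by (simp add: decide_def instance_header[OF refl] has_proportional_allocation_def
        valid_allocation_def proportional_def)
next
  case False
  define xs where "xs = instance_numbers m es n u"
  let ?V = "{0..<m}" and ?E = "edge_set es" and ?w = "weight xs"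
  have m: "m > 0" using star by (auto simp: is_star_def)
  have hd: "item_count xs = m" "nth0 xs 1 = length es" "player_count xs = n"
    using instance_header[OF xs_def] by auto
  have len: "length xs = 3 + 2 * length es + 2 * (n * m)" by (rule instance_length[OF xs_def])
  have "n \<le> n * m" "m \<le> n * m" using m False by simp_all
  then have lt: "n < length xs" "m \<le> length xs" "length es \<le> length xs" using len by linarith+
  have items: "set (items xs) = ?V" and players: "set (players xs) = {..<n}"
    using set_items[of xs] set_players[of xs] lt hd by simp_all
  let ?p = "\<lambda>k v. nat (fst (quotient_of (u (Suc k) v)))"
  let ?q = "\<lambda>k v. nat (snd (quotient_of (u (Suc k) v)))"
  let ?D = "\<lambda>k. \<Prod>v\<in>?V. ?q k v"
  have nonneg: "0 \<le> u (Suc k) v" if "k < n" "v < m" for k v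
    using inst that by (auto simp: cfd_instance_def)
  have sum1: "(\<Sum>v\<in>?V. u (Suc k) v) = 1" if "k < n" for k
    using inst that by (auto simp: cfd_instance_def)
  have weight: "of_nat (?w k v) = u (Suc k) v * of_nat (?D k)" if k: "k < n" and v: "v < m" for k v
  proof -
    have "?w k v = ?p k v * (\<Prod>v'\<in>set (filter (\<lambda>v'. \<not> v' = v) (items xs)). denominator xs k v')"
      unfolding weight_def instance_entry(1)[OF xs_def k v]
      by (subst prod.distinct_set_conv_list) (simp_all add: distinct_items)
    also have "(\<Prod>v'\<in>set (filter (\<lambda>v'. \<not> v' = v) (items xs)). denominator xs k v') = (\<Prod>v'\<in>?V - {v}. ?q k v')"
      by (rule prod.cong) (use items instance_entry(2)[OF xs_def k] in auto)
    finally have w: "?w k v = ?p k v * (\<Prod>v'\<in>?V - {v}. ?q k v')" .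
    have D: "?D k = ?q k v * (\<Prod>v'\<in>?V - {v}. ?q k v')"
      by (rule prod.remove) (use v in auto)
    have "u (Suc k) v * of_nat (?D k) =
        of_nat (?p k v) / of_nat (?q k v) * of_nat (?q k v * (\<Prod>v'\<in>?V - {v}. ?q k v'))"
      unfolding D using nonneg_rat_quotient(1)[OF nonneg[OF k v]] by simp
    then show ?thesis unfolding w using nonneg_rat_quotient(2)[OF nonneg[OF k v]] by simp
  qed
  have total: "sum (?w k) ?V = ?D k" if k: "k < n" for k
  proof -
    have "(of_nat (sum (?w k) ?V) :: rat) = (\<Sum>v\<in>?V. u (Suc k) v * of_nat (?D k))"
      unfolding of_nat_sum by (rule sum.cong) (use weight[OF k] in auto)
    also have "\<dots> = of_nat (?D k)" using sum1[OF k] by (simp add: sum_distrib_right[symmetric])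
    finally show ?thesis by (simp only: of_nat_eq_iff)
  qed
  have pos: "sum (?w k) ?V > 0" if k: "k < n" for k
    unfolding total[OF k] by (rule prod_pos) (use nonneg_rat_quotient(2)[OF nonneg[OF k]] in auto)
  have u: "u (Suc k) v = of_nat (?w k v) / of_nat (sum (?w k) ?V)" if "k < n" "v \<in> ?V" for k v
  proof -
    have "(of_nat (?D k) :: rat) \<noteq> 0" using pos[OF that(1)] unfolding total[OF that(1)] by (simp only: of_nat_eq_0_iff)
    moreover have "of_nat (?w k v) = u (Suc k) v * of_nat (?D k)" using weight that by simp
    ultimately show ?thesis unfolding total[OF that(1)] by (simp only: nonzero_mult_div_cancel_right not_False_eq_True)
  qed
  have tw: "total_weight xs k = sum (?w k) ?V" for k
    unfolding total_weight_def
    by (subst sum_list_distinct_conv_sum_set) (simp_all add: distinct_items items)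
  have feas: "feasible xs c j \<longleftrightarrow> rank (acceptable ?V c n ?w j) + 1 = n \<and>
      sum (?w j) ?V \<le> n * sum (?w j) {v \<in> ?V. v = c \<or> \<not> chosen (?w j) (acceptable ?V c n ?w j) v}"
    for c j
  proof -
    let ?A = "pairs xs c j"
    have A: "set ?A = acceptable ?V c n ?w j"
      unfolding pairs_def acceptable_def using items players hd tw by auto
    have sub: "snd ` set ?A \<subseteq> {..<player_count xs}" using hd by (auto simp: A acceptable_def)
    have size: "matching_size xs (filter P ?A) = rank {p \<in> set ?A. P p}" for P
      using matching_size_rank[of xs "filter P ?A"] sub hd lt by auto
    have sel: "selected xs c j v \<longleftrightarrow> chosen (?w j) (set ?A) v" for v
      unfolding selected_def size chosen_def not_after_def precedes_def by simp
    have "sum_list (map (\<lambda>v. weight xs j v) (filter (\<lambda>v. v = c \<or> \<not> selected xs c j v) (items xs))) =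
        sum (?w j) {v \<in> ?V. v = c \<or> \<not> chosen (?w j) (set ?A) v}"
      unfolding sel by (subst sum_list_distinct_conv_sum_set) (simp_all add: distinct_items items)
    then show ?thesis
      unfolding feasible_def tw hd matching_size_rank[OF lt(1)[folded hd(3)] sub] A[symmetric] by simp
  qed
  have centre: "is_centre xs c \<longleftrightarrow> (\<forall>e\<in>?E. c \<in> e)" for c
  proof -
    have "is_centre xs c \<longleftrightarrow> (\<forall>r<length es. nth0 xs (2 + 2 * r) = c \<or> nth0 xs (3 + 2 * r) = c)"
    proof -
      have "set (filter (\<lambda>r. r < length es) [0..<length xs]) = {..<length es}" using lt(3) by auto
      then show ?thesis unfolding is_centre_def hd by (simp only: Ball_def lessThan_iff)
    qed
    also have "\<dots> \<longleftrightarrow> (\<forall>r<length es. fst (es ! r) = c \<or> snd (es ! r) = c)"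
      using instance_edge[OF xs_def] by simp
    also have "\<dots> \<longleftrightarrow> (\<forall>p\<in>set es. fst p = c \<or> snd p = c)" by (auto simp: all_set_conv_all_nth)
    also have "\<dots> \<longleftrightarrow> (\<forall>e\<in>?E. c \<in> e)"
    proof -
      have "?E = (\<lambda>p. {fst p, snd p}) ` set es" by (force simp: edge_set_def)
      then show ?thesis by auto
    qed
    finally show ?thesis .
  qed
  have iff: "has_proportional_allocation ?V ?E n u \<longleftrightarrow> (\<exists>j<n. feasible xs c j)"
    if "c \<in> ?V" "\<forall>e\<in>?E. c \<in> e" for c
    unfolding feas
    by (rule star_allocation_iff[OF star_centre[OF star that] that(1)]) (use False u pos in auto)
  have "decide xs \<longleftrightarrow> (\<exists>c\<in>?V. (\<forall>e\<in>?E. c \<in> e) \<and> (\<exists>j<n. feasible xs c j))"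
    unfolding decide_def items players centre hd using False by (simp only: Bex_def lessThan_iff simp_thms)
  also have "\<dots> \<longleftrightarrow> has_proportional_allocation ?V ?E n u"
  proof
    assume "\<exists>c\<in>?V. (\<forall>e\<in>?E. c \<in> e) \<and> (\<exists>j<n. feasible xs c j)"
    then obtain c where c: "c \<in> ?V" "\<forall>e\<in>?E. c \<in> e" "\<exists>j<n. feasible xs c j" by blast
    show "has_proportional_allocation ?V ?E n u" unfolding iff[OF c(1,2)] by (rule c(3))
  next
    assume p: "has_proportional_allocation ?V ?E n u"
    obtain c where c: "c \<in> ?V" "\<forall>e\<in>?E. c \<in> e" using star_centre_exists[OF star] by blast
    show "\<exists>c\<in>?V. (\<forall>e\<in>?E. c \<in> e) \<and> (\<exists>j<n. feasible xs c j)"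
      using p[unfolded iff[OF c]] c by (intro bexI[of _ c] conjI)
  qed
  finally show ?thesis unfolding xs_def .
qed

subsection \<open>From the input tape to a tree code\<close>

definition emit :: "sym \<Rightarrow> cmd" where
  "emit s = CSeq (Pop 2) (pushes 0 (One # code (enc s)))"

definition load_loop :: cmd where
  "load_loop = CWhile 2 nonblank (on_top 2 emit)"

text \<open>Pushing \<open>One\<close> and the code of a symbol onto the code of a list is consing.
  The input is first reversed into register 2, so the list is rebuilt in order; register 1 stays
  free because \<open>pushes 0\<close> clears it.\<close>

definition load :: cmd where
  "load = CSeq (mv 0 2) (CSeq (Push 0 Zero) load_loop)"

lemma sz_sym: "sz (s :: sym) \<le> 7"
  by (simp add: sz_def enc_sym_def enc_bool_def del: length_code_enc)

lemma emit:
  assumes "R 1 = []" "R 2 = s # rs"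
  shows "exec (emit s) R 10 (R(2 := rs, 0 := One # code (enc s) @ R 0))"
  unfolding emit_def
  by (rule exec_eq[OF exec_Seq[OF exec_Pop pushes]])
     (use assms sz_sym[of s] in \<open>auto simp: fun_eq_iff\<close>)

lemma load_loop:
  assumes "R 2 = rs" "Blank \<notin> set rs" "R 1 = []" "R 0 = code (enc ws)"
  shows "exec load_loop R (13 * length rs + 1) (R(2 := [], 0 := code (enc (rev rs @ ws))))"
  using assms
proof (induction rs arbitrary: R ws)
  case Nil
  have "exec load_loop R 1 R" unfolding load_loop_def by (rule exec_WhileF) (use Nil in simp)
  then show ?case by (rule exec_eq) (use Nil in \<open>auto simp: fun_eq_iff\<close>)
next
  case (Cons s rs)
  let ?R = "R(2 := rs, 0 := code (enc (s # ws)))"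
  have e: "exec (emit s) R 10 ?R"
    by (rule exec_eq[OF emit]) (use Cons.prems in auto)
  have 1: "exec (on_top 2 emit) R (10 + 2) ?R"
    by (rule on_top[where f = emit, OF _ _ e]) (use Cons.prems in auto)
  have 2: "exec load_loop ?R (13 * length rs + 1) (?R(2 := [], 0 := code (enc (rev rs @ s # ws))))"
    by (rule Cons.IH) (use Cons.prems in auto)
  have "exec load_loop R (10 + 2 + (13 * length rs + 1) + 1) (?R(2 := [], 0 := code (enc (rev rs @ s # ws))))"
    unfolding load_loop_def
    by (rule exec_WhileT[OF _ 1 2[unfolded load_loop_def]]) (use Cons.prems in auto)
  then show ?case by (rule exec_eq) (auto simp: fun_eq_iff)
qed

lemma load:
  assumes "Blank \<notin> set w"
  shows "exec load ((\<lambda>_. [])(0 := w)) (18 * length w + 3) ((\<lambda>_. [])(0 := code (enc w)))"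
proof -
  let ?s0 = "(\<lambda>_. [])(0 := w)" and ?s1 = "(\<lambda>_. [])(2 := rev w)"
  let ?s2 = "(\<lambda>_. [])(2 := rev w, 0 := [Zero])"
  have 1: "exec (mv 0 2) ?s0 (5 * length w + 1) ?s1"
    by (rule exec_eq[OF mv]) (use assms in \<open>auto simp: fun_eq_iff\<close>)
  have 2: "exec (Push 0 Zero) ?s1 1 ?s2"
    by (rule exec_eq[OF exec_Push]) (auto simp: fun_eq_iff)
  have 3: "exec load_loop ?s2 (13 * length w + 1) ((\<lambda>_. [])(0 := code (enc w)))"
    by (rule exec_eq[OF load_loop[where rs = "rev w" and ws = "[]"]])
       (use assms in \<open>auto simp: fun_eq_iff\<close>)
  show ?thesis unfolding load_def
    by (rule exec_eq[OF exec_Seq[OF 1 exec_Seq[OF 2 3]]]) auto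
qed

text \<open>For positive \<open>s\<close> one has \<open>s + 2 \<le> 3 * s\<close>; the additive
  constant takes care of \<open>s = 0\<close>.\<close>

lemma poly_explicit: "poly T \<Longrightarrow> \<exists>c d. \<forall>s. T s \<le> c * s ^ d + c"
proof -
  assume "poly T"
  then obtain k where k: "\<And>s. T s \<le> (s + 2) ^ k" unfolding poly_def by blast
  have "(s + 2) ^ k \<le> 3 ^ k * s ^ k + 3 ^ k" for s :: nat
  proof (cases "s = 0")
    case True
    have "(0 + 2) ^ k \<le> (3 :: nat) ^ k" by (rule power_mono) auto
    then show ?thesis unfolding True by (rule trans_le_add2)
  next
    case False
    then have "(s + 2) ^ k \<le> (3 * s) ^ k" by (intro power_mono) auto
    then show ?thesis by (simp add: power_mult_distrib)
  qed
  then show ?thesis using k order.trans by meson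
qed

theorem PT_decider:
  assumes "PT (f :: sym list \<Rightarrow> bool)"
  shows "\<exists>M c d. wf_tm M \<and> (\<forall>w. Blank \<notin> set w \<longrightarrow>
    (\<exists>k \<le> c * length w ^ d + c. decides_in M w k (f w)))"
proof -
  obtain p e where p: "computes p (\<lambda>s. (s + 2) ^ e) UNIV f" using assms by (auto simp: PT_on_def)
  let ?c = "CSeq load (p 0)"
  obtain K where K: "K > 0" "regs_below K ?c" using regs_below_exists by blast
  \<comment> \<open>\<open>8 * L + 1\<close> bounds the size of a list of \<open>L\<close> symbols:
    at most seven for each symbol, one for its node, and one for the final leaf.\<close>
  let ?t = "\<lambda>L. (18 * L + 3) + (8 * L + 1 + 2) ^ e"
  let ?T = "\<lambda>L. ?t L * (20 * (L + K + ?t L + 1)) + 2"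
  have "poly (\<lambda>L. (8 * L + 1 + 2) ^ e)" by (rule poly_comp_power) (intro poly_intros)
  then have "poly ?T" by (intro poly_intros)
  then obtain c d where cd: "\<And>L. ?T L \<le> c * L ^ d + c" using poly_explicit by blast
  have "\<exists>k \<le> c * length w ^ d + c. decides_in (tm_of (compile K ?c)) w k (f w)"
    if w: "Blank \<notin> set w" for w
  proof -
    have "sz w \<le> length w * (7 + 1) + 1" by (rule sz_list_le) (rule sz_sym)
    then have le: "(sz w + 2) ^ e \<le> (8 * length w + 1 + 2) ^ e" by (intro power_mono) auto
    have "exec (p 0) ((\<lambda>_. [])(0 := code (enc w))) ((sz w + 2) ^ e)
        ((\<lambda>_. [])(0 := code (enc w), 0 := code (enc (f w))))"
      by (rule computesD[OF p]) auto
    from exec_Seq[OF load[OF w] exec_relax[OF this le]]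
    have "exec ?c ((\<lambda>_. [])(0 := w)) (?t (length w)) ((\<lambda>_. [])(0 := code (enc w), 0 := code (enc (f w))))" .
    from cmd_to_tm[OF K(2,1) this w]
    obtain k where "k \<le> ?T (length w)" "decides_in (tm_of (compile K ?c)) w k (f w)"
      by (auto simp: top_code split: if_splits)
    then show ?thesis using cd[of "length w"] order.trans by blast
  qed
  then show ?thesis using wf_tm_of by blast
qed

theorem theorem2:
  "\<exists>M c d. wf_tm M \<and>
     (\<forall>m es n u.
        cfd_instance {0..<m} (edge_set es) n u \<and> is_star {0..<m} (edge_set es) \<longrightarrow>
        (\<exists>k \<le> c * length (enc_instance m es n u) ^ d + c.
           decides_in M (enc_instance m es n u) k
             (has_proportional_allocation {0..<m} (edge_set es) n u)))"
proof -
  obtain M c d where M: "wf_tm M" "\<And>w. Blank \<notin> set w \<Longrightarrow>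
      \<exists>k \<le> c * length w ^ d + c. decides_in M w k (decide (parse w))"
    using PT_decider[OF PT_decide[OF PT_parse]] by blast
  have bits: "Blank \<notin> set (bits n)" for n
  proof (induction n rule: bits.induct)
    case (1 n)
    then show ?case by (cases "n = 0") (auto simp: bits.simps[of n] bits.simps[of 0])
  qed
  have "Blank \<notin> set (enc_instance m es n u)" for m es n u
    unfolding enc_instance_def enc_nats_def using bits by auto
  note no_blank = this
  have "\<exists>k \<le> c * length (enc_instance m es n u) ^ d + c.
      decides_in M (enc_instance m es n u) k (has_proportional_allocation {0..<m} (edge_set es) n u)"
    if "cfd_instance {0..<m} (edge_set es) n u" "is_star {0..<m} (edge_set es)" for m es n u
    using M(2)[OF no_blank[of m es n u]] decide_correct[OF that]
    unfolding enc_instance_numbers parse_enc_nats by simp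
  then show ?thesis using M(1) by blast
qed

end
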